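(* \begin{align*} \sum_{\lambda,\eta} G_{\lambda /\!\!/ \mu}({\bf x};\boldsymbol{\alpha},\boldsymbol{\beta}) G_{\nu' /\!\!/ \eta'}(-{\bf x};\boldsymbol{\beta},\boldsymbol{\alpha}) g_{\lambda/\eta}({\bf y};\boldsymbol{\alpha},\boldsymbol{\beta})&=\prod_{i,j} \frac{1}{1-x_i y_j} g_{\mu/\nu}({\bf y};\boldsymbol{\alpha},\boldsymbol{\beta}), \\ \sum_{\lambda,\eta} g_{\lambda / \mu}({\bf x};\boldsymbol{\alpha},\boldsymbol{\beta}) g_{\nu' / \eta'}(-{\bf x};\boldsymbol{\beta},\boldsymbol{\alpha}) G_{\lambda /\!\!/ \eta}({\bf y};\boldsymbol{\alpha},\boldsymbol{\beta})&=\prod_{i,j} \frac{1}{1-x_i y_j} G_{\mu /\!\!/ \nu}({\bf y};\boldsymbol{\alpha},\boldsymbol{\beta}), \\ \sum_{\lambda,\eta} G_{\lambda' /\!\!/ \mu'}({\bf x};\boldsymbol{\beta},\boldsymbol{\alpha}) G_{\nu /\!\!/ \eta}(-{\bf x};\boldsymbol{\alpha},\boldsymbol{\beta}) g_{\lambda/\eta}({\bf y};\boldsymbol{\alpha},\boldsymbol{\beta})&=\prod_{i,j} (1+x_i y_j) g_{\mu/\nu}({\bf y};\boldsymbol{\alpha},\boldsymbol{\beta}), \\ \sum_{\lambda,\eta} g_{\lambda' / \mu'}({\bf x};\boldsymbol{\beta},\boldsymbol{\alpha}) g_{\nu / \eta}(-{\bf x};\boldsymbol{\alpha},\boldsymbol{\beta})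 G_{\lambda /\!\!/ \eta}({\bf y};\boldsymbol{\alpha},\boldsymbol{\beta})&=\prod_{i,j} (1+x_i y_j) G_{\mu /\!\!/ \nu}({\bf y};\boldsymbol{\alpha},\boldsymbol{\beta}). \end{align*}
   Context: Let $\boldsymbol{\alpha}=(\alpha_1,\alpha_2,\ldots)$, $\boldsymbol{\beta}=(\beta_1,\beta_2,\ldots)$ be parameters. Set $A_i=\{-\alpha_1,\dots,-\alpha_i\}$, $B_i=\{\beta_1,\dots,\beta_i\}$ for $i\ge1$ and $A_i=B_i=\emptyset$ for $i\le 0$; for $i\le j$ put $A_{[i,j]}=A_j\setminus A_{i-1}$, $A_{[i,j)}=A_{[i,j-1]}$, and for reversed intervals interpret $A_{[i,j)}$ as the formal negative alphabet $\emptyset/A_{[j,i)}$; similarly for $B$. Supersymmetric $h_m(\mathbf{x}/\mathbf{y})=\sum_k(-1)^{m-k}h_k(\mathbf{x})e_{m-k}(\mathbf{y})$, and $h_m(\mathbf{x}/\!\!/\mathbf{y}):=\sum_{a-b=m}h_a(\mathbf{x})h_b(\mathbf{y})$. The refined canonical Grothendieck functions are, for $\ell\ge\ell(\lambda)$, $\mathbf{x}_n=(x_1,\dots,x_n)$: $G_{\lambda/\!\!/\mu}(\mathbf{x}_n;\boldsymbol{\alpha},\boldsymbol{\beta})=\prod_{i=1}^\ell\prod_{j=1}^n(1-\beta_ix_j)\det[h_{\lambda_i-\mu_j-i+j}(\mathbf{x}_n/\!\!/(A_{[\mu_j,\lambda_i]}\sqcup B_{[i,j)}))]_{i,j=1}^\ell$,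 $g_{\lambda/\mu}(\mathbf{x}_n;\boldsymbol{\alpha},\boldsymbol{\beta})=\det[h_{\lambda_i-\mu_j-i+j}(\mathbf{x}_n\sqcup A_{[\lambda_i,\mu_j]}\sqcup B_{[j,i)})]_{i,j=1}^\ell$, extended to infinitely many variables. $\lambda'$ is the conjugate partition, $-\mathbf{x}$ means all variables negated, and $(\boldsymbol{\beta},\boldsymbol{\alpha})$ means the parameter sequences are swapped.
   Formalization: The displayed determinants depend on ℓ (e.g. G for λ=μ=∅ is 1 at ℓ=0 but ∏(1−β₁x_j) at ℓ=1), so G is taken as the limit ℓ→∞ of the displayed formula in formal power series, and g uses ℓ = max(ℓ(λ),ℓ(μ)). *)

theory Defs
  imports
    "HOL-Analysis.Infinite_Sum"
    "HOL-Library.Multiset"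
    "Jordan_Normal_Form.Determinant"
begin

section \<open>Formal power series in arbitrarily many variables\<close>

text \<open>A monomial in the variables \<open>'v\<close> is a finite multiset of variables.\<close>

typedef ('v, 'a) mps = "UNIV :: ('v multiset \<Rightarrow> 'a) set"
  morphisms coeff_mps Abs_mps ..

setup_lifting type_definition_mps

lemma mps_eqI: "(\<And>m. coeff_mps f m = coeff_mps g m) \<Longrightarrow> f = g"
  by (simp add: coeff_mps_inject[symmetric] fun_eq_iff)

definition splits :: "'v multiset \<Rightarrow> ('v multiset \<times> 'v multiset) set" where
  "splits m = {(a, b). a + b = m}"

lemma finite_splits [simp]: "finite (splits m)"
proof -
  let ?L = "{xs. set xs \<subseteq> set_mset m \<and> length xs \<le> size m}"
  have fin: "finite ?L" by (rule finite_lists_length_le) simp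
  have sub: "A \<in> mset ` ?L" if "A \<subseteq># m" for A
  proof -
    obtain xs where xs: "mset xs = A" by (metis ex_mset)
    have "set_mset A \<subseteq> set_mset m" using that by (rule set_mset_mono)
    hence "set xs \<subseteq> set_mset m" using xs by (metis set_mset_mset)
    moreover have "length xs \<le> size m" using size_mset_mono[OF that] xs by (metis size_mset)
    ultimately show ?thesis using xs by blast
  qed
  have "splits m \<subseteq> (mset ` ?L) \<times> (mset ` ?L)"
    unfolding splits_def using sub by fastforce
  thus ?thesis using fin by (meson finite_SigmaI finite_imageI finite_subset)
qed

lemma splits_empty [simp]: "splits {#} = {({#}, {#})}"
  by (auto simp: splits_def)

instantiation mps :: (type, comm_ring_1) comm_ring_1
begin

lift_definition zero_mps :: "('a, 'b) mps" is "\<lambda>_. 0" .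
lift_definition one_mps :: "('a, 'b) mps" is "\<lambda>m. if m = {#} then 1 else 0" .
lift_definition plus_mps :: "('a, 'b) mps \<Rightarrow> ('a, 'b) mps \<Rightarrow> ('a, 'b) mps"
  is "\<lambda>f g m. f m + g m" .
lift_definition minus_mps :: "('a, 'b) mps \<Rightarrow> ('a, 'b) mps \<Rightarrow> ('a, 'b) mps"
  is "\<lambda>f g m. f m - g m" .
lift_definition uminus_mps :: "('a, 'b) mps \<Rightarrow> ('a, 'b) mps"
  is "\<lambda>f m. - f m" .
lift_definition times_mps :: "('a, 'b) mps \<Rightarrow> ('a, 'b) mps \<Rightarrow> ('a, 'b) mps"
  is "\<lambda>f g m. \<Sum>(a, b)\<in>splits m. f a * g b" .

instance
proof
  fix f g h :: "('a, 'b) mps"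
  show "f + g + h = f + (g + h)" by transfer (simp add: add.assoc)
  show "f + g = g + f" by transfer (simp add: add.commute)
  show "0 + f = f" by transfer simp
  show "- f + f = 0" by transfer simp
  show "f - g = f + - g" by transfer simp
  show "(0::('a, 'b) mps) \<noteq> 1" by transfer (metis zero_neq_one)
  show "(f + g) * h = f * h + g * h"
    by transfer (simp add: case_prod_unfold distrib_right sum.distrib)
  show "1 * f = f"
  proof (transfer, rule ext)
    fix f :: "'a multiset \<Rightarrow> 'b" and m
    have "(\<Sum>(a, b)\<in>splits m. (if a = {#} then 1 else 0) * f b)
        = (\<Sum>(a, b)\<in>{({#} :: 'a multiset, m)}. (if a = {#} then 1 else 0) * f b)"
      by (rule sum.mono_neutral_right[OF finite_splits])
         (auto simp: splits_def split: if_splits)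
    thus "(\<Sum>(a, b)\<in>splits m. (if a = {#} then 1 else 0) * f b) = f m" by simp
  qed
  show "f * g = g * f"
  proof (transfer, rule ext)
    fix f g :: "'a multiset \<Rightarrow> 'b" and m
    show "(\<Sum>(a, b)\<in>splits m. f a * g b) = (\<Sum>(a, b)\<in>splits m. g a * f b)"
      by (rule sum.reindex_bij_witness[of _ "\<lambda>(a, b). (b, a)" "\<lambda>(a, b). (b, a)"])
         (auto simp: splits_def add.commute mult.commute)
  qed
  show "f * g * h = f * (g * h)"
  proof (transfer, rule ext)
    fix f g h :: "'a multiset \<Rightarrow> 'b" and m
    have "(\<Sum>(p, c)\<in>splits m. (\<Sum>(a, b)\<in>splits p. f a * g b) * h c)
        = (\<Sum>u\<in>splits m. \<Sum>v\<in>splits (fst u). f (fst v) * g (snd v) * h (snd u))"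
      by (simp add: case_prod_unfold sum_distrib_right)
    also have "\<dots> = (\<Sum>(u, v)\<in>Sigma (splits m) (\<lambda>u. splits (fst u)).
                      f (fst v) * g (snd v) * h (snd u))"
      by (rule sum.Sigma) auto
    also have "\<dots> = (\<Sum>(u, v)\<in>Sigma (splits m) (\<lambda>u. splits (snd u)).
                      f (fst u) * (g (fst v) * h (snd v)))"
      by (rule sum.reindex_bij_witness
            [of _ "\<lambda>(u, v). ((fst u + fst v, snd v), (fst u, fst v))"
                  "\<lambda>(u, v). ((fst v, snd v + snd u), (snd v, snd u))"])
         (auto simp: splits_def add.assoc mult.assoc)
    also have "\<dots> = (\<Sum>u\<in>splits m. \<Sum>v\<in>splits (snd u). f (fst u) * (g (fst v) * h (snd v)))"
      by (rule sum.Sigma[symmetric]) auto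
    also have "\<dots> = (\<Sum>(a, p)\<in>splits m. f a * (\<Sum>(b, c)\<in>splits p. g b * h c))"
      by (simp add: case_prod_unfold sum_distrib_left)
    finally show "(\<Sum>(p, c)\<in>splits m. (\<Sum>(a, b)\<in>splits p. f a * g b) * h c)
        = (\<Sum>(a, p)\<in>splits m. f a * (\<Sum>(b, c)\<in>splits p. g b * h c))" .
  qed
qed

end

text \<open>The topology of coefficientwise convergence: the product topology, with the
  discrete topology on the coefficients.\<close>

definition mps_nbhd :: "('v, 'a) mps \<Rightarrow> 'v multiset set \<Rightarrow> ('v, 'a) mps set" where
  "mps_nbhd f M = {g. \<forall>m\<in>M. coeff_mps g m = coeff_mps f m}"

instantiation mps :: (type, type) t2_space
begin

definition open_mps :: "('a, 'b) mps set \<Rightarrow> bool" where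
  "open_mps S \<longleftrightarrow> (\<forall>f\<in>S. \<exists>M. finite M \<and> mps_nbhd f M \<subseteq> S)"

instance
proof
  show "open (UNIV :: ('a, 'b) mps set)" by (auto simp: open_mps_def)
next
  fix S T :: "('a, 'b) mps set"
  assume S: "open S" and T: "open T"
  show "open (S \<inter> T)"
    unfolding open_mps_def
  proof
    fix f assume f: "f \<in> S \<inter> T"
    obtain M where M: "finite M" "mps_nbhd f M \<subseteq> S"
      using S f by (meson open_mps_def IntD1)
    obtain N where N: "finite N" "mps_nbhd f N \<subseteq> T"
      using T f by (meson open_mps_def IntD2)
    have "mps_nbhd f (M \<union> N) = mps_nbhd f M \<inter> mps_nbhd f N"
      by (simp add: mps_nbhd_def ball_Un Collect_conj_eq)
    with M N show "\<exists>M. finite M \<and> mps_nbhd f M \<subseteq> S \<inter> T"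
      by (metis Int_mono finite_UnI)
  qed
next
  fix K :: "('a, 'b) mps set set"
  assume K: "\<forall>S\<in>K. open S"
  show "open (\<Union>K)"
    unfolding open_mps_def
  proof
    fix f assume "f \<in> \<Union>K"
    then obtain S where S: "S \<in> K" "f \<in> S" by (rule UnionE)
    with K have "open S" by (rule_tac bspec)
    with S obtain M where "finite M" "mps_nbhd f M \<subseteq> S"
      by (meson open_mps_def)
    with S(1) show "\<exists>M. finite M \<and> mps_nbhd f M \<subseteq> \<Union>K"
      by (meson Union_upper subset_trans)
  qed
next
  fix f g :: "('a, 'b) mps"
  assume "f \<noteq> g"
  then obtain m where m: "coeff_mps f m \<noteq> coeff_mps g m" using mps_eqI by blast
  have nbhd: "mps_nbhd u {m} = {v. coeff_mps v m = coeff_mps u m}" for u :: "('a, 'b) mps"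
    by (simp add: mps_nbhd_def)
  have op: "open (mps_nbhd u {m})" for u :: "('a, 'b) mps"
    unfolding open_mps_def
  proof
    fix v assume "v \<in> mps_nbhd u {m}"
    hence "mps_nbhd v {m} \<subseteq> mps_nbhd u {m}" by (simp add: nbhd)
    thus "\<exists>M. finite M \<and> mps_nbhd v M \<subseteq> mps_nbhd u {m}" by (meson finite.intros)
  qed
  have "f \<in> mps_nbhd f {m}" "g \<in> mps_nbhd g {m}" by (simp_all add: nbhd)
  moreover have "mps_nbhd f {m} \<inter> mps_nbhd g {m} = {}"
    using m by (simp add: nbhd disjoint_iff)
  ultimately show "\<exists>U V. open U \<and> open V \<and> f \<in> U \<and> g \<in> V \<and> U \<inter> V = {}"
    using op by meson
qed

end

instantiation mps :: (type, comm_ring_1) inverse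
begin

definition inverse_mps :: "('a, 'b) mps \<Rightarrow> ('a, 'b) mps" where
  "inverse_mps f = (if f dvd 1 then (THE g. f * g = 1) else 0)"

definition divide_mps :: "('a, 'b) mps \<Rightarrow> ('a, 'b) mps \<Rightarrow> ('a, 'b) mps" where
  "divide_mps f g = f * inverse g"

instance ..

end

definition Var_mps :: "'v \<Rightarrow> ('v, 'a::comm_ring_1) mps" where
  "Var_mps v = Abs_mps (\<lambda>m. if m = {#v#} then 1 else 0)"

definition infprod :: "('i \<Rightarrow> 'r::{comm_monoid_mult, t2_space}) \<Rightarrow> 'i set \<Rightarrow> 'r" where
  "infprod f I = Lim (finite_subsets_at_top I) (prod f)"

datatype variable = X nat | Y nat | Alpha nat | Beta nat


section \<open>Partitions\<close>

definition is_partition :: "nat list \<Rightarrow> bool" where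
  "is_partition l \<longleftrightarrow> sorted_wrt (\<ge>) l \<and> 0 \<notin> set l"

definition part :: "nat list \<Rightarrow> nat \<Rightarrow> nat" where
  "part l i = (if 1 \<le> i \<and> i \<le> length l then l ! (i - 1) else 0)"

definition conj_partition :: "nat list \<Rightarrow> nat list" where
  "conj_partition l = map (\<lambda>j. card {i\<in>{1..length l}. part l i \<ge> j}) [1..<Suc (part l 1)]"


section \<open>Alphabets and complete symmetric functions\<close>

definition elem_sym :: "nat \<Rightarrow> 'r::comm_ring_1 list \<Rightarrow> 'r" where
  "elem_sym k xs = (\<Sum>I | I \<subseteq> {..<length xs} \<and> card I = k. \<Prod>i\<in>I. xs ! i)"

definition compl_sym :: "nat \<Rightarrow> 'r::comm_ring_1 list \<Rightarrow> 'r" where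
  "compl_sym k xs = (\<Sum>I | set_mset I \<subseteq> {..<length xs} \<and> size I = k. \<Prod>i\<in>#I. xs ! i)"

text \<open>The pair \<open>(P, N)\<close> stands for the supersymmetric alphabet \<open>P/N\<close>.\<close>

type_synonym 'r alphabet = "'r list \<times> 'r list"

definition alph_union :: "'r alphabet \<Rightarrow> 'r alphabet \<Rightarrow> 'r alphabet"  (infixl "\<squnion>\<^sub>a" 65) where
  "S \<squnion>\<^sub>a T = (fst S @ fst T, snd S @ snd T)"

definition super_h :: "int \<Rightarrow> 'r::comm_ring_1 alphabet \<Rightarrow> 'r" where
  "super_h m S =
     (if m < 0 then 0
      else \<Sum>k\<le>nat m. (-1) ^ (nat m - k) * compl_sym k (fst S) * elem_sym (nat m - k) (snd S))"

text \<open>\<open>h_dslash m S T\<close> is \<open>h\<^sub>m(S//T)\<close>.\<close>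

definition h_dslash :: "int \<Rightarrow> 'r alphabet \<Rightarrow> 'r alphabet \<Rightarrow> 'r::{comm_ring_1, t2_space}" where
  "h_dslash m S T =
     (\<Sum>\<^sub>\<infinity>(a, b)\<in>{(a :: nat, b :: nat). int a - int b = m}. super_h (int a) S * super_h (int b) T)"

definition alph_vars :: "(nat \<Rightarrow> 'r) \<Rightarrow> nat \<Rightarrow> 'r alphabet" where
  "alph_vars x n = (map x [1..<Suc n], [])"

text \<open>The letters \<open>c\<^sub>k\<close> with \<open>k \<ge> 1\<close> in the half-open interval \<open>[i, j)\<close>,
  as a negative alphabet if the interval is reversed.\<close>

definition alph_seg :: "(nat \<Rightarrow> 'r) \<Rightarrow> int \<Rightarrow> int \<Rightarrow> 'r alphabet" where
  "alph_seg c i j =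
     (if i \<le> j then (map (\<lambda>k. c (nat k)) [max 1 i..j - 1], [])
      else ([], map (\<lambda>k. c (nat k)) [max 1 j..i - 1]))"

definition A_closed :: "(nat \<Rightarrow> 'r::comm_ring_1) \<Rightarrow> int \<Rightarrow> int \<Rightarrow> 'r alphabet" where
  "A_closed \<alpha> i j = alph_seg (\<lambda>k. - \<alpha> k) i (j + 1)"

definition B_halfopen :: "(nat \<Rightarrow> 'r::comm_ring_1) \<Rightarrow> int \<Rightarrow> int \<Rightarrow> 'r alphabet" where
  "B_halfopen \<beta> i j = alph_seg \<beta> i j"


section \<open>Refined canonical Grothendieck functions\<close>

text \<open>Determinant of the matrix with rows and columns indexed by \<open>1, \<dots>, l\<close>.\<close>

definition det1 :: "nat \<Rightarrow> (nat \<Rightarrow> nat \<Rightarrow> 'r::comm_ring_1) \<Rightarrow> 'r" where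
  "det1 l F = det (mat l l (\<lambda>(i, j). F (Suc i) (Suc j)))"

definition G_jt ::
  "nat \<Rightarrow> nat list \<Rightarrow> nat list \<Rightarrow> nat \<Rightarrow> (nat \<Rightarrow> 'r) \<Rightarrow> (nat \<Rightarrow> 'r) \<Rightarrow> (nat \<Rightarrow> 'r)
   \<Rightarrow> 'r::{comm_ring_1, t2_space}" where
  "G_jt l lam mu n x \<alpha> \<beta> =
     (\<Prod>i=1..l. \<Prod>j=1..n. 1 - \<beta> i * x j) *
     det1 l (\<lambda>i j.
       h_dslash (int (part lam i) - int (part mu j) - int i + int j)
         (alph_vars x n)
         (A_closed \<alpha> (int (part mu j)) (int (part lam i)) \<squnion>\<^sub>a B_halfopen \<beta> (int i) (int j)))"

text \<open>
  The value of \<open>G_jt l\<close> is not independent of \<open>l \<ge> length lam\<close>: when \<open>l > length mu\<close> it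
  still carries the factor \<open>\<Prod>j=1..n. 1 - \<beta> l * x j\<close>.  For instance, for \<open>lam = mu = []\<close> it
  is \<open>1\<close> at \<open>l = 0\<close> and \<open>\<Prod>j=1..n. 1 - \<beta> 1 * x j\<close> at \<open>l = 1\<close>.  As a formal power series in
  \<open>x\<close>, \<open>\<alpha>\<close>, \<open>\<beta>\<close> it has a limit for \<open>l \<longlonglongrightarrow> \<infinity>\<close>, every coefficient being eventually constant;
  this stable value is the function that is dual to the functions \<open>g\<close> below.
\<close>

definition G_fin ::
  "nat list \<Rightarrow> nat list \<Rightarrow> nat \<Rightarrow> (nat \<Rightarrow> 'r) \<Rightarrow> (nat \<Rightarrow> 'r) \<Rightarrow> (nat \<Rightarrow> 'r)
   \<Rightarrow> 'r::{comm_ring_1, t2_space}" where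
  "G_fin lam mu n x \<alpha> \<beta> = lim (\<lambda>l. G_jt l lam mu n x \<alpha> \<beta>)"

definition G_fun ::
  "nat list \<Rightarrow> nat list \<Rightarrow> (nat \<Rightarrow> 'r) \<Rightarrow> (nat \<Rightarrow> 'r) \<Rightarrow> (nat \<Rightarrow> 'r)
   \<Rightarrow> 'r::{comm_ring_1, t2_space}" where
  "G_fun lam mu x \<alpha> \<beta> = lim (\<lambda>n. G_fin lam mu n x \<alpha> \<beta>)"

text \<open>The determinant has the same value for every size \<open>l \<ge> max (length lam) (length mu)\<close>,
  and vanishes unless \<open>mu\<close> is contained in \<open>lam\<close>.\<close>

definition g_fin ::
  "nat list \<Rightarrow> nat list \<Rightarrow> nat \<Rightarrow> (nat \<Rightarrow> 'r) \<Rightarrow> (nat \<Rightarrow> 'r) \<Rightarrow> (nat \<Rightarrow> 'r)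
   \<Rightarrow> 'r::comm_ring_1" where
  "g_fin lam mu n x \<alpha> \<beta> =
     det1 (max (length lam) (length mu)) (\<lambda>i j.
       super_h (int (part lam i) - int (part mu j) - int i + int j)
         (alph_vars x n \<squnion>\<^sub>a A_closed \<alpha> (int (part lam i)) (int (part mu j))
            \<squnion>\<^sub>a B_halfopen \<beta> (int j) (int i)))"

definition g_fun ::
  "nat list \<Rightarrow> nat list \<Rightarrow> (nat \<Rightarrow> 'r) \<Rightarrow> (nat \<Rightarrow> 'r) \<Rightarrow> (nat \<Rightarrow> 'r)
   \<Rightarrow> 'r::{comm_ring_1, t2_space}" where
  "g_fun lam mu x \<alpha> \<beta> = lim (\<lambda>n. g_fin lam mu n x \<alpha> \<beta>)"

end

theory Submission
  imports Defs "HOL-Computational_Algebra.Formal_Power_Series"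
begin

text \<open>
  Let \<open>S(x)\<close> be the matrix of skew Schur functions \<open>s\<^bsub>\<lambda>/\<mu>\<^esub>(x)\<close> and \<open>c\<close> the unitriangular matrix that
  expands the functions \<open>g\<close> in Schur functions. By the Cauchy--Binet formula the Jacobi--Trudi
  determinants factor as \<open>g(y) = c S(y) c\<^sup>-\<^sup>1\<close> and \<open>G(x) = c\<^sup>-\<^sup>T S(x) c\<^sup>T\<close>; for \<open>G\<close> this holds in the limit of
  large determinants, where the factors \<open>1 - \<beta>\<^sub>i x\<^sub>j\<close> are exactly those of the skew Cauchy identity
  \<open>S(x)\<^sup>T S(y) = (\<Prod> 1 / (1 - x\<^sub>i y\<^sub>j)) S(y) S(x)\<^sup>T\<close>. The identity for \<open>S\<close> reduces to one variable on each side,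
  where it is a bijection between horizontal strips. An identity between complementary minors shows
  that conjugating partitions while exchanging \<open>\<alpha>\<close> and \<open>\<beta>\<close> fixes \<open>c\<close> and turns \<open>S(-x)\<close> into \<open>S(x)\<^sup>-\<^sup>1\<close>.
  The four sums are then products such as \<open>G(x)\<^sup>T g(y) G(x)\<^sup>-\<^sup>T\<close>, and moving the first factor past
  the second leaves the product on the right-hand side.
\<close>

section \<open>The weight filtration\<close>

text \<open>The generating function of an alphabet on an interval is a quotient of a product up to
  one end by a product up to the other. Hence every entry is a row series times a series in
  \<open>x\<close> times a column series, which is what Cauchy--Binet needs. The closed intervals of
  the \<open>A\<close> alphabets against the half-open ones of the \<open>B\<close> alphabets
  produce an offset of one: where row and column series cancel to a polynomial, its degree is one
  below the exponent that is read off. This count yields both the inverse of \<open>c\<close> and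
  the invariance of \<open>c\<close> under conjugation. The obstacle is \<open>G\<close>. Its row
  and column series are taken at \<open>1 / z\<close>, and the column series would push beads below
  the window that \<open>l\<close> rows occupy. Moving the product of all
  \<open>1 / (1 - \<beta>\<^sub>k z)\<close> with \<open>k < l\<close> from the column series to the
  row series leaves polynomials that stay inside the window, at the price of conjugating
  \<open>S(x)\<close> by \<open>S(\<beta>\<^sub>1, \<dots>,
  \<beta>\<^sub>l\<^sub>-\<^sub>1)\<^sup>T\<close>. The skew Cauchy identity undoes the conjugation
  and consumes the prefactor, except for its factors with index \<open>l\<close>, which tend to
  1.\<close>

text \<open>Every weight bound leaves only finitely many monomials, because the weights of the variables
  grow with their indices; coefficientwise convergence is therefore convergence with respect to the
  filtration by weight, and the limits in the statement are limits of congruences.\<close>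

fun var_weight :: "variable \<Rightarrow> nat" where
  "var_weight (X k) = Suc k"
| "var_weight (Y k) = Suc k"
| "var_weight (Alpha k) = Suc k"
| "var_weight (Beta k) = Suc k"

definition weight :: "variable multiset \<Rightarrow> nat" where
  "weight m = (\<Sum>v\<in>#m. var_weight v)"

lemma weight_add [simp]: "weight (a + b) = weight a + weight b"
  by (simp add: weight_def)

definition ordge :: "nat \<Rightarrow> (variable, 'a::comm_ring_1) mps \<Rightarrow> bool" where
  "ordge N f \<longleftrightarrow> (\<forall>m. weight m < N \<longrightarrow> coeff_mps f m = 0)"

lemma coeff_mps_add [simp]: "coeff_mps (f + g) m = coeff_mps f m + coeff_mps g m"
  by (simp only: plus_mps.rep_eq)
lemma coeff_mps_diff [simp]: "coeff_mps (f - g) m = coeff_mps f m - coeff_mps g m"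
  by (simp only: minus_mps.rep_eq)
lemma coeff_mps_uminus [simp]: "coeff_mps (- f) m = - coeff_mps f m"
  by (simp only: uminus_mps.rep_eq)
lemma coeff_mps_zero [simp]: "coeff_mps 0 m = 0"
  by (subst zero_mps.rep_eq) (rule refl)
lemma coeff_mps_times: "coeff_mps (f * g) m = (\<Sum>(a, b)\<in>splits m. coeff_mps f a * coeff_mps g b)"
  by (simp add: times_mps.rep_eq)

lemma ordge_0 [simp]: "ordge 0 f"
  by (simp add: ordge_def)
lemma ordge_zero [simp]: "ordge N 0"
  by (simp add: ordge_def)
lemma ordge_mono: "ordge N f \<Longrightarrow> M \<le> N \<Longrightarrow> ordge M f"
  by (simp add: ordge_def)
lemma ordge_add: "ordge N f \<Longrightarrow> ordge N g \<Longrightarrow> ordge N (f + g)"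
  by (simp add: ordge_def)
lemma ordge_uminus [simp]: "ordge N (- f) = ordge N f"
  by (simp add: ordge_def)
lemma ordge_mult:
  assumes "ordge a f" "ordge b g"
  shows "ordge (a + b) (f * g)"
  unfolding ordge_def
proof (intro allI impI)
  fix m assume m: "weight m < a + b"
  have "coeff_mps f u * coeff_mps g v = 0" if "(u, v) \<in> splits m" for u v
  proof -
    have "weight u + weight v < a + b" using that m by (auto simp: splits_def)
    hence "weight u < a \<or> weight v < b" by linarith
    thus ?thesis using assms by (auto simp: ordge_def)
  qed
  thus "coeff_mps (f * g) m = 0"
    unfolding coeff_mps_times by (intro sum.neutral) auto
qed
lemma ordge_mult1: "ordge N f \<Longrightarrow> ordge N (f * g)"
  using ordge_mult[of N f 0 g] by simp
lemma ordge_mult2: "ordge N g \<Longrightarrow> ordge N (f * g)"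
  using ordge_mult[of 0 f N g] by simp
lemma ordge_sum: "(\<And>i. i \<in> A \<Longrightarrow> ordge N (f i)) \<Longrightarrow> ordge N (sum f A)"
  by (induction A rule: infinite_finite_induct) (auto intro: ordge_add)
lemma ordge_prod: "(\<And>i. i \<in> A \<Longrightarrow> ordge (n i) (f i)) \<Longrightarrow> ordge (sum n A) (prod f A)"
  by (induction A rule: infinite_finite_induct) (simp_all add: ordge_mult)
lemma ordge_power: "ordge n f \<Longrightarrow> ordge (k * n) (f ^ k)"
  by (induction k) (simp_all add: ordge_mult)
lemma ordge_all_zero: "(\<And>N. ordge N f) \<Longrightarrow> f = 0"
  by (rule mps_eqI) (auto simp: ordge_def)

section \<open>Congruences modulo weight, completeness and limits\<close>

definition eqv :: "nat \<Rightarrow> (variable, 'a::comm_ring_1) mps \<Rightarrow> (variable, 'a) mps \<Rightarrow> bool" where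
  "eqv N f g \<longleftrightarrow> ordge N (f - g)"

lemma eqv_coeff: "eqv N f g \<longleftrightarrow> (\<forall>m. weight m < N \<longrightarrow> coeff_mps f m = coeff_mps g m)"
  by (simp add: eqv_def ordge_def)
lemma eqv_refl [simp, intro]: "eqv N f f"
  by (simp add: eqv_coeff)
lemma eqv_sym: "eqv N f g \<Longrightarrow> eqv N g f"
  by (simp add: eqv_coeff)
lemma eqv_trans [trans]: "eqv N f g \<Longrightarrow> eqv N g h \<Longrightarrow> eqv N f h"
  by (simp add: eqv_coeff)
lemma eqv_mono: "eqv N f g \<Longrightarrow> M \<le> N \<Longrightarrow> eqv M f g"
  by (simp add: eqv_coeff)
lemma eqv_add: "eqv N f g \<Longrightarrow> eqv N f' g' \<Longrightarrow> eqv N (f + f') (g + g')"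
  by (simp add: eqv_coeff)
lemma eqv_mult:
  assumes "eqv N f g" "eqv N f' g'"
  shows "eqv N (f * f') (g * g')"
proof -
  have "f * f' - g * g' = (f - g) * f' + g * (f' - g')" by (simp add: algebra_simps)
  thus ?thesis using assms by (simp add: eqv_def ordge_add ordge_mult1 ordge_mult2)
qed
lemma eqv_sum: "(\<And>i. i \<in> A \<Longrightarrow> eqv N (f i) (g i)) \<Longrightarrow> eqv N (sum f A) (sum g A)"
  by (induction A rule: infinite_finite_induct) (auto intro: eqv_add)
lemma eqv_prod: "(\<And>i. i \<in> A \<Longrightarrow> eqv N (f i) (g i)) \<Longrightarrow> eqv N (prod f A) (prod g A)"
  by (induction A rule: infinite_finite_induct) (auto intro: eqv_mult)
lemma eqv_zero_iff: "eqv N f 0 \<longleftrightarrow> ordge N f"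
  by (simp add: eqv_def)
lemma eqv_all: "(\<And>N. eqv N f g) \<Longrightarrow> f = g"
  using ordge_all_zero[of "f - g"] by (simp add: eqv_def)

lemma eqv_sum_subset:
  assumes "finite B" "A \<subseteq> B" "\<And>i. i \<in> B - A \<Longrightarrow> ordge N (f i)"
  shows "eqv N (sum f B) (sum f A)"
proof -
  have "sum f B - sum f A = sum f (B - A)"
    using assms(1,2) by (simp add: sum.subset_diff)
  moreover have "ordge N (sum f (B - A))" by (rule ordge_sum) (rule assms(3))
  ultimately show ?thesis by (simp add: eqv_def)
qed

lemma eqv_prod_subset:
  assumes "finite B" "A \<subseteq> B" "\<And>i. i \<in> B - A \<Longrightarrow> eqv N (f i) 1"
  shows "eqv N (prod f B) (prod f A)"
proof -
  have "prod f B = prod f (B - A) * prod f A"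
    by (rule prod.subset_diff[OF assms(2,1)])
  moreover have "eqv N (prod f (B - A)) (\<Prod>i\<in>B - A. 1)"
    using assms(3) by (intro eqv_prod) auto
  ultimately show ?thesis
    using eqv_mult[of N "prod f (B - A)" 1 "prod f A" "prod f A"] by simp
qed

lemma eqv_stable:
  assumes "\<And>n. eqv n (s n) (s (Suc n))"
  shows "n \<le> k \<Longrightarrow> eqv n (s n) (s k)"
proof (induction k rule: dec_induct)
  case (step k)
  show ?case by (rule eqv_trans[OF step.IH]) (use assms[of k] step.hyps in \<open>auto intro: eqv_mono\<close>)
qed simp

lemma eqv_complete:
  assumes "\<And>n. eqv n (s n) (s (Suc n))"
  obtains t where "\<And>n. eqv n t (s n)"
proof -
  \<comment> \<open>The coefficient at \<open>m\<close> no longer changes from index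
    \<open>Suc (weight m)\<close> on, so it is read off there.\<close>
  define t where "t = Abs_mps (\<lambda>m. coeff_mps (s (Suc (weight m))) m)"
  have "eqv n t (s n)" for n
    unfolding eqv_coeff
  proof (intro allI impI)
    fix m assume "weight m < n"
    hence "eqv (Suc (weight m)) (s (Suc (weight m))) (s n)"
      using eqv_stable[of s "Suc (weight m)" n] assms by simp
    thus "coeff_mps t m = coeff_mps (s n) m"
      by (simp add: t_def Abs_mps_inverse eqv_coeff)
  qed
  thus ?thesis by (rule that)
qed

text \<open>A basic neighbourhood fixes finitely many coefficients, so it contains a whole
  congruence class for any \<open>N\<close> above their weights.\<close>

lemma tendsto_mpsI:
  assumes "\<And>N. eventually (\<lambda>n. eqv N (f n) s) F"
  shows "(f \<longlongrightarrow> s) F"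
  unfolding tendsto_def
proof (intro allI impI)
  fix S assume "open S" "s \<in> S"
  then obtain M where M: "finite M" "mps_nbhd s M \<subseteq> S" by (meson open_mps_def)
  define N where "N = Suc (Max (insert 0 (weight ` M)))"
  have N: "weight m < N" if "m \<in> M" for m
    using that M(1) by (auto simp: N_def less_Suc_eq_le)
  have "f n \<in> S" if "eqv N (f n) s" for n
    using that N M(2) by (auto simp: eqv_coeff mps_nbhd_def)
  thus "eventually (\<lambda>n. f n \<in> S) F"
    using assms[of N] by (rule eventually_mono[rotated])
qed

lemma lim_mpsI:
  assumes "\<And>N. eventually (\<lambda>n. eqv N (f n) s) sequentially"
  shows "lim f = s"
  by (rule limI, rule tendsto_mpsI, rule assms)

text \<open>When all terms outside \<open>F\<close> vanish modulo \<open>N\<close>, every finite set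
  between \<open>F\<close> and \<open>A\<close> has the same sum modulo \<open>N\<close>. So the net
  of partial sums is eventually congruent to \<open>s\<close>, in whatever order the terms are
  taken.\<close>

lemma has_sum_mpsI:
  assumes "\<And>N. \<exists>F\<subseteq>A. finite F \<and> eqv N (sum f F) s \<and> (\<forall>i\<in>A - F. ordge N (f i))"
  shows "(f has_sum s) A"
  unfolding has_sum_def
proof (rule tendsto_mpsI)
  fix N
  obtain F where F: "F \<subseteq> A" "finite F" "eqv N (sum f F) s" "\<And>i. i \<in> A - F \<Longrightarrow> ordge N (f i)"
    using assms[of N] by auto
  have "eqv N (sum f B) s" if "finite B" "F \<subseteq> B" "B \<subseteq> A" for B
    by (rule eqv_trans[OF eqv_sum_subset F(3)]) (use that F(4) in auto)
  thus "\<forall>\<^sub>F B in finite_subsets_at_top A. eqv N (sum f B) s"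
    unfolding eventually_finite_subsets_at_top using F by blast
qed

lemma infprod_mpsI:
  assumes "\<And>N. \<exists>F\<subseteq>A. finite F \<and> eqv N (prod f F) s \<and> (\<forall>i\<in>A - F. eqv N (f i) 1)"
  shows "infprod f A = s"
proof -
  have "(prod f \<longlongrightarrow> s) (finite_subsets_at_top A)"
  proof (rule tendsto_mpsI)
    fix N
    obtain F where F: "F \<subseteq> A" "finite F" "eqv N (prod f F) s" "\<And>i. i \<in> A - F \<Longrightarrow> eqv N (f i) 1"
      using assms[of N] by auto
    have "eqv N (prod f B) s" if "finite B" "F \<subseteq> B" "B \<subseteq> A" for B
      by (rule eqv_trans[OF eqv_prod_subset F(3)]) (use that F(4) in auto)
    thus "\<forall>\<^sub>F B in finite_subsets_at_top A. eqv N (prod f B) s"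
      unfolding eventually_finite_subsets_at_top using F by blast
  qed
  thus ?thesis unfolding infprod_def
    by (intro tendsto_Lim) (simp add: finite_subsets_at_top_neq_bot)
qed

text \<open>The inverse is the geometric series; its partial sums converge because
  \<open>t ^ n\<close> has weight at least \<open>n\<close>.\<close>

lemma one_minus_unit:
  assumes t: "ordge 1 t"
  obtains u where "(1 - t) * u = 1"
proof -
  define s where "s n = (\<Sum>k<n. t ^ k)" for n
  have "eqv n (s n) (s (Suc n))" for n
    using ordge_power[OF t, of n] by (simp add: s_def eqv_def)
  then obtain u where u: "\<And>n. eqv n u (s n)" by (rule eqv_complete) blast
  have "eqv n ((1 - t) * u) 1" for n
  proof -
    have "eqv n ((1 - t) * u) ((1 - t) * s n)" using u by (simp add: eqv_mult)
    also have "(1 - t) * s n = 1 - t ^ n"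
      by (simp add: s_def one_diff_power_eq)
    also have "eqv n \<dots> 1" using ordge_power[OF t, of n] by (simp add: eqv_def)
    finally show ?thesis .
  qed
  hence "(1 - t) * u = 1" by (rule eqv_all)
  thus ?thesis by (rule that)
qed

lemma mps_inverse:
  fixes f :: "(variable, 'a::comm_ring_1) mps"
  assumes "f * u = 1"
  shows "inverse f = u"
proof -
  have "f dvd 1" using assms by (intro dvdI[of 1 f u]) simp
  moreover have "(THE g. f * g = 1) = u"
  proof (rule the_equality)
    fix v assume v: "f * v = 1"
    have "v = (f * u) * v" using assms by simp
    also have "\<dots> = (f * v) * u" by (simp only: mult_ac)
    finally show "v = u" using v by simp
  qed (rule assms)
  ultimately show ?thesis by (simp add: inverse_mps_def)
qed

lemma one_minus_inverse:
  assumes "ordge N t" "N \<ge> 1"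
  shows "(1 - t) * (1 / (1 - t)) = 1" "eqv N (1 / (1 - t)) 1"
proof -
  have "ordge 1 t" using assms by (rule ordge_mono)
  then obtain u where u: "(1 - t) * u = 1" by (rule one_minus_unit)
  have eq: "1 / (1 - t) = u" using mps_inverse[OF u] by (simp add: divide_mps_def)
  show "(1 - t) * (1 / (1 - t)) = 1" using u eq by simp
  have "u - 1 = t * u" using u by (simp add: algebra_simps)
  thus "eqv N (1 / (1 - t)) 1" using eq assms by (simp add: eqv_def ordge_mult1)
qed

lemma ordge_Var: "ordge (var_weight v) (Var_mps v)"
  by (auto simp: ordge_def Var_mps_def Abs_mps_inverse weight_def)


section \<open>Determinants of matrices given by functions\<close>

definition fdet :: "nat \<Rightarrow> (nat \<Rightarrow> nat \<Rightarrow> 'r::comm_ring_1) \<Rightarrow> 'r" where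
  "fdet l F = det (mat l l (\<lambda>(i, j). F i j))"

lemma det1_fdet: "det1 l F = fdet l (\<lambda>i j. F (Suc i) (Suc j))"
  by (simp add: det1_def fdet_def)

lemma fdet_leibniz: "fdet l F = (\<Sum>p | p permutes {..<l}. signof p * (\<Prod>i<l. F i (p i)))"
proof -
  have "fdet l F = (\<Sum>p | p permutes {0..<l}. signof p * (\<Prod>i = 0..<l. mat l l (\<lambda>(i, j). F i j) $$ (i, p i)))"
    unfolding fdet_def by (rule det_def') simp
  also have "\<dots> = (\<Sum>p | p permutes {0..<l}. signof p * (\<Prod>i = 0..<l. F i (p i)))"
  proof (rule sum.cong[OF refl], rule arg_cong2[of _ _ _ _ "(*)"], rule refl, rule prod.cong[OF refl])
    fix p i assume "p \<in> {p. p permutes {0..<l}}" "i \<in> {0..<l}"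
    hence "p i \<in> {0..<l}" using permutes_in_image[of p "{0..<l}" i] by simp
    thus "mat l l (\<lambda>(i, j). F i j) $$ (i, p i) = F i (p i)" using \<open>i \<in> {0..<l}\<close> by simp
  qed
  finally show ?thesis by (simp add: atLeast0LessThan)
qed

lemma fdet_cong: "(\<And>i j. i < l \<Longrightarrow> j < l \<Longrightarrow> F i j = F' i j) \<Longrightarrow> fdet l F = fdet l F'"
  unfolding fdet_def by (rule arg_cong[of _ _ det], rule eq_matI) auto

lemma fdet_transpose: "fdet l (\<lambda>i j. F j i) = fdet l F"
proof -
  have "transpose_mat (mat l l (\<lambda>(i, j). F i j)) = mat l l (\<lambda>(i, j). F j i)"
    by (rule eq_matI) auto
  thus ?thesis unfolding fdet_def by (metis det_transpose mat_carrier)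
qed

lemma fdet_mult: "fdet n (\<lambda>i j. \<Sum>k<n. F i k * G k j) = fdet n F * fdet n G"
proof -
  have "mat n n (\<lambda>(i, j). F i j) * mat n n (\<lambda>(i, j). G i j) = mat n n (\<lambda>(i, j). \<Sum>k<n. F i k * G k j)"
    by (rule eq_matI) (auto simp: scalar_prod_def atLeast0LessThan)
  thus ?thesis unfolding fdet_def by (metis det_mult mat_carrier)
qed

text \<open>By counting, every permutation sends some row of \<open>R\<close> into \<open>C\<close>,
  so every Leibniz term has a zero factor. The vanishing arguments for Jacobi--Trudi determinants
  below all take this form.\<close>

lemma fdet_zero_block:
  assumes RC: "R \<subseteq> {..<l}" "C \<subseteq> {..<l}" "card R + card C > l"
    and z: "\<And>i j. i \<in> R \<Longrightarrow> j \<in> C \<Longrightarrow> F i j = 0"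
  shows "fdet l F = 0"
  unfolding fdet_leibniz
proof (rule sum.neutral, rule ballI)
  fix p assume "p \<in> {p. p permutes {..<l}}"
  hence p: "p permutes {..<l}" by simp
  have "p ` R \<inter> C \<noteq> {}"
  proof
    assume disj: "p ` R \<inter> C = {}"
    have "p ` R \<subseteq> {..<l}" using RC(1) permutes_in_image[OF p] by blast
    hence "card (p ` R \<union> C) \<le> card {..<l}" using RC(2) by (intro card_mono) auto
    moreover have "card (p ` R \<union> C) = card (p ` R) + card C"
      using RC(1,2) disj by (intro card_Un_disjoint) (auto intro: finite_subset)
    moreover have "card (p ` R) = card R"
      by (rule card_image) (rule inj_on_subset[OF permutes_inj[OF p]], simp)
    ultimately show False using RC(3) by simp
  qed
  then obtain i where "i \<in> R" "p i \<in> C" by blast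
  hence "F i (p i) = 0" "i < l" using z RC(1) by auto
  hence "(\<Prod>i<l. F i (p i)) = 0" by (intro prod_zero) auto
  thus "signof p * (\<Prod>i<l. F i (p i)) = 0" by simp
qed

lemma fdet_upper:
  assumes "\<And>i j. j < i \<Longrightarrow> i < l \<Longrightarrow> F i j = 0"
  shows "fdet l F = (\<Prod>i<l. F i i)"
proof -
  have "fdet l F = prod_list (diag_mat (mat l l (\<lambda>(i, j). F i j)))"
    unfolding fdet_def by (rule det_upper_triangular[of _ l]) (auto simp: assms)
  thus ?thesis by (simp add: prod_list_diag_prod atLeast0LessThan)
qed

lemma fdet_Suc_col:
  assumes "\<And>i. i < l \<Longrightarrow> F i l = 0"
  shows "fdet (Suc l) F = fdet l F * F l l"
proof -
  let ?A = "mat l l (\<lambda>(i, j). F i j)" and ?C = "mat 1 l (\<lambda>(i, j). F l j)" and ?D = "mat 1 1 (\<lambda>(i, j). F l l)"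
  have "mat (Suc l) (Suc l) (\<lambda>(i, j). F i j) = four_block_mat ?A (0\<^sub>m l 1) ?C ?D"
    by (rule eq_matI) (auto simp: assms less_Suc_eq)
  moreover have "det \<dots> = det ?A * det ?D"
    by (rule det_four_block_mat_upper_right_zero_col) auto
  moreover have "det ?D = F l l" by (subst det_single) auto
  ultimately show ?thesis by (simp add: fdet_def)
qed

lemma fdet_Suc_row:
  assumes "\<And>j. j < l \<Longrightarrow> F l j = 0"
  shows "fdet (Suc l) F = fdet l F * F l l"
proof -
  have "fdet (Suc l) (\<lambda>i j. F j i) = fdet l (\<lambda>i j. F j i) * F l l"
    by (rule fdet_Suc_col) (rule assms)
  thus ?thesis unfolding fdet_transpose[of "Suc l" F] fdet_transpose[of l F] .
qed

lemma fdet_Suc_first_col: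
  assumes "\<And>i. i < l \<Longrightarrow> F (Suc i) 0 = 0"
  shows "fdet (Suc l) F = F 0 0 * fdet l (\<lambda>i j. F (Suc i) (Suc j))"
proof -
  let ?A = "mat 1 1 (\<lambda>(i, j). F 0 0)" and ?B = "mat 1 l (\<lambda>(i, j). F 0 (Suc j))"
    and ?D = "mat l l (\<lambda>(i, j). F (Suc i) (Suc j))"
  have "mat (Suc l) (Suc l) (\<lambda>(i, j). F i j) = four_block_mat ?A ?B (0\<^sub>m l 1) ?D"
  proof (rule eq_matI)
    fix i j assume "i < dim_row (four_block_mat ?A ?B (0\<^sub>m l 1) ?D)"
      "j < dim_col (four_block_mat ?A ?B (0\<^sub>m l 1) ?D)"
    thus "mat (Suc l) (Suc l) (\<lambda>(i, j). F i j) $$ (i, j) = four_block_mat ?A ?B (0\<^sub>m l 1) ?D $$ (i, j)"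
      by (cases i; cases j) (auto simp: assms)
  qed auto
  moreover have "det \<dots> = det ?A * det ?D"
    by (rule det_four_block_mat_lower_left_zero_col) auto
  moreover have "det ?A = F 0 0" by (subst det_single) auto
  ultimately show ?thesis by (simp add: fdet_def)
qed

lemma fdet_Suc_first_row:
  assumes "\<And>j. j < l \<Longrightarrow> F 0 (Suc j) = 0"
  shows "fdet (Suc l) F = F 0 0 * fdet l (\<lambda>i j. F (Suc i) (Suc j))"
proof -
  have "fdet (Suc l) (\<lambda>i j. F j i) = F 0 0 * fdet l (\<lambda>i j. F (Suc j) (Suc i))"
    by (rule fdet_Suc_first_col) (rule assms)
  thus ?thesis
    unfolding fdet_transpose[of "Suc l" F] fdet_transpose[of l "\<lambda>i j. F (Suc i) (Suc j)"] .
qed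

text \<open>The matrix is the product of \<open>P\<close>, which keeps its first \<open>l\<close>
  rows above an identity block, and \<open>Q\<close>, which has an identity block above the
  remaining rows. In both factors the unit rows can be peeled off one at a time.\<close>

lemma fdet_block:
  assumes z: "\<And>i j. i < l \<Longrightarrow> l \<le> j \<Longrightarrow> j < l + k \<Longrightarrow> F i j = 0"
  shows "fdet (l + k) F = fdet l F * fdet k (\<lambda>i j. F (l + i) (l + j))"
proof -
  define P where "P i j = (if i < l then F i j else if i = j then 1 else 0)" for i j
  define Q where "Q i j = (if i < l then if i = j then 1 else 0 else F i j)" for i j
  have "fdet (l + k) F = fdet (l + k) (\<lambda>i j. \<Sum>t<l + k. P i t * Q t j)"
  proof (rule fdet_cong)
    fix i j assume ij: "i < l + k" "j < l + k"
    show "F i j = (\<Sum>t<l + k. P i t * Q t j)"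
    proof (cases "i < l")
      case True
      have "(\<Sum>t<l + k. P i t * Q t j) = (\<Sum>t<l + k. if t = j then F i j else 0)"
        using True z ij by (intro sum.cong) (auto simp: P_def Q_def)
      thus ?thesis using ij by simp
    next
      case False
      have "(\<Sum>t<l + k. P i t * Q t j) = (\<Sum>t<l + k. if t = i then F i j else 0)"
        using False by (intro sum.cong) (auto simp: P_def Q_def)
      thus ?thesis using ij by simp
    qed
  qed
  also have "\<dots> = fdet (l + k) P * fdet (l + k) Q" by (rule fdet_mult)
  also have "fdet (l + k) P = fdet l F"
  proof -
    have "fdet (l + k') P = fdet l P" for k'
    proof (induction k')
      case (Suc k')
      have "fdet (Suc (l + k')) P = fdet (l + k') P * P (l + k') (l + k')"
        by (rule fdet_Suc_row) (simp add: P_def)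
      moreover have "P (l + k') (l + k') = 1" by (simp add: P_def)
      ultimately show ?case using Suc by simp
    qed simp
    moreover have "fdet l P = fdet l F" by (rule fdet_cong) (simp add: P_def)
    ultimately show ?thesis by simp
  qed
  also have "fdet (l + k) Q = fdet k (\<lambda>i j. F (l + i) (l + j))"
  proof -
    have "n \<le> l \<Longrightarrow> fdet (n + k) (\<lambda>i j. Q (l - n + i) (l - n + j)) = fdet k (\<lambda>i j. Q (l + i) (l + j))" for n
    proof (induction n)
      case (Suc n)
      have sh: "l - Suc n + Suc i = l - n + i" for i using Suc.prems by simp
      have "fdet (Suc (n + k)) (\<lambda>i j. Q (l - Suc n + i) (l - Suc n + j))
          = Q (l - Suc n + 0) (l - Suc n + 0) * fdet (n + k) (\<lambda>i j. Q (l - Suc n + Suc i) (l - Suc n + Suc j))"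
        using Suc.prems by (intro fdet_Suc_first_row) (simp add: Q_def)
      also have "Q (l - Suc n + 0) (l - Suc n + 0) = 1" using Suc.prems by (simp add: Q_def)
      finally have "fdet (Suc n + k) (\<lambda>i j. Q (l - Suc n + i) (l - Suc n + j))
          = fdet (n + k) (\<lambda>i j. Q (l - n + i) (l - n + j))" unfolding sh by simp
      also have "\<dots> = fdet k (\<lambda>i j. Q (l + i) (l + j))" using Suc by simp
      finally show ?case .
    qed simp
    from this[of l] have "fdet (l + k) Q = fdet k (\<lambda>i j. Q (l + i) (l + j))" by simp
    thus ?thesis by (simp add: Q_def cong: if_cong)
  qed
  finally show ?thesis .
qed

lemma fdet_permute_rows:
  assumes p: "p permutes {..<l}"
  shows "fdet l (\<lambda>i j. F (p i) j) = signof p * fdet l F"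
proof -
  have p': "p permutes {0..<l}" using p by (simp add: atLeast0LessThan)
  have "fdet l (\<lambda>i j. F (p i) j) = det (mat l l (\<lambda>(i, j). mat l l (\<lambda>(i, j). F i j) $$ (p i, j)))"
    unfolding fdet_def
    by (rule arg_cong[of _ _ det], rule eq_matI) (use permutes_in_image[OF p] in auto)
  also have "\<dots> = signof p * fdet l F"
    unfolding fdet_def by (rule det_permute_rows[OF _ p']) simp
  finally show ?thesis .
qed

lemma fdet_identical_rows:
  assumes "i \<noteq> i'" "i < l" "i' < l" "\<And>j. j < l \<Longrightarrow> F i j = F i' j"
  shows "fdet l F = 0"
  unfolding fdet_def
  by (rule det_identical_rows[of _ l i i']) (use assms in \<open>auto intro!: eq_vecI\<close>)

lemma fdet_eqv:
  assumes "\<And>i j. i < l \<Longrightarrow> j < l \<Longrightarrow> eqv N (F i j) (F' i j)"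
  shows "eqv N (fdet l F) (fdet l F')"
  unfolding fdet_leibniz
proof (rule eqv_sum, rule eqv_mult[OF eqv_refl], rule eqv_prod)
  fix p i assume "p \<in> {p. p permutes {..<l}}" "i \<in> {..<l}"
  thus "eqv N (F i (p i)) (F' i (p i))" using assms permutes_in_image[of p "{..<l}" i] by simp
qed

section \<open>The Cauchy--Binet formula\<close>

definition decseqs :: "nat \<Rightarrow> nat \<Rightarrow> (nat \<Rightarrow> nat) set" where
  "decseqs l W = {s \<in> {..<l} \<rightarrow>\<^sub>E {..<W}. \<forall>i j. i < j \<longrightarrow> j < l \<longrightarrow> s j < s i}"

lemma decseqs_inj: "s \<in> decseqs l W \<Longrightarrow> inj_on s {..<l}"
  unfolding decseqs_def by (intro inj_onI) (metis (no_types, lifting) lessThan_iff less_irrefl linorder_neqE_nat mem_Collect_eq)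

text \<open>The rank of an entry from above is its position, so a decreasing sequence can be
  recovered from its image.\<close>

lemma decseqs_above:
  assumes "s \<in> decseqs l W" "j < l"
  shows "card {t \<in> s ` {..<l}. s j < t} = j"
proof -
  have mono: "s b < s a" if "a < b" "b < l" for a b using assms(1) that by (auto simp: decseqs_def)
  have "{t \<in> s ` {..<l}. s j < t} = s ` {..<j}"
  proof (rule Set.set_eqI, rule iffI)
    fix t assume "t \<in> {t \<in> s ` {..<l}. s j < t}"
    then obtain k where k: "k < l" "t = s k" "s j < s k" by auto
    have "k < j" using mono[of j k] k by (cases j k rule: linorder_cases) auto
    thus "t \<in> s ` {..<j}" using k by auto
  next
    fix t assume "t \<in> s ` {..<j}"
    thus "t \<in> {t \<in> s ` {..<l}. s j < t}" using mono assms(2) by auto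
  qed
  moreover have "inj_on s {..<j}"
    using decseqs_inj[OF assms(1)] by (rule inj_on_subset) (use assms(2) in auto)
  ultimately show ?thesis by (simp add: card_image)
qed

lemma decseqs_eqI:
  assumes s: "s \<in> decseqs l W" and t: "t \<in> decseqs l W" and im: "s ` {..<l} = t ` {..<l}"
  shows "s = t"
proof (rule PiE_ext)
  show "s \<in> {..<l} \<rightarrow>\<^sub>E {..<W}" "t \<in> {..<l} \<rightarrow>\<^sub>E {..<W}" using s t by (auto simp: decseqs_def)
  fix j assume j: "j \<in> {..<l}"
  then obtain k where k: "k < l" "s j = t k" using im by (metis (no_types, lifting) imageE imageI lessThan_iff)
  have "j = k" using decseqs_above[OF s, of j] decseqs_above[OF t, of k] j k im by simp
  thus "s j = t j" using k by simp
qed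

text \<open>This is sorting: an injective map is the decreasing enumeration of its image after
  exactly one permutation.\<close>

lemma decseqs_perm_bij:
  "bij_betw (\<lambda>(s, p). restrict (s \<circ> p) {..<l}) (decseqs l W \<times> {p. p permutes {..<l}})
     {f \<in> {..<l} \<rightarrow>\<^sub>E {..<W}. inj_on f {..<l}}"
  unfolding bij_betw_def
proof
  let ?h = "\<lambda>(s, p). restrict (s \<circ> p) {..<l}"
  show "inj_on ?h (decseqs l W \<times> {p. p permutes {..<l}})"
  proof (rule inj_onI, clarify)
    fix s p s' p'
    assume s: "s \<in> decseqs l W" and s': "s' \<in> decseqs l W"
      and p: "p permutes {..<l}" and p': "p' permutes {..<l}"
      and eq: "restrict (s \<circ> p) {..<l} = restrict (s' \<circ> p') {..<l}"
    have e: "s (p i) = s' (p' i)" if "i < l" for i using fun_cong[OF eq, of i] that by simp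
    have "s ` {..<l} = s ` p ` {..<l}" using permutes_image[OF p] by simp
    also have "\<dots> = s' ` p' ` {..<l}" unfolding image_image using e by (intro image_cong) auto
    also have "\<dots> = s' ` {..<l}" using permutes_image[OF p'] by simp
    finally have ss: "s = s'" by (rule decseqs_eqI[OF s s'])
    have "p i = p' i" for i
    proof (cases "i < l")
      case True
      hence "p i \<in> {..<l}" "p' i \<in> {..<l}" using permutes_in_image[OF p] permutes_in_image[OF p'] by auto
      thus ?thesis using e[OF True] ss inj_onD[OF decseqs_inj[OF s'], of "p i" "p' i"] by simp
    next
      case False
      thus ?thesis using permutes_not_in[OF p] permutes_not_in[OF p'] by simp
    qed
    thus "s = s' \<and> p = p'" using ss by auto
  qed
  show "?h ` (decseqs l W \<times> {p. p permutes {..<l}}) = {f \<in> {..<l} \<rightarrow>\<^sub>E {..<W}. inj_on f {..<l}}"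
  proof (rule Set.set_eqI, rule iffI)
    fix f assume "f \<in> ?h ` (decseqs l W \<times> {p. p permutes {..<l}})"
    then obtain s p where s: "s \<in> decseqs l W" and p: "p permutes {..<l}"
      and f: "f = restrict (s \<circ> p) {..<l}" by auto
    have "p i < l" if "i < l" for i using permutes_in_image[OF p, of i] that by simp
    hence "f \<in> {..<l} \<rightarrow>\<^sub>E {..<W}" using s by (simp add: f decseqs_def PiE_iff)
    moreover have "inj_on (s \<circ> p) {..<l}"
      by (rule comp_inj_on) (use permutes_inj_on[OF p] permutes_image[OF p] decseqs_inj[OF s] in auto)
    hence "inj_on f {..<l}" by (simp add: f)
    ultimately show "f \<in> {f \<in> {..<l} \<rightarrow>\<^sub>E {..<W}. inj_on f {..<l}}" by simp
  next
    fix f assume f0: "f \<in> {f \<in> {..<l} \<rightarrow>\<^sub>E {..<W}. inj_on f {..<l}}"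
    hence f: "f \<in> {..<l} \<rightarrow>\<^sub>E {..<W}" "inj_on f {..<l}" by auto
    let ?T = "f ` {..<l}"
    have cT: "card ?T = l" using f(2) by (simp add: card_image)
    obtain h where h: "bij_betw h {..<card ?T} ?T" "strict_mono_on {..<card ?T} h"
      by (rule ex_bij_betw_strict_mono_card[of ?T]) simp
    \<comment> \<open>\<open>h\<close> enumerates the image increasingly, hence the reversal of the
      index.\<close>
    define s where "s = restrict (\<lambda>i. h (l - 1 - i)) {..<l}"
    have sim: "s ` {..<l} = ?T"
    proof -
      have "(\<lambda>i. l - 1 - i) ` {..<l} = {..<l}"
      proof (rule Set.set_eqI, rule iffI)
        fix x assume "x \<in> {..<l}"
        hence "x = l - 1 - (l - 1 - x)" "l - 1 - x < l" by auto
        thus "x \<in> (\<lambda>i. l - 1 - i) ` {..<l}" by blast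
      qed auto
      hence "h ` (\<lambda>i. l - 1 - i) ` {..<l} = ?T" using h(1) cT by (simp add: bij_betw_def)
      thus ?thesis by (simp add: s_def image_image)
    qed
    have s: "s \<in> decseqs l W"
    proof -
      have "s i \<in> {..<W}" if "i < l" for i
      proof -
        have "s i \<in> f ` {..<l}" unfolding sim[symmetric] using that by simp
        then obtain k where "k < l" "s i = f k" by auto
        thus ?thesis using PiE_mem[OF f(1), of k] by simp
      qed
      hence "s \<in> {..<l} \<rightarrow>\<^sub>E {..<W}" by (simp add: s_def PiE_iff)
      moreover have "s j < s i" if "i < j" "j < l" for i j
        using that strict_mono_onD[OF h(2), of "l - 1 - j" "l - 1 - i"] cT by (simp add: s_def)
      ultimately show ?thesis by (simp add: decseqs_def)
    qed
    define p where "p i = (if i < l then inv_into {..<l} s (f i) else i)" for i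
    have sp: "s (p i) = f i" "p i < l" if "i < l" for i
    proof -
      have "f i \<in> s ` {..<l}" unfolding sim using that by simp
      thus "s (p i) = f i" "p i < l"
        using that f_inv_into_f[of "f i" s "{..<l}"] inv_into_into[of "f i" s "{..<l}"]
        by (simp_all add: p_def)
    qed
    have "inj_on p {..<l}"
    proof (rule inj_onI)
      fix i i' assume "i \<in> {..<l}" "i' \<in> {..<l}" "p i = p i'"
      hence "f i = f i'" using sp(1)[of i] sp(1)[of i'] by simp
      thus "i = i'" using inj_onD[OF f(2)] \<open>i \<in> {..<l}\<close> \<open>i' \<in> {..<l}\<close> by simp
    qed
    moreover have "p ` {..<l} \<subseteq> {..<l}" using sp(2) by auto
    ultimately have "bij_betw p {..<l} {..<l}" by (simp add: bij_betw_def endo_inj_surj)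
    hence "p permutes {..<l}" by (rule bij_imp_permutes) (simp add: p_def)
    moreover have "f = restrict (s \<circ> p) {..<l}"
    proof (rule ext)
      fix i show "f i = restrict (s \<circ> p) {..<l} i"
        using sp(1)[of i] f(1) by (cases "i < l") (auto simp: PiE_def extensional_def)
    qed
    ultimately show "f \<in> ?h ` (decseqs l W \<times> {p. p permutes {..<l}})"
      using s by (intro image_eqI[of _ _ "(s, p)"]) simp_all
  qed
qed

lemma finite_decseqs [simp]: "finite (decseqs l W)"
  by (rule finite_subset[of _ "{..<l} \<rightarrow>\<^sub>E {..<W}"]) (auto simp: decseqs_def intro: finite_PiE)

text \<open>Multilinearity in the rows gives a sum over all maps \<open>f\<close>. A map that is not
  injective contributes a determinant with two equal rows, and the injective ones are grouped by
  their image.\<close>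

lemma Cauchy_Binet:
  "fdet l (\<lambda>i j. \<Sum>u<W. A i u * B u j)
     = (\<Sum>s\<in>decseqs l W. fdet l (\<lambda>i j. A i (s j)) * fdet l (\<lambda>i j. B (s i) j))"
proof -
  let ?P = "{p. p permutes {..<l}}" and ?F = "{..<l} \<rightarrow>\<^sub>E {..<W}"
  have finP: "finite ?P" by (rule finite_permutations) simp
  have finF: "finite ?F" by (rule finite_PiE) auto
  let ?G = "\<lambda>f. (\<Prod>i<l. A i (f i)) * fdet l (\<lambda>i j. B (f i) j)"
  have "fdet l (\<lambda>i j. \<Sum>u<W. A i u * B u j)
      = (\<Sum>p\<in>?P. signof p * (\<Sum>f\<in>?F. \<Prod>i<l. A i (f i) * B (f i) (p i)))"
    unfolding fdet_leibniz by (subst prod_sum_PiE) auto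
  also have "\<dots> = (\<Sum>p\<in>?P. \<Sum>f\<in>?F. (\<Prod>i<l. A i (f i)) * (signof p * (\<Prod>i<l. B (f i) (p i))))"
    by (simp add: sum_distrib_left prod.distrib mult_ac)
  also have "\<dots> = (\<Sum>f\<in>?F. \<Sum>p\<in>?P. (\<Prod>i<l. A i (f i)) * (signof p * (\<Prod>i<l. B (f i) (p i))))"
    by (rule sum.swap)
  also have "\<dots> = sum ?G ?F"
    by (simp add: fdet_leibniz sum_distrib_left)
  also have "\<dots> = sum ?G {f \<in> ?F. inj_on f {..<l}}"
  proof (rule sum.mono_neutral_right[OF finF], blast, rule ballI)
    fix f assume "f \<in> ?F - {f \<in> ?F. inj_on f {..<l}}"
    then obtain i i' where "i < l" "i' < l" "i \<noteq> i'" "f i = f i'" by (auto simp: inj_on_def)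
    hence "fdet l (\<lambda>i j. B (f i) j) = 0" by (intro fdet_identical_rows[of i i']) auto
    thus "?G f = 0" by simp
  qed
  also have "\<dots> = (\<Sum>x\<in>decseqs l W \<times> ?P. ?G ((\<lambda>(s, p). restrict (s \<circ> p) {..<l}) x))"
    by (rule sum.reindex_bij_betw[OF decseqs_perm_bij, symmetric])
  also have "\<dots> = (\<Sum>(s, p)\<in>decseqs l W \<times> ?P.
      (signof p * (\<Prod>i<l. A i (s (p i)))) * fdet l (\<lambda>i j. B (s i) j))"
  proof (rule sum.cong[OF refl], clarify)
    fix s p assume p: "p permutes {..<l}"
    have "fdet l (\<lambda>i j. B (restrict (s \<circ> p) {..<l} i) j) = fdet l (\<lambda>i j. B (s (p i)) j)"
      by (rule fdet_cong) simp
    also have "\<dots> = signof p * fdet l (\<lambda>i j. B (s i) j)"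
      using fdet_permute_rows[OF p, of "\<lambda>i j. B (s i) j"] .
    finally show "?G (restrict (s \<circ> p) {..<l})
        = (signof p * (\<Prod>i<l. A i (s (p i)))) * fdet l (\<lambda>i j. B (s i) j)"
      by (simp add: mult_ac)
  qed
  also have "\<dots> = (\<Sum>s\<in>decseqs l W. \<Sum>p\<in>?P.
      (signof p * (\<Prod>i<l. A i (s (p i)))) * fdet l (\<lambda>i j. B (s i) j))"
    by (rule sum.cartesian_product[symmetric])
  also have "\<dots> = (\<Sum>s\<in>decseqs l W. fdet l (\<lambda>i j. A i (s j)) * fdet l (\<lambda>i j. B (s i) j))"
    by (rule sum.cong[OF refl]) (simp add: fdet_leibniz[of l "\<lambda>i j. A i (s j)" for s] sum_distrib_right)
  finally show ?thesis .
qed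


section \<open>Partitions and matrices indexed by partitions\<close>

text \<open>With a type of partitions, matrix indices range over the whole type and carry no side
  condition \<open>is_partition\<close>.\<close>

typedef ptn = "{l. is_partition l}" morphisms plist Ptn
  by (rule exI[of _ "[]"]) (simp add: is_partition_def)

definition pt :: "ptn \<Rightarrow> nat \<Rightarrow> nat" where "pt p i = part (plist p) (Suc i)"
definition plen :: "ptn \<Rightarrow> nat" where "plen p = length (plist p)"
definition psize :: "ptn \<Rightarrow> nat" where "psize p = sum_list (plist p)"

lemma plist_partition: "is_partition (plist p)"
  using plist by simp

lemma pt_nth: "pt p i = (if i < plen p then plist p ! i else 0)"
  by (auto simp: pt_def part_def plen_def)

lemma pt_antimono: "i \<le> j \<Longrightarrow> pt p j \<le> pt p i"
  using plist_partition[of p] sorted_wrt_nth_less[of "(\<ge>)" "plist p" i j]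
  by (cases "i = j") (auto simp: pt_nth is_partition_def plen_def)

lemma pt_zero: "plen p \<le> i \<Longrightarrow> pt p i = 0"
  by (simp add: pt_nth)

lemma pt_pos:
  assumes "i < plen p"
  shows "pt p i > 0"
proof -
  have "plist p ! i \<in> set (plist p)" using assms by (simp add: plen_def)
  hence "plist p ! i \<noteq> 0" using plist_partition[of p] by (metis is_partition_def)
  thus ?thesis using assms by (simp add: pt_nth)
qed

lemma psize_sum: "plen p \<le> l \<Longrightarrow> psize p = (\<Sum>i<l. pt p i)"
proof -
  assume l: "plen p \<le> l"
  have "psize p = (\<Sum>i<plen p. pt p i)"
    by (simp add: psize_def sum_list_sum_nth pt_nth plen_def atLeast0LessThan)
  also have "\<dots> = (\<Sum>i<l. pt p i)"
    using l by (intro sum.mono_neutral_left) (auto simp: pt_zero)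
  finally show ?thesis .
qed

lemma plen_le: "(\<And>i. l \<le> i \<Longrightarrow> pt p i = 0) \<Longrightarrow> plen p \<le> l"
  by (rule ccontr) (metis not_le order_refl pt_pos less_irrefl)

lemma ptn_eqI:
  assumes "\<And>i. pt p i = pt q i"
  shows "p = q"
proof -
  have "plen p = plen q"
    using plen_le[of "plen p" q] plen_le[of "plen q" p] assms by (metis le_antisym pt_zero)
  moreover have "plist p ! i = plist q ! i" if "i < plen p" for i
    using assms[of i] that calculation by (simp add: pt_nth)
  ultimately have "plist p = plist q" by (intro nth_equalityI) (auto simp: plen_def)
  thus ?thesis by (simp add: plist_inject)
qed

lemma ptn_exists:
  assumes anti: "\<And>i j. i \<le> j \<Longrightarrow> f j \<le> (f i :: nat)" and z: "f l = 0"
  obtains p where "\<And>i. pt p i = f i" "plen p \<le> l"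
proof -
  \<comment> \<open>Cutting at the first zero discards all zero parts, which the list of a partition
    must not contain.\<close>
  define n where "n = (LEAST n. f n = 0)"
  have n: "f n = 0" "n \<le> l" using z by (auto simp: n_def intro: LeastI Least_le)
  have bead: "f i > 0" if "i < n" for i using not_less_Least[of i "\<lambda>n. f n = 0"] that by (auto simp: n_def)
  have "is_partition (map f [0..<n])"
    using bead by (force simp: is_partition_def sorted_wrt_map sorted_wrt_iff_nth_less intro: anti)
  hence pl: "plist (Ptn (map f [0..<n])) = map f [0..<n]" by (simp add: Ptn_inverse)
  have "pt (Ptn (map f [0..<n])) i = f i" for i
    using anti[of n i] n(1) by (auto simp: pt_nth plen_def pl)
  moreover have "plen (Ptn (map f [0..<n])) \<le> l" using n(2) by (simp add: plen_def pl)
  ultimately show ?thesis by (rule that)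
qed

lemma pt_le_psize: "pt p i \<le> psize p"
proof (cases "i < plen p")
  case True
  thus ?thesis unfolding psize_sum[OF order_refl] by (intro member_le_sum) auto
qed (simp add: pt_zero)

lemma plen_le_psize: "plen p \<le> psize p"
proof -
  have "(\<Sum>i<plen p. 1) \<le> (\<Sum>i<plen p. pt p i)" by (intro sum_mono) (simp add: Suc_leI pt_pos)
  thus ?thesis by (simp add: psize_sum[OF order_refl])
qed

lemma finite_psize [simp]: "finite {p. psize p \<le> K}"
proof (rule finite_imageD)
  show "inj_on plist {p. psize p \<le> K}" by (auto simp: inj_on_def plist_inject)
  have "plist p \<in> {xs. set xs \<subseteq> {..K} \<and> length xs \<le> K}" if "psize p \<le> K" for p
    using order_trans[OF plen_le_psize that] that
    by (auto simp: psize_def plen_def dest: member_le_sum_list)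
  hence "plist ` {p. psize p \<le> K} \<subseteq> {xs. set xs \<subseteq> {..K} \<and> length xs \<le> K}" by blast
  thus "finite (plist ` {p. psize p \<le> K})"
    by (rule finite_subset) (simp add: finite_lists_length_le)
qed

text \<open>With parts numbered from \<open>0\<close>, \<open>bead l p j\<close> is \<open>p\<^sub>j - (j + 1)\<close> shifted by \<open>l\<close> into
  the natural numbers; it is meaningful for \<open>j < l\<close> only.\<close>

definition bead :: "nat \<Rightarrow> ptn \<Rightarrow> nat \<Rightarrow> nat" where
  "bead l p j = pt p j + (l - 1 - j)"

definition pbox :: "nat \<Rightarrow> nat \<Rightarrow> ptn set" where
  "pbox l K = {p. plen p \<le> l \<and> pt p 0 \<le> K}"

lemma bead_diff:
  "i < l \<Longrightarrow> j < l \<Longrightarrow> int (bead l p i) - int (bead l q j) = int (pt p i) - int (pt q j) - int i + int j"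
  by (simp add: bead_def of_nat_diff)

text \<open>Beads are parts plus a staircase. A strictly decreasing sequence drops by at least one
  at each step, so subtracting the staircase leaves a weakly decreasing sequence, and the bound
  \<open>l + K\<close> becomes the bound \<open>K\<close> on the first part.\<close>

lemma bead_bij: "bij_betw (\<lambda>p. restrict (bead l p) {..<l}) (pbox l K) (decseqs l (l + K))"
  unfolding bij_betw_def
proof
  show "inj_on (\<lambda>p. restrict (bead l p) {..<l}) (pbox l K)"
  proof (rule inj_onI, rule ptn_eqI)
    fix p q i assume pq: "p \<in> pbox l K" "q \<in> pbox l K"
      and eq: "restrict (bead l p) {..<l} = restrict (bead l q) {..<l}"
    show "pt p i = pt q i"
      using fun_cong[OF eq, of i] pq by (cases "i < l") (auto simp: bead_def pbox_def pt_zero)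
  qed
  show "(\<lambda>p. restrict (bead l p) {..<l}) ` pbox l K = decseqs l (l + K)"
  proof (rule Set.set_eqI, rule iffI)
    fix s assume "s \<in> (\<lambda>p. restrict (bead l p) {..<l}) ` pbox l K"
    then obtain p where p: "p \<in> pbox l K" and s: "s = restrict (bead l p) {..<l}" by auto
    have "bead l p i < l + K" if "i < l" for i
      using pt_antimono[of 0 i p] p that by (auto simp: bead_def pbox_def)
    moreover have "bead l p j < bead l p i" if "i < j" "j < l" for i j
      using pt_antimono[of i j p] that by (auto simp: bead_def)
    ultimately show "s \<in> decseqs l (l + K)" by (auto simp: s decseqs_def)
  next
    fix s assume s: "s \<in> decseqs l (l + K)"
    have step: "s j + (j - i) \<le> s i" if "i \<le> j" "j < l" for i j
      using that
    proof (induction j rule: dec_induct)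
      case (step n)
      have "s (Suc n) < s n" using s step by (auto simp: decseqs_def)
      thus ?case using step by simp
    qed simp
    define f where "f j = (if j < l then s j - (l - 1 - j) else 0)" for j
    have ge: "l - 1 - j \<le> s j" if "j < l" for j using step[of j "l - 1"] that by linarith
    have anti: "f j \<le> f i" if "i \<le> j" for i j
      using step[of i j] that by (auto simp: f_def)
    have fl: "f l = 0" by (simp add: f_def)
    obtain p where p: "\<And>i. pt p i = f i" "plen p \<le> l"
      using ptn_exists[of f l, OF anti fl] by blast
    have "pt p 0 \<le> K"
    proof (cases "l = 0")
      case False
      hence "s 0 < l + K" using s by (auto simp: decseqs_def)
      thus ?thesis using False by (simp add: p f_def)
    qed (simp add: p f_def)
    hence "p \<in> pbox l K" using p by (simp add: pbox_def)
    moreover have "s = restrict (bead l p) {..<l}"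
    proof (rule ext)
      fix i show "s i = restrict (bead l p) {..<l} i"
        using s ge[of i] by (cases "i < l") (auto simp: bead_def p f_def decseqs_def PiE_def extensional_def)
    qed
    ultimately show "s \<in> (\<lambda>p. restrict (bead l p) {..<l}) ` pbox l K" by blast
  qed
qed

lemma finite_pbox [simp]: "finite (pbox l K)"
  using bead_bij[of l K] finite_decseqs by (metis bij_betw_finite)

lemma Cauchy_Binet_pbox:
  "fdet l (\<lambda>i j. \<Sum>u<l + K. A i u * B u j)
     = (\<Sum>p\<in>pbox l K. fdet l (\<lambda>i j. A i (bead l p j)) * fdet l (\<lambda>i j. B (bead l p i) j))"
proof -
  let ?r = "\<lambda>p. restrict (bead l p) {..<l}"
  have "fdet l (\<lambda>i j. \<Sum>u<l + K. A i u * B u j)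
      = (\<Sum>p\<in>pbox l K. fdet l (\<lambda>i j. A i (?r p j)) * fdet l (\<lambda>i j. B (?r p i) j))"
    unfolding Cauchy_Binet by (rule sum.reindex_bij_betw[OF bead_bij, symmetric])
  also have "\<dots> = (\<Sum>p\<in>pbox l K. fdet l (\<lambda>i j. A i (bead l p j)) * fdet l (\<lambda>i j. B (bead l p i) j))"
    by (intro sum.cong refl arg_cong2[of _ _ _ _ "(*)"] fdet_cong) simp_all
  finally show ?thesis .
qed


section \<open>Matrices indexed by partitions\<close>

definition pdist :: "ptn \<Rightarrow> ptn \<Rightarrow> nat" where
  "pdist p q = (psize p - psize q) + (psize q - psize p)"

lemma pdist_triangle: "pdist p q \<le> pdist p r + pdist r q"
  by (simp add: pdist_def)
lemma pdist_same [simp]: "pdist p p = 0"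
  by (simp add: pdist_def)
lemma pdist_sym: "pdist p q = pdist q p"
  by (simp add: pdist_def)

text \<open>The decay of the entries away from the diagonal blocks makes every matrix product converge,
  so these matrices form a monoid and the identities below are plain noncommutative algebra.\<close>

typedef (overloaded) 'a pmat =
  "{A :: ptn \<Rightarrow> ptn \<Rightarrow> (variable, 'a::comm_ring_1) mps. \<forall>p q. ordge (pdist p q) (A p q)}"
  morphisms ent Pmat
  by (rule exI[of _ "\<lambda>_ _. 0"]) simp

lemma ent_ordge: "ordge (pdist p q) (ent A p q)"
  using ent[of A] by simp

lemma pmat_eqI: "(\<And>p q. ent A p q = ent B p q) \<Longrightarrow> A = B"
  by (simp add: ent_inject[symmetric] fun_eq_iff)

lemma ent_Pmat: "(\<And>p q. ordge (pdist p q) (F p q)) \<Longrightarrow> ent (Pmat F) = F"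
  by (simp add: Pmat_inverse)

text \<open>The sum over all intermediate partitions is infinite, so the product is specified by its
  truncations: an \<open>r\<close> with \<open>psize r > psize p + N\<close> only adds terms of
  weight above \<open>N\<close>. The congruences leave no freedom in the choice.\<close>

definition pprod :: "'a pmat \<Rightarrow> 'a::comm_ring_1 pmat \<Rightarrow> ptn \<Rightarrow> ptn \<Rightarrow> (variable, 'a) mps" where
  "pprod A B p q = (SOME s. \<forall>N. eqv N s (\<Sum>r | psize r \<le> psize p + N. ent A p r * ent B r q))"

lemma ent_mult_ordge: "ordge (pdist p r + pdist r q) (ent A p r * ent B r q)"
  by (intro ordge_mult ent_ordge)

lemma pprod_eqv: "eqv N (pprod A B p q) (\<Sum>r | psize r \<le> psize p + N. ent A p r * ent B r q)"
proof -
  define s where "s N = (\<Sum>r | psize r \<le> psize p + N. ent A p r * ent B r q)" for N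
  have "eqv n (s n) (s (Suc n))" for n
    unfolding s_def
    by (rule eqv_sym, rule eqv_sum_subset)
      (auto intro!: ordge_mono[OF ent_mult_ordge] simp: pdist_def)
  then obtain t where "\<And>n. eqv n t (s n)" by (rule eqv_complete) blast
  hence "\<exists>t. \<forall>N. eqv N t (s N)" by blast
  hence "\<forall>N. eqv N (SOME t. \<forall>N. eqv N t (s N)) (s N)" by (rule someI_ex)
  thus ?thesis by (simp add: pprod_def s_def)
qed

lemma pprod_ordge: "ordge (pdist p q) (pprod A B p q)"
proof -
  have "ordge (pdist p q) (\<Sum>r | psize r \<le> psize p + pdist p q. ent A p r * ent B r q)"
    by (intro ordge_sum ordge_mono[OF ent_mult_ordge] pdist_triangle)
  thus ?thesis using pprod_eqv[of "pdist p q" A B p q]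
    by (metis eqv_trans eqv_zero_iff)
qed

instantiation pmat :: (comm_ring_1) times
begin
definition "A * B = Pmat (pprod A B)"
instance ..
end

instantiation pmat :: (comm_ring_1) one
begin
definition "1 = Pmat (\<lambda>p q. if p = q then 1 else 0)"
instance ..
end

lemma ent_one: "ent 1 p q = (if p = q then 1 else 0)"
  unfolding one_pmat_def by (subst ent_Pmat) auto

lemma ent_mult_approx:
  assumes T: "finite T" and z: "\<And>r. r \<notin> T \<Longrightarrow> ordge N (ent A p r * ent B r q)"
  shows "eqv N (ent (A * B) p q) (\<Sum>r\<in>T. ent A p r * ent B r q)"
proof -
  let ?S = "{r. psize r \<le> psize p + N}"
  let ?f = "\<lambda>r. ent A p r * ent B r q"
  have "eqv N (ent (A * B) p q) (sum ?f ?S)"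
    unfolding times_pmat_def ent_Pmat[OF pprod_ordge] by (rule pprod_eqv)
  also have "eqv N \<dots> (sum ?f (?S \<union> T))"
    by (rule eqv_sym, rule eqv_sum_subset)
      (use T in \<open>auto intro!: ordge_mono[OF ent_mult_ordge] simp: pdist_def\<close>)
  also have "eqv N \<dots> (sum ?f T)"
    by (rule eqv_sum_subset) (use T z in auto)
  finally show ?thesis .
qed

text \<open>Both factors decay, so the truncation may be measured from either outer index; products
  of several matrices use both.\<close>

lemma ent_mult_size:
  assumes "psize p + N \<le> K \<or> psize q + N \<le> K"
  shows "eqv N (ent (A * B) p q) (\<Sum>r | psize r \<le> K. ent A p r * ent B r q)"
  by (rule ent_mult_approx)
    (use assms in \<open>auto intro!: ordge_mono[OF ent_mult_ordge] simp: pdist_def\<close>)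

lemma ent_mult_finite:
  assumes T: "finite T" and z: "\<And>r. r \<notin> T \<Longrightarrow> ent A p r * ent B r q = 0"
  shows "ent (A * B) p q = (\<Sum>r\<in>T. ent A p r * ent B r q)"
  by (rule eqv_all, rule ent_mult_approx) (use assms in auto)

instance pmat :: (comm_ring_1) monoid_mult
proof
  fix A B C :: "'a pmat"
  show "1 * A = A"
  proof (rule pmat_eqI)
    fix p q show "ent (1 * A) p q = ent A p q"
      by (subst ent_mult_finite[of "{p}"]) (auto simp: ent_one)
  qed
  show "A * 1 = A"
  proof (rule pmat_eqI)
    fix p q show "ent (A * 1) p q = ent A p q"
      by (subst ent_mult_finite[of "{q}"]) (auto simp: ent_one)
  qed
  show "A * B * C = A * (B * C)"
  proof (rule pmat_eqI, rule eqv_all)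
    fix p q N
    \<comment> \<open>One window serves all four products, being large enough relative to
      \<open>p\<close> and to \<open>q\<close>; associativity modulo \<open>N\<close> is then an
      exchange of two finite sums.\<close>
    define K where "K = psize p + psize q + N"
    let ?T = "{r. psize r \<le> K}"
    have "eqv N (ent (A * B * C) p q) (\<Sum>r\<in>?T. ent (A * B) p r * ent C r q)"
      by (rule ent_mult_size) (simp add: K_def)
    also have "eqv N \<dots> (\<Sum>r\<in>?T. (\<Sum>t\<in>?T. ent A p t * ent B t r) * ent C r q)"
      by (intro eqv_sum eqv_mult ent_mult_size eqv_refl) (simp add: K_def)
    also have "(\<Sum>r\<in>?T. (\<Sum>t\<in>?T. ent A p t * ent B t r) * ent C r q)
        = (\<Sum>r\<in>?T. \<Sum>t\<in>?T. ent A p t * (ent B t r * ent C r q))"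
      by (simp add: sum_distrib_right mult.assoc)
    also have "\<dots> = (\<Sum>t\<in>?T. \<Sum>r\<in>?T. ent A p t * (ent B t r * ent C r q))"
      by (rule sum.swap)
    also have "\<dots> = (\<Sum>t\<in>?T. ent A p t * (\<Sum>r\<in>?T. ent B t r * ent C r q))"
      by (simp add: sum_distrib_left)
    also have "eqv N \<dots> (\<Sum>t\<in>?T. ent A p t * ent (B * C) t q)"
      by (intro eqv_sum eqv_mult eqv_sym[OF ent_mult_size] eqv_refl) (simp add: K_def)
    also have "eqv N \<dots> (ent (A * (B * C)) p q)"
      by (rule eqv_sym, rule ent_mult_size) (simp add: K_def)
    finally show "eqv N (ent (A * B * C) p q) (ent (A * (B * C)) p q)" .
  qed
qed

definition tr :: "'a::comm_ring_1 pmat \<Rightarrow> 'a pmat" where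
  "tr A = Pmat (\<lambda>p q. ent A q p)"

lemma ent_tr [simp]: "ent (tr A) p q = ent A q p"
proof -
  have "ordge (pdist p q) (ent A q p)" for p q using ent_ordge[of q p A] by (simp add: pdist_sym)
  thus ?thesis unfolding tr_def by (subst ent_Pmat) auto
qed

lemma tr_tr [simp]: "tr (tr A) = A"
  by (rule pmat_eqI) simp

lemma tr_mult: "tr (A * B) = tr B * tr A"
proof (rule pmat_eqI, rule eqv_all)
  fix p q N
  let ?T = "{r. psize r \<le> psize p + psize q + N}"
  have "eqv N (ent (tr (A * B)) p q) (\<Sum>r\<in>?T. ent A q r * ent B r p)"
    by (simp, rule ent_mult_size) simp
  also have "\<dots> = (\<Sum>r\<in>?T. ent (tr B) p r * ent (tr A) r q)" by (simp add: mult.commute)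
  also have "eqv N \<dots> (ent (tr B * tr A) p q)"
    by (rule eqv_sym, rule ent_mult_size) simp
  finally show "eqv N (ent (tr (A * B)) p q) (ent (tr B * tr A) p q)" .
qed

lemma tr_one [simp]: "tr 1 = 1"
  by (rule pmat_eqI) (simp add: ent_one)

definition smul :: "(variable, 'a::comm_ring_1) mps \<Rightarrow> 'a pmat \<Rightarrow> 'a pmat" where
  "smul c A = Pmat (\<lambda>p q. c * ent A p q)"

lemma ent_smul [simp]: "ent (smul c A) p q = c * ent A p q"
  unfolding smul_def by (subst ent_Pmat) (auto intro: ordge_mult2 ent_ordge)

lemma smul_one [simp]: "smul 1 A = A"
  by (rule pmat_eqI) simp

lemma smul_smul [simp]: "smul a (smul b A) = smul (a * b) A"
  by (rule pmat_eqI) (simp add: mult.assoc)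

lemma tr_smul [simp]: "tr (smul c A) = smul c (tr A)"
  by (rule pmat_eqI) simp

lemma smul_mult_left: "smul c A * B = smul c (A * B)"
proof (rule pmat_eqI, rule eqv_all)
  fix p q N
  let ?T = "{r. psize r \<le> psize p + N}"
  have "eqv N (ent (smul c A * B) p q) (\<Sum>r\<in>?T. ent (smul c A) p r * ent B r q)"
    by (rule ent_mult_size) simp
  also have "\<dots> = c * (\<Sum>r\<in>?T. ent A p r * ent B r q)" by (simp add: sum_distrib_left mult.assoc)
  also have "eqv N \<dots> (c * ent (A * B) p q)"
    by (intro eqv_mult eqv_refl eqv_sym[OF ent_mult_size]) simp
  finally show "eqv N (ent (smul c A * B) p q) (ent (smul c (A * B)) p q)" by simp
qed

lemma smul_mult_right: "A * smul c B = smul c (A * B)"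
  using smul_mult_left[of c "tr B" "tr A"] by (metis tr_mult tr_smul tr_tr)

definition eqvm :: "nat \<Rightarrow> 'a::comm_ring_1 pmat \<Rightarrow> 'a pmat \<Rightarrow> bool" where
  "eqvm N A B \<longleftrightarrow> (\<forall>p q. eqv N (ent A p q) (ent B p q))"

lemma eqvm_refl [simp]: "eqvm N A A"
  by (simp add: eqvm_def)
lemma eqvm_sym: "eqvm N A B \<Longrightarrow> eqvm N B A"
  by (auto simp: eqvm_def intro: eqv_sym)
lemma eqvm_trans [trans]: "eqvm N A B \<Longrightarrow> eqvm N B C \<Longrightarrow> eqvm N A C"
  unfolding eqvm_def by (meson eqv_trans)
lemma eqvm_all: "(\<And>N. eqvm N A B) \<Longrightarrow> A = B"
  by (rule pmat_eqI, rule eqv_all) (simp add: eqvm_def)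
lemma eqvm_tr: "eqvm N A B \<Longrightarrow> eqvm N (tr A) (tr B)"
  by (simp add: eqvm_def)
lemma eqvm_smul: "eqv N c c' \<Longrightarrow> eqvm N A B \<Longrightarrow> eqvm N (smul c A) (smul c' B)"
  by (simp add: eqvm_def eqv_mult)
lemma eqvm_mult:
  assumes "eqvm N A A'" "eqvm N B B'"
  shows "eqvm N (A * B) (A' * B')"
  unfolding eqvm_def
proof (intro allI)
  fix p q
  let ?T = "{r. psize r \<le> psize p + N}"
  have "eqv N (ent (A * B) p q) (\<Sum>r\<in>?T. ent A p r * ent B r q)"
    by (rule ent_mult_size) simp
  also have "eqv N \<dots> (\<Sum>r\<in>?T. ent A' p r * ent B' r q)"
    using assms by (intro eqv_sum eqv_mult) (auto simp: eqvm_def)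
  also have "eqv N \<dots> (ent (A' * B') p q)"
    by (rule eqv_sym, rule ent_mult_size) simp
  finally show "eqv N (ent (A * B) p q) (ent (A' * B') p q)" .
qed

lemma eqvm_complete:
  assumes "\<And>n. eqvm n (A n) (A (Suc n))"
  obtains B where "\<And>n. eqvm n B (A n)"
proof -
  have "\<exists>t. \<forall>n. eqv n t (ent (A n) p q)" for p q
    using eqv_complete[of "\<lambda>n. ent (A n) p q"] assms unfolding eqvm_def by metis
  then obtain F where F: "\<And>p q n. eqv n (F p q) (ent (A n) p q)" by metis
  have "ordge (pdist p q) (F p q)" for p q
    using F[of "pdist p q" p q] ent_ordge[of p q "A (pdist p q)"] by (metis eqv_trans eqv_zero_iff)
  hence "ent (Pmat F) = F" by (rule ent_Pmat)
  thus ?thesis using that[of "Pmat F"] F by (simp add: eqvm_def)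
qed

text \<open>If \<open>p\<close> or \<open>q\<close> lies outside the window, the path from
  \<open>a\<close> over \<open>p\<close> to \<open>q\<close> already covers a size difference of at
  least \<open>N\<close>. This gives unconditional convergence of the double sum, jointly in both
  partitions.\<close>

lemma has_sum_triple:
  "((\<lambda>(p, q). ent A a p * ent B p q * ent C q b) has_sum ent (A * B * C) a b) UNIV"
proof (rule has_sum_mpsI)
  fix N
  define K where "K = psize a + N"
  let ?T = "{r. psize r \<le> K}"
  let ?f = "\<lambda>(p, q). ent A a p * ent B p q * ent C q b"
  have "sum ?f (?T \<times> ?T) = (\<Sum>p\<in>?T. \<Sum>q\<in>?T. ent A a p * ent B p q * ent C q b)"
    by (rule sum.cartesian_product[symmetric])
  also have "\<dots> = (\<Sum>q\<in>?T. \<Sum>p\<in>?T. ent A a p * ent B p q * ent C q b)"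
    by (rule sum.swap)
  also have "\<dots> = (\<Sum>q\<in>?T. (\<Sum>p\<in>?T. ent A a p * ent B p q) * ent C q b)"
    by (simp add: sum_distrib_right)
  also have "eqv N \<dots> (\<Sum>q\<in>?T. ent (A * B) a q * ent C q b)"
    by (intro eqv_sum eqv_mult eqv_refl eqv_sym[OF ent_mult_size]) (simp add: K_def)
  also have "eqv N \<dots> (ent (A * B * C) a b)"
    by (rule eqv_sym, rule ent_mult_size) (simp add: K_def)
  finally have 1: "eqv N (sum ?f (?T \<times> ?T)) (ent (A * B * C) a b)" .
  have 2: "ordge N (?f x)" if "x \<notin> ?T \<times> ?T" for x
  proof -
    obtain p q where x: "x = (p, q)" by (cases x)
    have "ordge (pdist a p + pdist p q + pdist q b) (ent A a p * ent B p q * ent C q b)"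
      by (intro ordge_mult ent_ordge)
    moreover have "N \<le> pdist a p + pdist p q + pdist q b"
      using that x by (auto simp: pdist_def K_def)
    ultimately show ?thesis using x by (auto intro: ordge_mono)
  qed
  show "\<exists>F\<subseteq>UNIV. finite F \<and> eqv N (sum ?f F) (ent (A * B * C) a b) \<and> (\<forall>i\<in>UNIV - F. ordge N (?f i))"
    using 1 2 by (intro exI[of _ "?T \<times> ?T"]) auto
qed


section \<open>Jacobi--Trudi matrices\<close>

text \<open>A letter \<open>a\<close> of the positive part of an alphabet contributes
  \<open>geo a\<close>, that is \<open>1 / (1 - a z)\<close>, to the generating function of the
  functions \<open>h\<close>; a letter of the negative part contributes
  \<open>lin a\<close>.\<close>

definition geo :: "'r::comm_ring_1 \<Rightarrow> 'r fps" where "geo a = Abs_fps (\<lambda>n. a ^ n)"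
definition lin :: "'r::comm_ring_1 \<Rightarrow> 'r fps" where "lin a = 1 - fps_const a * fps_X"

definition zcoeff :: "'r::comm_ring_1 fps \<Rightarrow> int \<Rightarrow> 'r" where
  "zcoeff f z = (if z < 0 then 0 else fps_nth f (nat z))"

lemma zcoeff_neg [simp]: "z < 0 \<Longrightarrow> zcoeff f z = 0"
  by (simp add: zcoeff_def)
lemma zcoeff_nat [simp]: "zcoeff f (int n) = fps_nth f n"
  by (simp add: zcoeff_def)
lemma zcoeff_0 [simp]: "zcoeff f 0 = fps_nth f 0"
  by (simp add: zcoeff_def)

lemma lin_nth_0 [simp]: "fps_nth (lin a) 0 = 1"
  by (simp add: lin_def)
lemma geo_nth [simp]: "fps_nth (geo a) n = a ^ n"
  by (simp add: geo_def)
lemma lin_mult_nth_Suc: "fps_nth (lin a * f) (Suc n) = fps_nth f (Suc n) - a * fps_nth f n"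
  by (simp add: lin_def algebra_simps)
lemma lin_nth: "fps_nth (lin a) n = (if n = 0 then 1 else if n = 1 then - a else 0)"
  by (cases n) (use lin_mult_nth_Suc[of a 1 "n - 1"] in auto)

lemma lin_geo [simp]: "lin a * geo a = 1"
proof (rule fps_ext)
  fix n show "fps_nth (lin a * geo a) n = fps_nth 1 n"
    by (cases n) (simp_all add: lin_mult_nth_Suc)
qed
lemma geo_lin [simp]: "geo a * lin a = 1"
  using lin_geo[of a] by (simp only: mult.commute)

text \<open>Matrices with entries \<open>zcoeff f (a - b)\<close> multiply like the series. The
  factors vanish unless \<open>b \<le> u \<le> a\<close>, so the window only has to reach above
  \<open>a\<close>.\<close>

lemma zcoeff_mult_window:
  assumes "a < W"
  shows "(\<Sum>u<W. zcoeff f (int a - int u) * zcoeff g (int u - int b)) = zcoeff (f * g) (int a - int b)"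
proof (cases "a < b")
  case True
  hence "zcoeff f (int a - int u) * zcoeff g (int u - int b) = 0" for u
    by (cases "a < u") simp_all
  thus ?thesis using True by simp
next
  case False
  have "(\<Sum>u<W. zcoeff f (int a - int u) * zcoeff g (int u - int b))
      = (\<Sum>u\<in>{b..a}. zcoeff f (int a - int u) * zcoeff g (int u - int b))"
    using assms by (intro sum.mono_neutral_right) auto
  also have "\<dots> = (\<Sum>i\<in>{0..a - b}. fps_nth f i * fps_nth g (a - b - i))"
    using False
    by (intro sum.reindex_bij_witness[of _ "\<lambda>i. a - i" "\<lambda>u. a - u"]) (auto simp: zcoeff_def nat_diff_distrib' intro!: arg_cong2[of _ _ _ _ "(*)"] arg_cong[of _ _ "fps_nth _"])
  also have "\<dots> = zcoeff (f * g) (int a - int b)"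
    using False by (simp add: zcoeff_def fps_mult_nth nat_diff_distrib')
  finally show ?thesis .
qed

text \<open>This homogeneity of the series is what gives the determinants the decay demanded of a
  \<open>pmat\<close>.\<close>

definition filtered :: "(variable, 'a::comm_ring_1) mps fps \<Rightarrow> bool" where
  "filtered f \<longleftrightarrow> (\<forall>n. ordge n (fps_nth f n))"

lemma filtered_one [simp]: "filtered 1"
  by (simp add: filtered_def fps_one_nth)
lemma filtered_geo: "ordge 1 a \<Longrightarrow> filtered (geo a)"
  using ordge_power[of 1 a] by (simp add: filtered_def)
lemma filtered_lin: "ordge 1 a \<Longrightarrow> filtered (lin a)"
  by (simp add: filtered_def lin_nth)
lemma filtered_mult: "filtered f \<Longrightarrow> filtered g \<Longrightarrow> filtered (f * g)"
  unfolding filtered_def fps_mult_nth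
  by (intro allI ordge_sum) (metis atLeastAtMost_iff le_add_diff_inverse ordge_mult)
lemma filtered_prod: "(\<And>i. i \<in> A \<Longrightarrow> filtered (f i)) \<Longrightarrow> filtered (prod f A)"
  by (induction A rule: infinite_finite_induct) (auto intro: filtered_mult)
lemma filtered_zcoeff: "filtered f \<Longrightarrow> z \<ge> 0 \<Longrightarrow> ordge (nat z) (zcoeff f z)"
  by (simp add: zcoeff_def filtered_def)

definition deg_le :: "nat \<Rightarrow> 'r::comm_ring_1 fps \<Rightarrow> bool" where
  "deg_le n f \<longleftrightarrow> (\<forall>m>n. fps_nth f m = 0)"

lemma deg_le_one [simp]: "deg_le n 1"
  by (simp add: deg_le_def fps_one_nth)
lemma deg_le_lin: "deg_le 1 (lin a)"
  by (simp add: deg_le_def lin_nth)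
lemma deg_le_mult:
  assumes "deg_le a f" "deg_le b g"
  shows "deg_le (a + b) (f * g)"
  unfolding deg_le_def fps_mult_nth
proof (intro allI impI sum.neutral ballI)
  fix m i assume "a + b < m" "i \<in> {0..m}"
  hence "a < i \<or> b < m - i" by auto
  thus "fps_nth f i * fps_nth g (m - i) = 0" using assms by (auto simp: deg_le_def)
qed
lemma deg_le_prod_lin: "finite A \<Longrightarrow> deg_le (card A) (\<Prod>i\<in>A. lin (f i))"
proof (induction A rule: finite_induct)
  case (insert x A)
  thus ?case using deg_le_mult[OF deg_le_lin insert.IH, of "f x"] by simp
qed simp
lemma deg_le_zcoeff: "deg_le n f \<Longrightarrow> z > int n \<Longrightarrow> zcoeff f z = 0"
  by (auto simp: zcoeff_def deg_le_def)
lemma deg_le_mono: "deg_le n f \<Longrightarrow> n \<le> m \<Longrightarrow> deg_le m f"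
  by (simp add: deg_le_def)

definition geos :: "(nat \<Rightarrow> 'r::comm_ring_1) \<Rightarrow> nat \<Rightarrow> 'r fps" where
  "geos c n = (\<Prod>k\<in>{1..n}. geo (c k))"
definition lins :: "(nat \<Rightarrow> 'r::comm_ring_1) \<Rightarrow> nat \<Rightarrow> 'r fps" where
  "lins c n = (\<Prod>k\<in>{1..n}. lin (c k))"

lemma lins_geos [simp]: "lins c n * geos c n = 1"
  unfolding lins_def geos_def prod.distrib[symmetric] by simp
lemma geos_lins [simp]: "geos c n * lins c n = 1"
  using lins_geos[of c n] by (simp only: mult.commute)
lemma lins_split: "m \<le> n \<Longrightarrow> lins c n = lins c m * (\<Prod>k\<in>{m<..n}. lin (c k))"
  unfolding lins_def by (subst prod.union_disjoint[symmetric]) (auto intro!: prod.cong)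
lemma geos_split: "m \<le> n \<Longrightarrow> geos c n = geos c m * (\<Prod>k\<in>{m<..n}. geo (c k))"
  unfolding geos_def by (subst prod.union_disjoint[symmetric]) (auto intro!: prod.cong)
lemma geos_lins_le: "m \<le> n \<Longrightarrow> geos c m * lins c n = (\<Prod>k\<in>{m<..n}. lin (c k))"
  by (simp add: lins_split mult.assoc[symmetric])
lemma geos_lins_ge: "m \<le> n \<Longrightarrow> geos c n * lins c m = (\<Prod>k\<in>{m<..n}. geo (c k))"
  by (simp add: geos_split mult.commute mult.left_commute[of "lins c m"] mult.assoc[symmetric])
lemma geos_0 [simp]: "geos c 0 = 1" and lins_0 [simp]: "lins c 0 = 1"
  by (simp_all add: geos_def lins_def)
lemma prod_nth_0: "(\<And>i. i \<in> A \<Longrightarrow> fps_nth (f i) 0 = 1) \<Longrightarrow> fps_nth (prod f A) 0 = (1 :: 'r::comm_ring_1)"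
  by (induction A rule: infinite_finite_induct) auto
lemma geos_nth_0 [simp]: "fps_nth (geos c n) 0 = 1" and lins_nth_0 [simp]: "fps_nth (lins c n) 0 = 1"
  by (simp_all add: geos_def lins_def prod_nth_0)
lemma filtered_geos: "(\<And>k. ordge 1 (c k)) \<Longrightarrow> filtered (geos c n)"
  unfolding geos_def by (intro filtered_prod filtered_geo)
lemma filtered_lins: "(\<And>k. ordge 1 (c k)) \<Longrightarrow> filtered (lins c n)"
  unfolding lins_def by (intro filtered_prod filtered_lin)

section \<open>Jacobi--Trudi determinants with row and column series\<close>

definition good :: "(ptn \<Rightarrow> nat \<Rightarrow> (variable, 'a::comm_ring_1) mps fps) \<Rightarrow> bool" where
  "good \<phi> \<longleftrightarrow> (\<forall>p i. filtered (\<phi> p i) \<and> fps_nth (\<phi> p i) 0 = 1)"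

abbreviation unit_fam :: "ptn \<Rightarrow> nat \<Rightarrow> (variable, 'a::comm_ring_1) mps fps" where
  "unit_fam \<equiv> \<lambda>_ _. 1"

lemma good_unit [simp]: "good unit_fam"
  by (simp add: good_def)
lemma good_mult: "good \<phi> \<Longrightarrow> good \<psi> \<Longrightarrow> good (\<lambda>p i. \<phi> p i * \<psi> p i)"
  by (auto simp: good_def filtered_mult)

text \<open>The series is split into a part that knows only the row and a part that knows only the
  column, in the shape in which Cauchy--Binet can separate them.\<close>

definition jt_det :: "nat \<Rightarrow> (ptn \<Rightarrow> nat \<Rightarrow> 'r::comm_ring_1 fps) \<Rightarrow> (ptn \<Rightarrow> nat \<Rightarrow> 'r fps) \<Rightarrow> ptn \<Rightarrow> ptn \<Rightarrow> 'r" where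
  "jt_det l \<phi> \<psi> p q = fdet l (\<lambda>i j. zcoeff (\<phi> p i * \<psi> q j) (int (pt p i) - int (pt q j) - int i + int j))"

text \<open>Left of the diagonal the exponents in the added row are negative, and on the diagonal
  stands a constant term.\<close>

lemma jt_det_Suc:
  assumes "fps_nth (\<phi> p l) 0 = 1" "fps_nth (\<psi> q l) 0 = 1" "plen p \<le> l" "plen q \<le> l"
  shows "jt_det (Suc l) \<phi> \<psi> p q = jt_det l \<phi> \<psi> p q"
proof -
  let ?F = "\<lambda>i j. zcoeff (\<phi> p i * \<psi> q j) (int (pt p i) - int (pt q j) - int i + int j)"
  have "fdet (Suc l) ?F = fdet l ?F * ?F l l"
    using assms by (intro fdet_Suc_row) (simp add: pt_zero)
  thus ?thesis using assms by (simp add: jt_det_def pt_zero)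
qed

lemma jt_det_size:
  assumes "good \<phi>" "good \<psi>" "plen p \<le> l" "plen q \<le> l" "l \<le> l'"
  shows "jt_det l' \<phi> \<psi> p q = jt_det l \<phi> \<psi> p q"
  using assms(5)
proof (induction l' rule: dec_induct)
  case (step n)
  thus ?case using assms by (subst jt_det_Suc) (auto simp: good_def)
qed simp

text \<open>The rows from \<open>i\<close> on meet the columns up to \<open>i\<close> in negative
  exponents only, and this block has \<open>l + 1\<close> rows and columns together.\<close>

lemma jt_det_zero:
  assumes "i < l" "pt p i < pt q i"
  shows "jt_det l \<phi> \<psi> p q = 0"
  unfolding jt_det_def
proof (rule fdet_zero_block[of "{i..<l}" l "{..i}"])
  fix a b assume "a \<in> {i..<l}" "b \<in> {..i}"
  hence "pt p a \<le> pt p i" "pt q i \<le> pt q b" "b \<le> a" by (auto intro: pt_antimono)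
  thus "zcoeff (\<phi> p a * \<psi> q b) (int (pt p a) - int (pt q b) - int a + int b) = 0"
    using assms(2) by simp
qed (use assms(1) in auto)

definition contained :: "ptn \<Rightarrow> ptn \<Rightarrow> bool" where
  "contained q p \<longleftrightarrow> (\<forall>i. pt q i \<le> pt p i)"

lemma contained_plen: "contained q p \<Longrightarrow> plen q \<le> plen p"
  by (rule plen_le) (metis contained_def le_zero_eq pt_zero)

lemma contained_psize: "contained q p \<Longrightarrow> psize q \<le> psize p"
  using psize_sum[OF contained_plen, of q p] psize_sum[of p "plen p"]
  by (simp add: contained_def sum_mono)

lemma contained_antisym: "contained q p \<Longrightarrow> contained p q \<Longrightarrow> p = q"
  by (rule ptn_eqI) (simp add: contained_def le_antisym)

lemma contained_size_eq:
  assumes "contained q p" "psize q = psize p"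
  shows "q = p"
proof (rule ptn_eqI)
  fix i
  define l where "l = max (Suc i) (plen p)"
  have "(\<Sum>i<l. pt q i) = (\<Sum>i<l. pt p i)"
    using psize_sum[of p l] psize_sum[of q l] contained_plen[OF assms(1)] assms(2) by (simp add: l_def)
  moreover have "(\<Sum>i<l. pt q i) < (\<Sum>i<l. pt p i)" if "pt q i < pt p i"
    using assms(1) that by (intro sum_strict_mono_ex1) (auto simp: contained_def l_def)
  ultimately show "pt q i = pt p i" using assms(1) by (metis contained_def le_neq_implies_less less_irrefl)
qed

lemma jt_det_not_contained:
  assumes "plen q \<le> l" "\<not> contained q p"
  shows "jt_det l \<phi> \<psi> p q = 0"
proof -
  obtain i where i: "pt p i < pt q i" using assms(2) by (auto simp: contained_def not_le)
  hence "i < plen q" by (metis not_le not_less0 pt_zero)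
  thus ?thesis using i assms(1) by (intro jt_det_zero[of i]) auto
qed

text \<open>The exponents in a Leibniz term add up to \<open>psize p - psize q\<close> for every
  permutation. Either one of them is negative and the term is zero, or the weights of the factors
  add up to the distance.\<close>

lemma jt_det_ordge:
  assumes "good \<phi>" "good \<psi>" "plen p \<le> l" "plen q \<le> l"
  shows "ordge (pdist p q) (jt_det l \<phi> \<psi> p q)"
proof (cases "contained q p")
  case False
  thus ?thesis using assms by (simp add: jt_det_not_contained)
next
  case True
  have dist: "int (pdist p q) = (\<Sum>i<l. int (pt p i)) - (\<Sum>i<l. int (pt q i))"
    using contained_psize[OF True] psize_sum[OF assms(3)] psize_sum[OF assms(4)]
    by (simp add: pdist_def)
  show ?thesis
    unfolding jt_det_def fdet_leibniz
  proof (rule ordge_sum, rule ordge_mult2)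
    fix \<pi> assume "\<pi> \<in> {p. p permutes {..<l}}"
    hence \<pi>: "\<pi> permutes {..<l}" by simp
    let ?z = "\<lambda>i. int (pt p i) - int (pt q (\<pi> i)) - int i + int (\<pi> i)"
    show "ordge (pdist p q) (\<Prod>i<l. zcoeff (\<phi> p i * \<psi> q (\<pi> i)) (?z i))"
    proof (cases "\<forall>i<l. ?z i \<ge> 0")
      case False
      then obtain i where "i < l" "?z i < 0" by auto
      hence "(\<Prod>i<l. zcoeff (\<phi> p i * \<psi> q (\<pi> i)) (?z i)) = 0"
        by (intro prod_zero[OF _ bexI[of _ i]]) auto
      thus ?thesis by simp
    next
      case True
      have "ordge (\<Sum>i<l. nat (?z i)) (\<Prod>i<l. zcoeff (\<phi> p i * \<psi> q (\<pi> i)) (?z i))"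
        using True assms(1,2) by (intro ordge_prod filtered_zcoeff filtered_mult) (auto simp: good_def)
      moreover have "(\<Sum>i<l. nat (?z i)) = pdist p q"
      proof -
        have "int (\<Sum>i<l. nat (?z i)) = (\<Sum>i<l. ?z i)" using True by (simp add: of_nat_sum)
        also have "\<dots> = (\<Sum>i<l. int (pt p i)) - (\<Sum>i<l. int (pt q (\<pi> i))) - (\<Sum>i<l. int i) + (\<Sum>i<l. int (\<pi> i))"
          by (simp add: sum.distrib sum_subtractf)
        also have "(\<Sum>i<l. int (\<pi> i)) = (\<Sum>i<l. int i)"
          using sum.permute[OF \<pi>, of int] by (simp add: o_def)
        also have "(\<Sum>i<l. int (pt q (\<pi> i))) = (\<Sum>i<l. int (pt q i))"
          using sum.permute[OF \<pi>, of "\<lambda>i. int (pt q i)"] by (simp add: o_def)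
        finally have "int (\<Sum>i<l. nat (?z i)) = int (pdist p q)" by (simp add: dist)
        thus ?thesis by (simp only: of_nat_eq_iff)
      qed
      ultimately show ?thesis by (simp only:)
    qed
  qed
qed

definition jt_mat :: "(ptn \<Rightarrow> nat \<Rightarrow> (variable, 'a::comm_ring_1) mps fps) \<Rightarrow> (ptn \<Rightarrow> nat \<Rightarrow> (variable, 'a) mps fps) \<Rightarrow> 'a pmat" where
  "jt_mat \<phi> \<psi> = Pmat (\<lambda>p q. jt_det (max (plen p) (plen q)) \<phi> \<psi> p q)"

lemma ent_jt_mat_max:
  "good \<phi> \<Longrightarrow> good \<psi> \<Longrightarrow> ent (jt_mat \<phi> \<psi>) p q = jt_det (max (plen p) (plen q)) \<phi> \<psi> p q"
  unfolding jt_mat_def by (subst ent_Pmat) (auto intro!: jt_det_ordge)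

lemma ent_jt_mat:
  assumes "good \<phi>" "good \<psi>" "plen p \<le> l" "plen q \<le> l"
  shows "ent (jt_mat \<phi> \<psi>) p q = jt_det l \<phi> \<psi> p q"
  using assms by (simp add: ent_jt_mat_max jt_det_size[of \<phi> \<psi> p "max (plen p) (plen q)" q l])

lemma ent_jt_mat_not_contained:
  "good \<phi> \<Longrightarrow> good \<psi> \<Longrightarrow> \<not> contained q p \<Longrightarrow> ent (jt_mat \<phi> \<psi>) p q = 0"
  by (simp add: ent_jt_mat_max jt_det_not_contained)

lemma ent_jt_mat_diag:
  assumes "good \<phi>" "good \<psi>"
  shows "ent (jt_mat \<phi> \<psi>) p p = 1"
proof -
  have "jt_det (plen p) \<phi> \<psi> p p = (\<Prod>i<plen p. zcoeff (\<phi> p i * \<psi> p i) (int (pt p i) - int (pt p i) - int i + int i))"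
    unfolding jt_det_def
  proof (rule fdet_upper)
    fix i j assume "j < i" "i < plen p"
    thus "zcoeff (\<phi> p i * \<psi> p j) (int (pt p i) - int (pt p j) - int i + int j) = 0"
      using pt_antimono[of j i p] by simp
  qed
  thus ?thesis using assms by (simp add: ent_jt_mat_max good_def)
qed

lemma jt_det_bead:
  "jt_det l \<phi> \<psi> p q = fdet l (\<lambda>i j. zcoeff (\<phi> p i * \<psi> q j) (int (bead l p i) - int (bead l q j)))"
  unfolding jt_det_def by (rule fdet_cong) (simp add: bead_diff)

text \<open>With exponents written as differences of beads, an entry for the product series is a sum
  over intermediate positions, and Cauchy--Binet selects these positions as the beads of an
  intermediate partition \<open>r\<close>. Only \<open>r\<close> contained in \<open>p\<close>
  matters, so a finite box suffices.\<close>

lemma jt_mat_mult: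
  assumes "good \<phi>" "good \<psi>"
  shows "jt_mat \<phi> unit_fam * jt_mat unit_fam \<psi> = jt_mat \<phi> \<psi>"
proof (rule pmat_eqI)
  fix p q
  define l where "l = max (plen p) (plen q)"
  define K where "K = pt p 0"
  have l: "plen p \<le> l" "plen q \<le> l" by (auto simp: l_def)
  have "ent (jt_mat \<phi> unit_fam * jt_mat unit_fam \<psi>) p q
      = (\<Sum>r\<in>pbox l K. ent (jt_mat \<phi> unit_fam) p r * ent (jt_mat unit_fam \<psi>) r q)"
  proof (rule ent_mult_finite)
    fix r assume r: "r \<notin> pbox l K"
    have "\<not> contained r p"
    proof
      assume c: "contained r p"
      hence "pt r 0 \<le> pt p 0" by (simp add: contained_def)
      thus False using r contained_plen[OF c] by (simp add: pbox_def K_def l_def)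
    qed
    thus "ent (jt_mat \<phi> unit_fam) p r * ent (jt_mat unit_fam \<psi>) r q = 0"
      using assms by (simp add: ent_jt_mat_not_contained)
  qed simp
  also have "\<dots> = (\<Sum>r\<in>pbox l K. fdet l (\<lambda>i j. zcoeff (\<phi> p i) (int (bead l p i) - int (bead l r j)))
        * fdet l (\<lambda>i j. zcoeff (\<psi> q j) (int (bead l r i) - int (bead l q j))))"
    using assms l by (intro sum.cong) (auto simp: ent_jt_mat[of _ _ _ l] jt_det_bead pbox_def)
  also have "\<dots> = fdet l (\<lambda>i j. \<Sum>u<l + K. zcoeff (\<phi> p i) (int (bead l p i) - int u) * zcoeff (\<psi> q j) (int u - int (bead l q j)))"
    by (rule Cauchy_Binet_pbox[symmetric])
  also have "\<dots> = jt_det l \<phi> \<psi> p q"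
    unfolding jt_det_bead
  proof (rule fdet_cong)
    fix i j assume "i < l" "j < l"
    hence "bead l p i < l + K" using pt_antimono[of 0 i p] by (auto simp: bead_def K_def)
    thus "(\<Sum>u<l + K. zcoeff (\<phi> p i) (int (bead l p i) - int u) * zcoeff (\<psi> q j) (int u - int (bead l q j)))
        = zcoeff (\<phi> p i * \<psi> q j) (int (bead l p i) - int (bead l q j))"
      by (rule zcoeff_mult_window)
  qed
  also have "\<dots> = ent (jt_mat \<phi> \<psi>) p q" using assms l by (simp add: ent_jt_mat)
  finally show "ent (jt_mat \<phi> unit_fam * jt_mat unit_fam \<psi>) p q = ent (jt_mat \<phi> \<psi>) p q" .
qed

section \<open>Matrices of skew Schur functions and one-sided inverses\<close>

definition schur :: "(variable, 'a::comm_ring_1) mps fps \<Rightarrow> 'a pmat" where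
  "schur H = jt_mat (\<lambda>_ _. H) unit_fam"

lemma jt_mat_const: "jt_mat (\<lambda>p i. H * \<phi> p i) \<psi> = jt_mat \<phi> (\<lambda>p i. H * \<psi> p i)"
  unfolding jt_mat_def jt_det_def by (simp add: mult_ac)

lemma schur_alt: "schur H = jt_mat unit_fam (\<lambda>_ _. H)"
  using jt_mat_const[of H unit_fam unit_fam] by (simp add: schur_def)

lemma good_const: "good (\<lambda>_ _. H) \<longleftrightarrow> filtered H \<and> fps_nth H 0 = 1"
  by (simp add: good_def)

lemma schur_mult:
  assumes "filtered H" "fps_nth H 0 = 1" "filtered H'" "fps_nth H' 0 = 1"
  shows "schur H * schur H' = schur (H * H')"
proof -
  have "schur H * schur H' = jt_mat (\<lambda>_ _. H) (\<lambda>_ _. H')"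
    unfolding schur_def[of H] schur_alt[of H'] using assms by (intro jt_mat_mult) (auto simp: good_const)
  also have "\<dots> = schur (H * H')"
    using jt_mat_const[of H' "\<lambda>_ _. H" unit_fam] by (simp add: schur_def mult.commute)
  finally show ?thesis .
qed

text \<open>Left multiplication by this matrix is injective, being unitriangular with respect to
  size: induction on \<open>psize p\<close> compares \<open>A * (B * A)\<close> with
  \<open>A * 1\<close> row by row.\<close>

lemma jt_mat_left_right_inverse:
  assumes "good \<phi>" and AB: "jt_mat \<phi> unit_fam * B = 1"
  shows "B * jt_mat \<phi> unit_fam = 1"
proof (rule pmat_eqI)
  let ?A = "jt_mat \<phi> unit_fam"
  fix p q
  have "ent (B * ?A) p q = ent 1 p q"
  proof (induction "psize p" arbitrary: p rule: less_induct)
    case less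
    let ?T = "{r. psize r \<le> psize p}"
    have z: "ent ?A p r = 0" if "psize r \<ge> psize p" "r \<noteq> p" for r
    proof (rule ent_jt_mat_not_contained)
      show "\<not> contained r p" using that contained_psize[of r p] contained_size_eq[of r p] by auto
    qed (use assms in auto)
    have ex: "ent (?A * M) p q = ent M p q + (\<Sum>r\<in>?T - {p}. ent ?A p r * ent M r q)" for M
    proof -
      have "ent (?A * M) p q = (\<Sum>r\<in>?T. ent ?A p r * ent M r q)"
      proof (rule ent_mult_finite)
        fix r assume "r \<notin> ?T"
        thus "ent ?A p r * ent M r q = 0" using z[of r] by (cases "r = p") auto
      qed simp
      also have "\<dots> = ent ?A p p * ent M p q + (\<Sum>r\<in>?T - {p}. ent ?A p r * ent M r q)"
        by (rule sum.remove) auto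
      finally show ?thesis using assms by (simp add: ent_jt_mat_diag)
    qed
    have "?A * (B * ?A) = ?A * 1" using AB by (metis mult.assoc mult_1 mult.right_neutral)
    hence "ent (?A * (B * ?A)) p q = ent (?A * 1) p q" by simp
    hence "ent (B * ?A) p q + (\<Sum>r\<in>?T - {p}. ent ?A p r * ent (B * ?A) r q)
        = ent 1 p q + (\<Sum>r\<in>?T - {p}. ent ?A p r * ent 1 r q)"
      unfolding ex .
    moreover have "ent ?A p r * ent (B * ?A) r q = ent ?A p r * ent 1 r q" if "r \<in> ?T - {p}" for r
      using less[of r] z[of r] that by (cases "psize r < psize p") auto
    hence "(\<Sum>r\<in>?T - {p}. ent ?A p r * ent (B * ?A) r q) = (\<Sum>r\<in>?T - {p}. ent ?A p r * ent 1 r q)"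
      by (rule sum.cong[OF refl])
    ultimately show ?case by simp
  qed
  thus "ent (B * ?A) p q = ent 1 p q" .
qed


section \<open>The skew Cauchy identity\<close>

text \<open>The entries of the determinant of \<open>g\<close> have generating function
  \<open>H(x) * row_ser p i * col_ser q j\<close> in \<open>z\<close>; those of \<open>G\<close> are the coefficients of
  \<open>H(x; z) * col_ser p i * row_ser q j\<close> with the last two factors taken at \<open>1 / z\<close>. The truncated
  subtraction agrees with the convention that the alphabets \<open>A\<^sub>i\<close> with \<open>i \<le> 0\<close> are empty.\<close>

definition row_ser :: "(nat \<Rightarrow> 'r::comm_ring_1) \<Rightarrow> (nat \<Rightarrow> 'r) \<Rightarrow> ptn \<Rightarrow> nat \<Rightarrow> 'r fps" where
  "row_ser a b p i = lins (\<lambda>k. - a k) (pt p i - 1) * geos b i"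
definition col_ser :: "(nat \<Rightarrow> 'r::comm_ring_1) \<Rightarrow> (nat \<Rightarrow> 'r) \<Rightarrow> ptn \<Rightarrow> nat \<Rightarrow> 'r fps" where
  "col_ser a b p i = geos (\<lambda>k. - a k) (pt p i) * lins b i"

text \<open>Weight 1 for every letter would make each single determinant behave. The growth with the
  index is what makes the limits in the number of variables and in the size of the determinant
  exist.\<close>

definition small :: "(nat \<Rightarrow> (variable, 'a::comm_ring_1) mps) \<Rightarrow> bool" where
  "small a \<longleftrightarrow> (\<forall>k. ordge (Suc k) (a k))"

lemma small_ordge1: "small a \<Longrightarrow> ordge 1 (a k)"
  unfolding small_def by (metis le_add1 ordge_mono plus_1_eq_Suc)
lemma small_uminus: "small a \<Longrightarrow> small (\<lambda>k. - a k)"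
  by (simp add: small_def)

lemma good_row_ser: "small a \<Longrightarrow> small b \<Longrightarrow> good (row_ser a b)"
  by (auto simp: good_def row_ser_def intro!: filtered_mult filtered_lins filtered_geos small_ordge1 small_uminus)
lemma good_col_ser: "small a \<Longrightarrow> small b \<Longrightarrow> good (col_ser a b)"
  by (auto simp: good_def col_ser_def intro!: filtered_mult filtered_lins filtered_geos small_ordge1 small_uminus)

text \<open>The rows of \<open>g_to_schur\<close> expand the functions \<open>g\<close> in Schur functions.\<close>

definition g_to_schur :: "(nat \<Rightarrow> (variable, 'a::comm_ring_1) mps) \<Rightarrow> (nat \<Rightarrow> (variable, 'a) mps) \<Rightarrow> 'a pmat" where
  "g_to_schur a b = jt_mat (row_ser a b) unit_fam"
definition schur_to_g :: "(nat \<Rightarrow> (variable, 'a::comm_ring_1) mps) \<Rightarrow> (nat \<Rightarrow> (variable, 'a) mps) \<Rightarrow> 'a pmat" where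
  "schur_to_g a b = jt_mat unit_fam (col_ser a b)"

text \<open>Under these inequalities all geometric factors cancel against linear ones, and the
  remaining linear factors are counted. The bound is one less than
  \<open>pt p r - pt q s - r + s\<close>, the exponent at this place of the determinant.\<close>

lemma row_ser_col_ser_deg_le:
  assumes "pt q s < pt p r" "r \<le> s"
  shows "deg_le (pt p r - 1 - pt q s + (s - r)) (row_ser a b p r * col_ser a b q s)"
proof -
  have "row_ser a b p r * col_ser a b q s
      = (geos (\<lambda>k. - a k) (pt q s) * lins (\<lambda>k. - a k) (pt p r - 1)) * (geos b r * lins b s)"
    by (simp add: row_ser_def col_ser_def mult_ac)
  also have "\<dots> = (\<Prod>k\<in>{pt q s<..pt p r - 1}. lin (- a k)) * (\<Prod>k\<in>{r<..s}. lin (b k))"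
    using assms by (subst (1 2) geos_lins_le) auto
  also have "deg_le (card {pt q s<..pt p r - 1} + card {r<..s}) \<dots>"
    by (intro deg_le_mult deg_le_prod_lin) auto
  finally show ?thesis by simp
qed

text \<open>If \<open>q\<close> is properly contained in \<open>p\<close>, choose a row
  \<open>i\<close> with \<open>pt q i < pt p i\<close>. The entries in the rows up to
  \<open>i\<close> and the columns from \<open>i\<close> on are coefficients beyond the degree of a
  polynomial, and this zero block is too large for a nonzero determinant.\<close>

lemma g_to_schur_schur_to_g: "small a \<Longrightarrow> small b \<Longrightarrow> g_to_schur a b * schur_to_g a b = 1"
proof (rule pmat_eqI)
  fix p q assume ab: "small a" "small b"
  note gd = good_row_ser[OF ab] good_col_ser[OF ab]
  have "g_to_schur a b * schur_to_g a b = jt_mat (row_ser a b) (col_ser a b)"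
    unfolding g_to_schur_def schur_to_g_def using gd by (rule jt_mat_mult)
  moreover have "ent (jt_mat (row_ser a b) (col_ser a b)) p q = ent 1 p q"
  proof (cases "p = q")
    case True
    thus ?thesis using gd by (simp add: ent_jt_mat_diag ent_one)
  next
    case False
    have "ent (jt_mat (row_ser a b) (col_ser a b)) p q = 0"
    proof (cases "contained q p")
      case True
      obtain i where i: "pt q i < pt p i"
        using False True contained_antisym[of q p] unfolding contained_def by (meson not_le)
      define l where "l = max (plen p) (plen q)"
      have il: "i < l" using i by (metis l_def less_max_iff_disj not_le not_less0 pt_zero)
      have "jt_det l (row_ser a b) (col_ser a b) p q = 0"
        unfolding jt_det_def
      proof (rule fdet_zero_block[of "{..i}" l "{i..<l}"])
        fix r s assume "r \<in> {..i}" "s \<in> {i..<l}"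
        hence *: "pt p i \<le> pt p r" "pt q s \<le> pt q i" "r \<le> s" by (auto intro: pt_antimono)
        hence lt: "pt q s < pt p r" using i by simp
        show "zcoeff (row_ser a b p r * col_ser a b q s) (int (pt p r) - int (pt q s) - int r + int s) = 0"
          by (rule deg_le_zcoeff[OF row_ser_col_ser_deg_le[OF lt *(3)]]) (use lt *(3) in linarith)
      qed (use il in auto)
      thus ?thesis using gd by (simp add: ent_jt_mat_max l_def)
    qed (use gd in \<open>simp add: ent_jt_mat_not_contained\<close>)
    thus ?thesis using False by (simp add: ent_one)
  qed
  ultimately show "ent (g_to_schur a b * schur_to_g a b) p q = ent 1 p q" by simp
qed

lemma schur_to_g_g_to_schur: "small a \<Longrightarrow> small b \<Longrightarrow> schur_to_g a b * g_to_schur a b = 1"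
  unfolding g_to_schur_def
  by (rule jt_mat_left_right_inverse[OF good_row_ser]) (auto simp: g_to_schur_schur_to_g[unfolded g_to_schur_def])

lemma jt_mat_factor:
  assumes "small a" "small b" "filtered H" "fps_nth H 0 = 1"
  shows "jt_mat (row_ser a b) (\<lambda>p i. H * col_ser a b p i) = g_to_schur a b * schur H * schur_to_g a b"
    and "jt_mat (\<lambda>p i. H * row_ser a b p i) unit_fam = g_to_schur a b * schur H"
    and "jt_mat unit_fam (\<lambda>p i. H * col_ser a b p i) = schur H * schur_to_g a b"
proof -
  note gd = good_row_ser[OF assms(1,2)] good_col_ser[OF assms(1,2)]
  have H: "good (\<lambda>_ _. H)" using assms by (simp add: good_const)
  have HK: "good (\<lambda>p i. H * col_ser a b p i)" using good_mult[OF H gd(2)] .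
  show 1: "jt_mat unit_fam (\<lambda>p i. H * col_ser a b p i) = schur H * schur_to_g a b"
    unfolding schur_def schur_to_g_def jt_mat_mult[OF H gd(2)] using jt_mat_const[of H unit_fam "col_ser a b"] by simp
  show "jt_mat (row_ser a b) (\<lambda>p i. H * col_ser a b p i) = g_to_schur a b * schur H * schur_to_g a b"
    unfolding jt_mat_mult[OF gd(1) HK, symmetric] 1 by (simp add: g_to_schur_def mult.assoc)
  show "jt_mat (\<lambda>p i. H * row_ser a b p i) unit_fam = g_to_schur a b * schur H"
    unfolding schur_alt g_to_schur_def jt_mat_mult[OF gd(1) H] using jt_mat_const[of H "row_ser a b" unit_fam] by simp
qed

section \<open>Horizontal strips and the one-variable case\<close>

definition hstrip :: "ptn \<Rightarrow> ptn \<Rightarrow> bool" where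
  "hstrip p q \<longleftrightarrow> (\<forall>i. pt q i \<le> pt p i \<and> pt p (Suc i) \<le> pt q i)"

lemma hstrip_contained: "hstrip p q \<Longrightarrow> contained q p"
  by (simp add: hstrip_def contained_def)

text \<open>For a horizontal strip, \<open>pt p (Suc j) \<le> pt q j\<close> makes the exponents
  below the diagonal negative, so the determinant is the product of its diagonal. Otherwise a
  violation of this inequality makes rows proportional on a block.\<close>

lemma ent_schur_geo:
  assumes x: "ordge 1 x"
  shows "ent (schur (geo x)) p q = (if hstrip p q then x ^ (psize p - psize q) else 0)"
proof (cases "contained q p")
  case False
  hence "ent (schur (geo x)) p q = 0"
    unfolding schur_def using x by (intro ent_jt_mat_not_contained) (auto simp: good_const filtered_geo)
  thus ?thesis using False hstrip_contained by auto
next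
  case True
  define l where "l = plen p"
  have l: "plen p \<le> l" "plen q \<le> l" using contained_plen[OF True] by (auto simp: l_def)
  define F where "F i j = zcoeff (geo x) (int (pt p i) - int (pt q j) - int i + int j)" for i j
  have ent: "ent (schur (geo x)) p q = fdet l F"
    unfolding schur_def using x l by (subst ent_jt_mat[of _ _ _ l]) (auto simp: good_const filtered_geo jt_det_def F_def[abs_def])
  have Fge: "F i j = x ^ nat (int (pt p i) - int (pt q j) - int i + int j)"
    if "int (pt p i) - int (pt q j) - int i + int j \<ge> 0" for i j
    using that by (simp add: F_def zcoeff_def)
  show ?thesis
  proof (cases "hstrip p q")
    case hstrip: True
    have "fdet l F = (\<Prod>i<l. F i i)"
    proof (rule fdet_upper)
      fix i j assume "j < i" "i < l"
      hence "pt p i \<le> pt p (Suc j)" "pt p (Suc j) \<le> pt q j" using hstrip by (auto intro: pt_antimono simp: hstrip_def)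
      thus "F i j = 0" using \<open>j < i\<close> by (simp add: F_def)
    qed
    also have "\<dots> = (\<Prod>i<l. x ^ (pt p i - pt q i))"
      using True by (intro prod.cong) (auto simp: Fge contained_def nat_diff_distrib')
    also have "\<dots> = x ^ (psize p - psize q)"
      using True by (simp add: power_sum[symmetric] psize_sum[OF l(1)] psize_sum[OF l(2)] contained_def
          sum_subtractf_nat)
    finally show ?thesis using hstrip ent by simp
  next
    case nhs: False
    then obtain i where i: "pt q i < pt p (Suc i)" using True unfolding hstrip_def contained_def by (meson not_le)
    have il: "Suc i < l" using i by (metis l_def not_le not_less0 pt_zero)
    \<comment> \<open>Rows \<open>0, \<dots>, i + 1\<close> are proportional on the columns from \<open>i\<close> on, so \<open>M\<close> clears too large a block.\<close>
    define M where "M r t = (if r = t then 1 else if r \<le> i \<and> t = Suc i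
      then - (x ^ nat (int (pt p r) - int r - int (pt p (Suc i)) + int (Suc i))) else 0)" for r t
    have "fdet l M = (\<Prod>i<l. M i i)" by (rule fdet_upper) (auto simp: M_def)
    hence M1: "fdet l M = 1" by (simp add: M_def)
    have "fdet l M * fdet l F = fdet l (\<lambda>r s. \<Sum>t<l. M r t * F t s)" by (rule fdet_mult[symmetric])
    also have "\<dots> = 0"
    proof (rule fdet_zero_block[of "{..i}" l "{i..<l}"])
      fix r s assume rs: "r \<in> {..i}" "s \<in> {i..<l}"
      have "(\<Sum>t<l. M r t * F t s) = (\<Sum>t\<in>{r, Suc i}. M r t * F t s)"
        using rs il by (intro sum.mono_neutral_right) (auto simp: M_def)
      also have "\<dots> = F r s - x ^ nat (int (pt p r) - int r - int (pt p (Suc i)) + int (Suc i)) * F (Suc i) s"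
        using rs by (simp add: M_def)
      also have "\<dots> = 0"
      proof -
        have *: "pt p (Suc i) \<le> pt p r" "pt q s \<le> pt q i" "r \<le> i" "i \<le> s"
          using rs by (auto intro: pt_antimono)
        let ?a = "int (pt p r) - int r - int (pt p (Suc i)) + int (Suc i)"
        let ?b = "int (pt p (Suc i)) - int (pt q s) - int (Suc i) + int s"
        have nn: "?a \<ge> 0" "?b \<ge> 0" using * i by auto
        have ab: "int (pt p r) - int (pt q s) - int r + int s = ?a + ?b" by simp
        have "F r s = x ^ nat (?a + ?b)" using Fge[of r s] nn unfolding ab by simp
        also have "\<dots> = x ^ nat ?a * F (Suc i) s"
          using Fge[of "Suc i" s] nn by (simp only: nat_add_distrib power_add)
        finally show ?thesis by simp
      qed
      finally show "(\<Sum>t<l. M r t * F t s) = 0" .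
    qed (use il in auto)
    finally show ?thesis using nhs ent M1 by simp
  qed
qed

text \<open>If \<open>p / m\<close> and \<open>p / e\<close> are horizontal strips, then \<open>p\<^sub>0\<close> is any number above \<open>max m\<^sub>0 e\<^sub>0\<close> and
  \<open>p\<^sub>i\<^sub>+\<^sub>1\<close> lies between \<open>max m\<^sub>i\<^sub>+\<^sub>1 e\<^sub>i\<^sub>+\<^sub>1\<close> and \<open>min m\<^sub>i e\<^sub>i\<close>. If \<open>m / r\<close> and \<open>e / r\<close> are horizontal strips, then \<open>r\<^sub>i\<close>
  ranges over the same interval, and reflecting this interval matches the weights of \<open>p\<close> and \<open>r\<close>. The
  free part \<open>p\<^sub>0\<close> contributes the geometric series in \<open>x y\<close>.\<close>

definition strip_lift :: "ptn \<Rightarrow> ptn \<Rightarrow> nat \<Rightarrow> ptn \<Rightarrow> nat \<Rightarrow> nat" where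
  "strip_lift m e k r i = (case i of 0 \<Rightarrow> max (pt m 0) (pt e 0) + k
     | Suc i \<Rightarrow> max (pt m (Suc i)) (pt e (Suc i)) + min (pt m i) (pt e i) - pt r i)"

definition strip_map :: "ptn \<Rightarrow> ptn \<Rightarrow> nat \<times> ptn \<Rightarrow> ptn" where
  "strip_map m e kr = (SOME p. \<forall>i. pt p i = strip_lift m e (fst kr) (snd kr) i)"

lemma strip_bounds:
  assumes "hstrip m r" "hstrip e r"
  shows "max (pt m (Suc i)) (pt e (Suc i)) \<le> pt r i" "pt r i \<le> min (pt m i) (pt e i)"
  using assms by (auto simp: hstrip_def)

lemma strip_map_pt:
  assumes r: "hstrip m r" "hstrip e r"
  shows "pt (strip_map m e (k, r)) i = strip_lift m e k r i"
proof -
  let ?f = "strip_lift m e k r"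
  have step: "?f (Suc i) \<le> ?f i" for i
  proof (cases i)
    case 0
    thus ?thesis using strip_bounds[OF r, of 0] by (auto simp: strip_lift_def)
  next
    case (Suc n)
    thus ?thesis using strip_bounds[OF r, of n] strip_bounds[OF r, of "Suc n"] by (auto simp: strip_lift_def)
  qed
  have anti: "?f j \<le> ?f i" if "i \<le> j" for i j
    using that step by (rule lift_Suc_antimono_le[rotated])
  let ?l = "Suc (max (plen m) (plen e))"
  have "?f ?l = 0" by (simp add: strip_lift_def pt_zero)
  then obtain p where "\<And>i. pt p i = ?f i" using ptn_exists[of ?f ?l, OF anti] by blast
  hence "\<exists>p. \<forall>i. pt p i = ?f i" by blast
  thus ?thesis unfolding strip_map_def fst_conv snd_conv by (rule someI2_ex) simp
qed

text \<open>Adding \<open>r\<close> back turns each part below the first into the maximum in its row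
  plus the minimum in the row above. Regrouped by row, a maximum and a minimum add up to the parts
  of \<open>m\<close> and \<open>e\<close>.\<close>

lemma strip_map_size:
  assumes r: "hstrip m r" "hstrip e r"
  shows "psize (strip_map m e (k, r)) + psize r = k + psize m + psize e"
proof -
  define l where "l = max (max (plen m) (plen e)) (max (plen r) (plen (strip_map m e (k, r))))"
  let ?p = "strip_map m e (k, r)"
  have l: "plen m \<le> l" "plen e \<le> l" "plen r \<le> l" "plen ?p \<le> Suc l" by (simp_all add: l_def le_SucI)
  have "psize ?p = (\<Sum>i<Suc l. strip_lift m e k r i)"
    unfolding psize_sum[OF l(4)] strip_map_pt[OF r] ..
  also have "\<dots> = max (pt m 0) (pt e 0) + k + (\<Sum>i<l. strip_lift m e k r (Suc i))"
    by (simp only: sum.lessThan_Suc_shift) (simp add: strip_lift_def)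
  finally have "psize ?p + psize r = max (pt m 0) (pt e 0) + k + (\<Sum>i<l. strip_lift m e k r (Suc i)) + (\<Sum>i<l. pt r i)"
    unfolding psize_sum[OF l(3)] by (simp only:)
  also have "\<dots> = max (pt m 0) (pt e 0) + k + (\<Sum>i<l. strip_lift m e k r (Suc i) + pt r i)"
    by (simp only: sum.distrib add.assoc)
  also have "(\<Sum>i<l. strip_lift m e k r (Suc i) + pt r i)
      = (\<Sum>i<l. max (pt m (Suc i)) (pt e (Suc i)) + min (pt m i) (pt e i))"
  proof (rule sum.cong[OF refl])
    fix i show "strip_lift m e k r (Suc i) + pt r i = max (pt m (Suc i)) (pt e (Suc i)) + min (pt m i) (pt e i)"
      unfolding strip_lift_def nat.case by (rule le_add_diff_inverse2, rule trans_le_add2, rule strip_bounds(2)[OF r])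
  qed
  also have "max (pt m 0) (pt e 0) + k + \<dots>
      = k + (\<Sum>i<Suc l. max (pt m i) (pt e i)) + (\<Sum>i<l. min (pt m i) (pt e i))"
    by (simp only: sum.lessThan_Suc_shift sum.distrib add_ac)
  also have "(\<Sum>i<Suc l. max (pt m i) (pt e i)) = (\<Sum>i<l. max (pt m i) (pt e i))"
    by (simp add: pt_zero[OF l(1)] pt_zero[OF l(2)])
  also have "k + (\<Sum>i<l. max (pt m i) (pt e i)) + (\<Sum>i<l. min (pt m i) (pt e i))
      = k + (\<Sum>i<l. pt m i + pt e i)"
  proof -
    have "(\<Sum>i<l. max (pt m i) (pt e i)) + (\<Sum>i<l. min (pt m i) (pt e i)) = (\<Sum>i<l. pt m i + pt e i)"
      unfolding sum.distrib[symmetric] by (rule sum.cong) auto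
    thus ?thesis by (simp only: add.assoc)
  qed
  also have "\<dots> = k + psize m + psize e"
    unfolding psize_sum[OF l(1)] psize_sum[OF l(2)] by (simp only: sum.distrib add.assoc)
  finally show ?thesis .
qed

lemma strip_map_hstrip:
  assumes r: "hstrip m r" "hstrip e r"
  shows "hstrip (strip_map m e (k, r)) m" "hstrip (strip_map m e (k, r)) e"
proof -
  have "pt m i \<le> strip_lift m e k r i \<and> pt e i \<le> strip_lift m e k r i \<and>
      strip_lift m e k r (Suc i) \<le> pt m i \<and> strip_lift m e k r (Suc i) \<le> pt e i" for i
  proof (cases i)
    case 0
    thus ?thesis using strip_bounds[OF r, of 0] by (auto simp: strip_lift_def)
  next
    case (Suc n)
    thus ?thesis using strip_bounds[OF r, of n] strip_bounds[OF r, of "Suc n"] by (auto simp: strip_lift_def)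
  qed
  thus "hstrip (strip_map m e (k, r)) m" "hstrip (strip_map m e (k, r)) e" by (auto simp: hstrip_def strip_map_pt[OF r])
qed

text \<open>Reflection is an involution: the same formula recovers \<open>r\<close> from the lower
  parts of \<open>p\<close>, and \<open>k\<close> is the excess of the first part of
  \<open>p\<close> over its minimal value.\<close>

lemma strip_map_surj:
  assumes p: "hstrip p m" "hstrip p e"
  obtains k r where "hstrip m r" "hstrip e r" "p = strip_map m e (k, r)"
proof -
  define f where "f i = max (pt m (Suc i)) (pt e (Suc i)) + min (pt m i) (pt e i) - pt p (Suc i)" for i
  have b: "max (pt m i) (pt e i) \<le> pt p i" "pt p (Suc i) \<le> min (pt m i) (pt e i)" for i
    using p by (auto simp: hstrip_def)
  have bf: "max (pt m (Suc i)) (pt e (Suc i)) \<le> f i \<and> f i \<le> min (pt m i) (pt e i)" for i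
    using b(1)[of "Suc i"] b(2)[of i] by (auto simp: f_def)
  have "f (Suc i) \<le> f i" for i
    using bf[of i] bf[of "Suc i"] by auto
  hence anti: "f j \<le> f i" if "i \<le> j" for i j
    using that by (rule lift_Suc_antimono_le)
  have "f (plen m) = 0" using bf[of "plen m"] by (simp add: pt_zero)
  then obtain r where r: "\<And>i. pt r i = f i" using ptn_exists[of f "plen m", OF anti] by blast
  have hr: "hstrip m r" "hstrip e r" using bf by (auto simp: hstrip_def r)
  have "pt p i = pt (strip_map m e (pt p 0 - max (pt m 0) (pt e 0), r)) i" for i
    unfolding strip_map_pt[OF hr] using b(1)[of i] b(2)[of "i - 1"]
    by (cases i) (auto simp: strip_lift_def r f_def)
  hence "p = strip_map m e (pt p 0 - max (pt m 0) (pt e 0), r)" by (rule ptn_eqI)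
  thus ?thesis using hr that by blast
qed

lemma strip_map_inj: "inj_on (strip_map m e) (A \<times> {r. hstrip m r \<and> hstrip e r})"
proof (rule inj_onI, clarify)
  fix k r k' r' assume r: "hstrip m r" "hstrip e r" and r': "hstrip m r'" "hstrip e r'"
    and eq: "strip_map m e (k, r) = strip_map m e (k', r')"
  have e: "strip_lift m e k r i = strip_lift m e k' r' i" for i
    using strip_map_pt[OF r, of k i] strip_map_pt[OF r', of k' i] eq by simp
  have "k = k'" using e[of 0] by (simp add: strip_lift_def)
  moreover have "pt r i = pt r' i" for i
  proof -
    have cancel: "M + n - a = M + n - b \<Longrightarrow> a \<le> n \<Longrightarrow> b \<le> n \<Longrightarrow> a = b" for M n a b :: nat by linarith
    show ?thesis
      using e[of "Suc i"] strip_bounds(2)[OF r, of i] strip_bounds(2)[OF r', of i]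
      unfolding strip_lift_def nat.case by (rule cancel)
  qed
  ultimately show "k = k' \<and> r = r'" using ptn_eqI by blast
qed

text \<open>The factor stands on the side where it is the polynomial \<open>1 - x * y\<close> and
  not its inverse. Factors then multiply when letters are added on either side.\<close>

definition commute_upto :: "(variable, 'a::comm_ring_1) mps \<Rightarrow> 'a pmat \<Rightarrow> 'a pmat \<Rightarrow> bool" where
  "commute_upto k A B \<longleftrightarrow> smul k (A * B) = B * A"

lemma commute_upto_one: "commute_upto 1 1 B" "commute_upto 1 A 1"
  by (simp_all add: commute_upto_def)

lemma commute_upto_mult_right:
  assumes "commute_upto k A B" "commute_upto k' A B'"
  shows "commute_upto (k * k') A (B * B')"
proof -
  have "smul (k * k') (A * (B * B')) = smul k' (smul k (A * B) * B')"
    by (simp add: smul_mult_left mult.assoc mult.commute)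
  also have "\<dots> = B * smul k' (A * B')" using assms(1) by (simp add: commute_upto_def smul_mult_right mult.assoc)
  also have "\<dots> = B * B' * A" using assms(2) by (simp add: commute_upto_def mult.assoc)
  finally show ?thesis by (simp add: commute_upto_def)
qed

lemma commute_upto_mult_left:
  assumes "commute_upto k A B" "commute_upto k' A' B"
  shows "commute_upto (k * k') (A * A') B"
proof -
  have "smul (k * k') (A * A' * B) = smul k (A * smul k' (A' * B))"
    by (simp add: smul_mult_right mult.assoc)
  also have "\<dots> = smul k (A * B) * A'" using assms(2) by (simp add: commute_upto_def smul_mult_left mult.assoc)
  also have "\<dots> = B * (A * A')" using assms(1) by (simp add: commute_upto_def mult.assoc)
  finally show ?thesis by (simp add: commute_upto_def)
qed

text \<open>Under \<open>strip_map\<close> the sum over \<open>p\<close> becomes the sum over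
  \<open>r\<close> times the powers of \<open>x * y\<close> up to \<open>N\<close>. Multiplication
  by \<open>1 - x * y\<close> telescopes, and the leftover power lies beyond weight
  \<open>N\<close>.\<close>

lemma skew_Cauchy_single:
  assumes x: "ordge 1 x" and y: "ordge 1 y"
  shows "commute_upto (1 - x * y) (tr (schur (geo x))) (schur (geo y))"
  unfolding commute_upto_def
proof (rule pmat_eqI, rule eqv_all)
  fix m e N
  define R where "R = {r. hstrip m r \<and> hstrip e r}"
  have finR: "finite R"
    by (rule finite_subset[of _ "{r. psize r \<le> psize m}"])
      (auto simp: R_def dest: hstrip_contained intro: contained_psize)
  define w where "w r = y ^ (psize m - psize r) * x ^ (psize e - psize r)" for r
  have rhs: "ent (schur (geo y) * tr (schur (geo x))) m e = sum w R"
  proof -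
    have "ent (schur (geo y) * tr (schur (geo x))) m e = (\<Sum>r\<in>R. ent (schur (geo y)) m r * ent (tr (schur (geo x))) r e)"
      using finR by (rule ent_mult_finite) (auto simp: ent_schur_geo[OF x] ent_schur_geo[OF y] R_def)
    also have "\<dots> = sum w R" by (rule sum.cong) (auto simp: ent_schur_geo[OF x] ent_schur_geo[OF y] R_def w_def)
    finally show ?thesis .
  qed
  let ?T = "strip_map m e ` ({..N} \<times> R)"
  let ?g = "\<lambda>p. ent (tr (schur (geo x))) m p * ent (schur (geo y)) p e"
  have g: "?g (strip_map m e (k, r)) = (x * y) ^ k * w r" if "r \<in> R" for k r
  proof -
    have r: "hstrip m r" "hstrip e r" using that by (auto simp: R_def)
    have "psize r \<le> psize m" "psize r \<le> psize e"
      using r by (auto dest: hstrip_contained intro: contained_psize)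
    hence "psize (strip_map m e (k, r)) - psize m = k + (psize e - psize r)"
      "psize (strip_map m e (k, r)) - psize e = k + (psize m - psize r)"
      using strip_map_size[OF r, of k] by auto
    thus ?thesis using strip_map_hstrip[OF r] by (simp add: ent_schur_geo[OF x] ent_schur_geo[OF y] w_def power_add power_mult_distrib mult_ac)
  qed
  have "eqv N (ent (tr (schur (geo x)) * schur (geo y)) m e) (sum ?g ?T)"
  proof (rule ent_mult_approx)
    show "finite ?T" using finR by simp
    fix p assume pT: "p \<notin> ?T"
    show "ordge N (?g p)"
    proof (cases "hstrip p m \<and> hstrip p e")
      case False
      thus ?thesis by (auto simp: ent_schur_geo[OF x] ent_schur_geo[OF y])
    next
      case True
      then obtain k r where kr: "hstrip m r" "hstrip e r" "p = strip_map m e (k, r)"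
        using strip_map_surj[of p m e] by blast
      hence rR: "r \<in> R" by (simp add: R_def)
      have "k > N" using pT kr rR by force
      have "ordge (1 + 1) (x * y)" using x y by (rule ordge_mult)
      hence "ordge (k * (1 + 1)) ((x * y) ^ k)" by (rule ordge_power)
      hence "ordge N ((x * y) ^ k)" using \<open>k > N\<close> by (auto intro: ordge_mono)
      thus ?thesis unfolding kr(3) g[OF rR] by (rule ordge_mult1)
    qed
  qed
  also have "sum ?g ?T = (\<Sum>kr\<in>{..N} \<times> R. ?g (strip_map m e kr))"
    by (rule sum.reindex_cong[OF _ refl refl]) (unfold R_def, rule strip_map_inj)
  also have "\<dots> = (\<Sum>(k, r)\<in>{..N} \<times> R. (x * y) ^ k * w r)"
    by (rule sum.cong[OF refl]) (auto simp: g simp del: ent_tr)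
  also have "\<dots> = (\<Sum>k\<le>N. (x * y) ^ k) * sum w R"
    by (simp add: sum.cartesian_product[symmetric] sum_product)
  finally have "eqv N ((1 - x * y) * ent (tr (schur (geo x)) * schur (geo y)) m e)
      ((1 - x * y) * ((\<Sum>k\<le>N. (x * y) ^ k) * sum w R))"
    by (intro eqv_mult eqv_refl)
  also have "(1 - x * y) * ((\<Sum>k\<le>N. (x * y) ^ k) * sum w R) = (1 - (x * y) ^ Suc N) * sum w R"
  proof -
    have "(1 - x * y) * (\<Sum>k<Suc N. (x * y) ^ k) = 1 - (x * y) ^ Suc N"
      by (rule one_diff_power_eq[symmetric])
    thus ?thesis by (simp add: lessThan_Suc_atMost mult.assoc[symmetric])
  qed
  also have "eqv N \<dots> (sum w R)"
  proof -
    have "ordge (1 + 1) (x * y)" using x y by (rule ordge_mult)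
    hence "ordge (Suc N * (1 + 1)) ((x * y) ^ Suc N)" by (rule ordge_power)
    hence "ordge N ((x * y) ^ Suc N)" by (rule ordge_mono) simp
    thus ?thesis by (simp add: eqv_def left_diff_distrib ordge_mult1 del: power_Suc)
  qed
  finally show "eqv N (ent (smul (1 - x * y) (tr (schur (geo x)) * schur (geo y))) m e)
      (ent (schur (geo y) * tr (schur (geo x))) m e)"
    by (simp add: rhs)
qed

text \<open>The series 1 is \<open>geo 0\<close>, so the one-variable formula applies with
  \<open>x = 0\<close>, where only the empty strip survives.\<close>

lemma schur_one [simp]: "schur 1 = (1 :: 'a::comm_ring_1 pmat)"
proof (rule pmat_eqI)
  fix p q
  have "ent (schur (geo 0) :: 'a pmat) p q = ent 1 p q"
  proof (cases "p = q")
    case True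
    thus ?thesis unfolding schur_def using ent_jt_mat_diag[of "\<lambda>_ _. geo (0 :: (variable, 'a) mps)" unit_fam p]
      by (simp add: good_const filtered_geo ent_one)
  next
    case False
    hence "psize q < psize p" if "hstrip p q"
      using contained_size_eq[OF hstrip_contained[OF that]] contained_psize[OF hstrip_contained[OF that]]
      by (auto simp: le_less)
    thus ?thesis using False by (auto simp: ent_schur_geo ent_one power_0_left)
  qed
  moreover have "geo 0 = (1 :: (variable, 'a) mps fps)"
    by (rule fps_ext) (simp add: fps_one_nth power_0_left)
  ultimately show "ent (schur 1) p q = ent (1 :: 'a pmat) p q" by simp
qed

lemma filtered_geos_small: "small x \<Longrightarrow> filtered (geos x n)" and filtered_lins_small: "small x \<Longrightarrow> filtered (lins x n)"
  by (intro filtered_geos filtered_lins small_ordge1; assumption)+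

lemma geos_Suc: "geos c (Suc n) = geos c n * geo (c (Suc n))"
  by (simp add: geos_def atLeastAtMostSuc_conv mult.commute)

lemma schur_geos_Suc: "small x \<Longrightarrow> schur (geos x (Suc n)) = schur (geos x n) * schur (geo (x (Suc n)))"
  unfolding geos_Suc by (rule schur_mult[symmetric]) (auto intro: filtered_geos_small small_ordge1 filtered_geo)

lemma skew_Cauchy:
  assumes "small x" "small y"
  shows "commute_upto (\<Prod>i\<in>{1..n}. \<Prod>j\<in>{1..m}. 1 - x i * y j) (tr (schur (geos x n))) (schur (geos y m))"
proof -
  have 1: "commute_upto (\<Prod>j\<in>{1..m}. 1 - x i * y j) (tr (schur (geo (x i)))) (schur (geos y m))" for i m
  proof (induction m)
    case 0
    show ?case by (simp add: commute_upto_one)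
  next
    case (Suc m)
    have "commute_upto ((\<Prod>j\<in>{1..m}. 1 - x i * y j) * (1 - x i * y (Suc m))) (tr (schur (geo (x i)))) (schur (geos y m) * schur (geo (y (Suc m))))"
      by (intro commute_upto_mult_right skew_Cauchy_single Suc small_ordge1 assms)
    thus ?case using assms by (simp add: schur_geos_Suc atLeastAtMostSuc_conv mult.commute)
  qed
  show ?thesis
  proof (induction n)
    case 0
    show ?case by (simp add: commute_upto_one)
  next
    case (Suc n)
    have "commute_upto ((\<Prod>j\<in>{1..m}. 1 - x (Suc n) * y j) * (\<Prod>i\<in>{1..n}. \<Prod>j\<in>{1..m}. 1 - x i * y j))
        (tr (schur (geo (x (Suc n)))) * tr (schur (geos x n))) (schur (geos y m))"
      using Suc 1 by (intro commute_upto_mult_left)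
    thus ?case using assms by (simp add: schur_geos_Suc tr_mult atLeastAtMostSuc_conv)
  qed
qed


section \<open>Conjugation\<close>

lemma less_pt_set: "{i. j < pt p i} = {..<card {i. j < pt p i}}"
proof -
  define n where "n = (LEAST i. pt p i \<le> j)"
  have n: "pt p n \<le> j" unfolding n_def by (rule LeastI[of _ "plen p"]) (simp add: pt_zero)
  have "{i. j < pt p i} = {..<n}"
  proof (rule Set.set_eqI)
    fix i
    have "i < n" if "j < pt p i" using that n pt_antimono[of n i p] by (metis leI le_trans not_le)
    moreover have "j < pt p i" if "i < n"
      using not_less_Least[of i "\<lambda>i. pt p i \<le> j"] that by (simp add: n_def not_le)
    ultimately show "i \<in> {i. j < pt p i} \<longleftrightarrow> i \<in> {..<n}" by auto
  qed
  thus ?thesis by simp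
qed

lemma less_card_pt: "i < card {i. j < pt p i} \<longleftrightarrow> j < pt p i"
  using less_pt_set[of j p] by blast

lemma nat_eq_less: "(\<And>k. k < a \<longleftrightarrow> k < b) \<Longrightarrow> a = (b :: nat)"
  by (metis linorder_neqE_nat less_irrefl)

lemma conj_partition_nth:
  assumes "j < pt p 0"
  shows "conj_partition (plist p) ! j = card {i. j < pt p i}"
proof -
  have "conj_partition (plist p) ! j = card {i\<in>{1..length (plist p)}. part (plist p) i \<ge> Suc j}"
    using assms by (simp add: conj_partition_def pt_def del: upt_Suc)
  also have "{i\<in>{1..length (plist p)}. part (plist p) i \<ge> Suc j} = Suc ` {i. j < pt p i}"
  proof (rule Set.set_eqI)
    fix i
    show "i \<in> {i\<in>{1..length (plist p)}. part (plist p) i \<ge> Suc j} \<longleftrightarrow> i \<in> Suc ` {i. j < pt p i}"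
      by (cases i) (auto simp: pt_def part_def image_iff)
  qed
  also have "card \<dots> = card {i. j < pt p i}" by (simp add: card_image)
  finally show ?thesis .
qed

lemma conj_partition_is_partition: "is_partition (conj_partition (plist p))"
proof -
  have len: "length (conj_partition (plist p)) = pt p 0" by (simp add: conj_partition_def pt_def)
  have "conj_partition (plist p) ! j \<le> conj_partition (plist p) ! i" if "i < j" "j < pt p 0" for i j
  proof -
    have "card {k. j < pt p k} \<le> card {k. i < pt p k}"
    proof (rule card_mono)
      show "finite {k. i < pt p k}" by (subst less_pt_set) simp
      show "{k. j < pt p k} \<subseteq> {k. i < pt p k}" using that by auto
    qed
    thus ?thesis using that by (simp add: conj_partition_nth)
  qed
  moreover have "conj_partition (plist p) ! j \<noteq> 0" if "j < pt p 0" for j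
    using less_card_pt[of 0 j p] that by (simp add: conj_partition_nth)
  ultimately show ?thesis
    unfolding is_partition_def sorted_wrt_iff_nth_less len in_set_conv_nth by simp
qed

definition conj_ptn :: "ptn \<Rightarrow> ptn" where "conj_ptn p = Ptn (conj_partition (plist p))"

lemma plist_conj_ptn: "plist (conj_ptn p) = conj_partition (plist p)"
  unfolding conj_ptn_def by (rule Ptn_inverse) (simp add: conj_partition_is_partition)

lemma plen_conj_ptn: "plen (conj_ptn p) = pt p 0"
  by (simp add: plen_def plist_conj_ptn conj_partition_def pt_def)

lemma pt_conj_ptn: "pt (conj_ptn p) j = card {i. j < pt p i}"
proof (cases "j < pt p 0")
  case True
  thus ?thesis by (simp add: pt_nth[of "conj_ptn p"] plen_conj_ptn plist_conj_ptn conj_partition_nth)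
next
  case False
  hence "pt (conj_ptn p) j = 0" by (intro pt_zero) (simp add: plen_conj_ptn)
  moreover have "card {i. j < pt p i} = 0" using less_card_pt[of 0 j p] False by simp
  ultimately show ?thesis by simp
qed

lemma less_pt_conj_ptn: "i < pt (conj_ptn p) j \<longleftrightarrow> j < pt p i"
  unfolding pt_conj_ptn by (rule less_card_pt)

lemma conj_ptn_conj_ptn [simp]: "conj_ptn (conj_ptn p) = p"
  by (rule ptn_eqI, rule nat_eq_less) (simp add: less_pt_conj_ptn)

lemma pt_conj_ptn_le: "pt (conj_ptn p) j \<le> plen p"
  using plen_conj_ptn[of "conj_ptn p"] pt_antimono[of 0 j "conj_ptn p"] by simp

lemma psize_conj_ptn [simp]: "psize (conj_ptn p) = psize p"
proof -
  let ?l = "plen p" and ?n = "pt p 0"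
  have le: "pt p i \<le> ?n" for i by (rule pt_antimono) simp
  have lt: "i < ?l" if "j < pt p i" for i j using that pt_zero[of p i] by (cases "i < ?l") auto
  have "psize p = card (SIGMA i:{..<?l}. {..<pt p i})"
    by (simp add: psize_sum[OF order_refl])
  also have "(SIGMA i:{..<?l}. {..<pt p i}) = {(i, j). j < pt p i}"
    using lt by auto
  also have "card {(i, j). j < pt p i} = card {(j, i). j < pt p i}"
    by (rule bij_betw_same_card[of "\<lambda>(a, b). (b, a)"]) (auto simp: bij_betw_def inj_on_def)
  also have "{(j, i). j < pt p i} = (SIGMA j:{..<?n}. {..<pt (conj_ptn p) j})"
    using le by (auto simp: less_pt_conj_ptn intro: less_le_trans)
  also have "card \<dots> = psize (conj_ptn p)"
    by (simp add: psize_sum[OF order_refl] plen_conj_ptn)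
  finally show ?thesis by simp
qed

text \<open>The Maya diagram of \<open>p\<close> in a window of length \<open>l + n\<close>: first the \<open>l\<close> beads, one for each row,
  then the \<open>n\<close> gaps, one for each column.\<close>

definition maya :: "nat \<Rightarrow> ptn \<Rightarrow> nat \<Rightarrow> nat" where
  "maya l p r = (if r < l then bead l p r else r - pt (conj_ptn p) (r - l))"

text \<open>Beads decrease and gaps increase along the rows and columns. The bead of row
  \<open>r\<close> is above the gap of a column if the cell in that row and column belongs to
  \<open>p\<close>, and below it otherwise, so the two never coincide; finiteness then gives
  surjectivity.\<close>

lemma maya_bij:
  assumes "plen p \<le> l" "pt p 0 \<le> n"
  shows "bij_betw (maya l p) {..<l + n} {..<l + n}"
proof -
  have cl: "pt (conj_ptn p) j \<le> l" for j using pt_conj_ptn_le[of p j] assms(1) by simp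
  have "maya l p r < l + n" if "r < l + n" for r
    using that pt_antimono[of 0 r p] assms(2) by (auto simp: maya_def bead_def)
  hence "maya l p ` {..<l + n} \<subseteq> {..<l + n}" by auto
  moreover have "inj_on (maya l p) {..<l + n}"
  proof (rule linorder_inj_onI)
    fix r s assume rs: "r < s" "r \<in> {..<l + n}" "s \<in> {..<l + n}"
    consider "s < l" | "r < l" "l \<le> s" | "l \<le> r" using rs by linarith
    thus "maya l p r \<noteq> maya l p s"
    proof cases
      case 1
      thus ?thesis using rs pt_antimono[of r s p] by (auto simp: maya_def bead_def)
    next
      case 2
      show ?thesis
      proof (cases "s - l < pt p r")
        case True
        hence "r < pt (conj_ptn p) (s - l)" by (simp add: less_pt_conj_ptn)
        thus ?thesis using 2 True cl[of "s - l"] by (auto simp: maya_def bead_def)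
      next
        case False
        hence "pt (conj_ptn p) (s - l) \<le> r" by (simp add: less_pt_conj_ptn flip: not_less)
        thus ?thesis using 2 False cl[of "s - l"] by (auto simp: maya_def bead_def)
      qed
    next
      case 3
      have "pt (conj_ptn p) (s - l) \<le> pt (conj_ptn p) (r - l)" using rs by (intro pt_antimono) auto
      thus ?thesis using 3 rs cl[of "r - l"] by (auto simp: maya_def)
    qed
  qed auto
  ultimately show ?thesis by (simp add: bij_betw_def endo_inj_surj)
qed

section \<open>Signs of Maya diagrams\<close>

lemma fdet_permute_cols:
  assumes "\<pi> permutes {..<l}"
  shows "fdet l (\<lambda>i j. F i (\<pi> j)) = signof \<pi> * fdet l F"
  using fdet_permute_rows[OF assms, of "\<lambda>i j. F j i"] fdet_transpose[of l "\<lambda>i j. F i (\<pi> j)"] fdet_transpose[of l F]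
  by simp

lemma fdet_one: "fdet l (\<lambda>i j. if i = j then 1 else 0) = 1"
  by (subst fdet_upper) auto

text \<open>The sign of the permutation between two Maya diagrams, kept as the determinant of its
  matrix so that it can be split off by multiplicativity.\<close>

definition maya_sign :: "nat \<Rightarrow> nat \<Rightarrow> ptn \<Rightarrow> ptn \<Rightarrow> 'r::comm_ring_1" where
  "maya_sign l n p q = fdet (l + n) (\<lambda>s c. if maya l q s = maya l p c then 1 else 0)"

lemma maya_sign_sym: "maya_sign l n p q = maya_sign l n q p"
  unfolding maya_sign_def
  by (subst fdet_transpose[symmetric]) (simp add: eq_commute)

text \<open>The last cell of the last row can always be removed. Its row \<open>r\<close> and column
  \<open>c\<close> have a bead and a gap at adjacent positions, and the removal exchanges the two,
  which is the transposition of \<open>r\<close> and \<open>l + c\<close>.\<close>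

lemma remove_box:
  assumes "p \<noteq> Ptn []" "plen p \<le> l" "pt p 0 \<le> n"
  obtains p' \<pi> where "plen p' \<le> l" "pt p' 0 \<le> n" "psize p = Suc (psize p')" "\<pi> permutes {..<l + n}"
    "sign \<pi> = -1" "\<And>c. c < l + n \<Longrightarrow> maya l p c = maya l p' (\<pi> c)"
proof -
  have "plen p \<noteq> 0"
  proof
    assume "plen p = 0"
    hence "plist p = []" by (simp add: plen_def)
    thus False using assms(1) by (metis plist_inverse)
  qed
  define r where "r = plen p - 1"
  have r: "r < plen p" "Suc r = plen p" using \<open>plen p \<noteq> 0\<close> by (auto simp: r_def)
  define f where "f i = (if i = r then pt p r - 1 else pt p i)" for i
  have anti: "f j \<le> f i" if "i \<le> j" for i j
  proof (cases "j \<le> r")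
    case True
    thus ?thesis using that pt_antimono[of i j p] by (cases "i = j") (auto simp: f_def)
  next
    case False
    hence "pt p j = 0" using r by (intro pt_zero) simp
    thus ?thesis using False by (simp add: f_def)
  qed
  have fl: "f l = 0" using r assms(2) by (simp add: f_def pt_zero)
  obtain p' where p': "\<And>i. pt p' i = f i" "plen p' \<le> l"
    using ptn_exists[of f l, OF anti fl] by blast
  have pr: "pt p r > 0" using r by (simp add: pt_pos)
  define c where "c = pt p r - 1"
  have cj_c: "pt (conj_ptn p) c = Suc r" 
  proof (rule nat_eq_less)
    fix k show "k < pt (conj_ptn p) c \<longleftrightarrow> k < Suc r"
      unfolding less_pt_conj_ptn c_def
      using pr pt_antimono[of k r p] pt_zero[of p k] r by (cases "k \<le> r") auto
  qed
  have conj_ptn': "pt (conj_ptn p') j = (if j = c then r else pt (conj_ptn p) j)" for j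
  proof (rule nat_eq_less)
    fix k show "k < pt (conj_ptn p') j \<longleftrightarrow> k < (if j = c then r else pt (conj_ptn p) j)"
    proof (cases "j = c")
      case True
      have "c < pt p k \<longleftrightarrow> k < Suc r" using less_pt_conj_ptn[of k p c] cj_c by simp
      thus ?thesis unfolding less_pt_conj_ptn p'(1) f_def c_def[symmetric] using True by auto
    next
      case False
      thus ?thesis using pr by (auto simp: less_pt_conj_ptn p'(1) f_def c_def)
    qed
  qed
  have rl: "r < l" "c < n" using r assms pr pt_antimono[of 0 r p] by (auto simp: c_def)
  let ?\<pi> = "Transposition.transpose r (l + c)"
  show ?thesis
  proof (rule that)
    show "plen p' \<le> l" by (rule p')
    show "pt p' 0 \<le> n" using assms(3) by (auto simp: p'(1) f_def)
    have "psize p = (\<Sum>i<l. pt p i)" using assms(2) by (rule psize_sum)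
    also have "\<dots> = pt p r + (\<Sum>i\<in>{..<l} - {r}. pt p i)" using rl by (intro sum.remove) auto
    also have "(\<Sum>i\<in>{..<l} - {r}. pt p i) = (\<Sum>i\<in>{..<l} - {r}. pt p' i)"
      by (rule sum.cong) (auto simp: p'(1) f_def)
    also have "pt p r = Suc (pt p' r)" using pr by (simp add: p'(1) f_def)
    also have "Suc (pt p' r) + (\<Sum>i\<in>{..<l} - {r}. pt p' i) = Suc (\<Sum>i<l. pt p' i)"
      using rl by (subst sum.remove[of "{..<l}" r]) auto
    also have "(\<Sum>i<l. pt p' i) = psize p'" using p'(2) by (rule psize_sum[symmetric])
    finally show "psize p = Suc (psize p')" .
    show "?\<pi> permutes {..<l + n}" using rl by (intro permutes_swap_id) auto
    show "sign ?\<pi> = -1" using rl by (simp add: sign_swap_id)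
    fix k assume "k < l + n"
    show "maya l p k = maya l p' (?\<pi> k)"
    proof -
      consider "k = r" | "k = l + c" | "k \<noteq> r" "k \<noteq> l + c" by blast
      thus ?thesis
      proof cases
        case 1
        thus ?thesis using rl pr by (auto simp: maya_def bead_def conj_ptn' c_def)
      next
        case 2
        thus ?thesis using rl pr cj_c by (auto simp: maya_def bead_def p'(1) f_def c_def)
      next
        case 3
        moreover have "k - l \<noteq> c" if "\<not> k < l" using 3 that by auto
        ultimately show ?thesis by (simp add: maya_def bead_def conj_ptn' p'(1) f_def)
      qed
    qed
  qed
qed

lemma maya_sign_empty:
  assumes "plen p \<le> l" "pt p 0 \<le> n"
  shows "maya_sign l n p q = ((-1) ^ psize p * maya_sign l n (Ptn []) q :: 'r::comm_ring_1)"
  using assms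
proof (induction "psize p" arbitrary: p)
  case 0
  hence "plist p = []" using plen_le_psize[of p] by (simp add: plen_def)
  hence "p = Ptn []" by (metis plist_inverse)
  thus ?case using 0 by simp
next
  case (Suc k)
  have "p \<noteq> Ptn []"
  proof
    assume "p = Ptn []"
    hence "plist p = []" by (simp add: Ptn_inverse is_partition_def)
    thus False using Suc(2) by (simp add: psize_def)
  qed
  then obtain p' \<pi> where p': "plen p' \<le> l" "pt p' 0 \<le> n" "psize p = Suc (psize p')"
    and \<pi>: "\<pi> permutes {..<l + n}" "sign \<pi> = -1" and eq: "\<And>c. c < l + n \<Longrightarrow> maya l p c = maya l p' (\<pi> c)"
    using remove_box[OF _ Suc(3,4)] by blast
  have "maya_sign l n p q = (fdet (l + n) (\<lambda>s c. if maya l q s = maya l p' (\<pi> c) then 1 else 0) :: 'r)"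
    unfolding maya_sign_def by (rule fdet_cong) (simp add: eq)
  also have "\<dots> = signof \<pi> * maya_sign l n p' q"
    unfolding maya_sign_def
    by (rule fdet_permute_cols[OF \<pi>(1), of "\<lambda>s c. if maya l q s = maya l p' c then 1 else 0"])
  also have "\<dots> = - maya_sign l n p' q" by (simp add: \<pi>(2))
  finally show ?case using Suc(1)[of p'] Suc(2) p' by simp
qed

lemma plist_Nil [simp]: "plist (Ptn []) = []"
  by (simp add: Ptn_inverse is_partition_def)
lemma pt_Nil [simp]: "pt (Ptn []) i = 0"
  by (simp add: pt_def part_def)
lemma plen_Nil [simp]: "plen (Ptn []) = 0"
  by (simp add: plen_def)

lemma maya_sign:
  assumes "plen p \<le> l" "pt p 0 \<le> n" "plen q \<le> l" "pt q 0 \<le> n"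
  shows "maya_sign l n p q = ((-1) ^ (psize p + psize q) :: 'r::comm_ring_1)"
proof -
  let ?e = "Ptn []"
  have one: "maya_sign l n ?e ?e = (1 :: 'r)"
  proof -
    have "bij_betw (maya l ?e) {..<l + n} {..<l + n}" by (rule maya_bij) auto
    hence "inj_on (maya l ?e) {..<l + n}" by (rule bij_betw_imp_inj_on)
    hence "maya_sign l n ?e ?e = fdet (l + n) (\<lambda>s c. if s = c then 1 else (0 :: 'r))"
      unfolding maya_sign_def by (intro fdet_cong) (auto simp: inj_on_def)
    thus ?thesis by (simp add: fdet_one)
  qed
  have "maya_sign l n p q = ((-1) ^ psize p * maya_sign l n ?e q :: 'r)"
    by (rule maya_sign_empty[OF assms(1,2)])
  also have "maya_sign l n ?e q = (maya_sign l n q ?e :: 'r)" by (rule maya_sign_sym)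
  also have "\<dots> = (-1) ^ psize q * maya_sign l n ?e ?e" by (rule maya_sign_empty[OF assms(3,4)])
  finally show ?thesis by (simp add: one power_add)
qed

section \<open>Complementary minors\<close>

lemma sum_maya:
  assumes "plen p \<le> l" "pt p 0 \<le> n"
  shows "(\<Sum>s<l + n. g (maya l p s)) = (\<Sum>u<l + n. g u)"
  using sum.reindex_bij_betw[OF maya_bij[OF assms]] .

text \<open>This is Jacobi's principle: when the rows of \<open>A\<close> are orthogonal to the
  columns of \<open>B\<close>, minors of \<open>A\<close> on a set of positions are proportional, up
  to sign, to minors of \<open>B\<close> on the complement. At the Maya diagram of \<open>p\<close>
  both minors are unitriangular, which fixes the constant.\<close>

lemma complementary_minors:
  fixes \<phi> \<chi> :: "nat \<Rightarrow> 'r::comm_ring_1 fps"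
  assumes p: "plen p \<le> l" "pt p 0 \<le> n" and q: "plen q \<le> l" "pt q 0 \<le> n"
    and \<phi>0: "\<And>i. fps_nth (\<phi> i) 0 = 1" and \<chi>0: "\<And>j. fps_nth (\<chi> j) 0 = 1"
    and orth: "\<And>i j. i < l \<Longrightarrow> j < n \<Longrightarrow> zcoeff (\<phi> i * \<chi> j) (int (maya l p i) - int (maya l p (l + j))) = 0"
  shows "fdet n (\<lambda>i j. zcoeff (\<chi> j) (int (maya l q (l + i)) - int (maya l p (l + j))))
    = (-1) ^ (psize p + psize q) * fdet l (\<lambda>i j. zcoeff (\<phi> i) (int (bead l p i) - int (bead l q j)))"
proof -
  let ?W = "l + n"
  define A where "A i u = zcoeff (\<phi> i) (int (bead l p i) - int u)" for i u
  define B where "B u j = zcoeff (\<chi> j) (int u - int (maya l p (l + j)))" for u j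
  \<comment> \<open>Columns of \<open>X\<close> and rows of \<open>Y\<close> follow the Maya diagram
    of \<open>q\<close>. The unit rows reduce the determinant of \<open>X\<close> to the minor at
    the beads of \<open>q\<close>; orthogonality makes the product \<open>X Y\<close> block
    triangular, with the minor at the gaps of \<open>q\<close> as its second block.\<close>
  define X where "X r s = (if r < l then A r (maya l q s) else if r = s then 1 else 0)" for r s
  define Y where "Y s c = (if c < l then if maya l q s = maya l p c then 1 else 0
      else B (maya l q s) (c - l))" for s c
  have mp: "maya l p i = bead l p i" "maya l q i = bead l q i" if "i < l" for i using that by (simp_all add: maya_def)
  have pW: "bead l p i < ?W" if "i < l" for i
    using bij_betwE[OF maya_bij[OF p]] that mp(1)[OF that] by (metis lessThan_iff trans_less_add1)
  have AB: "(\<Sum>u<?W. A i u * B u j) = 0" if "i < l" "j < n" for i j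
    unfolding A_def B_def zcoeff_mult_window[OF pW[OF that(1)]] using orth[OF that] mp(1)[OF that(1)] by simp
  have XY: "fdet ?W X * fdet ?W Y = fdet ?W (\<lambda>r c. \<Sum>s<?W. X r s * Y s c)" by (rule fdet_mult[symmetric])
  have 1: "(\<Sum>s<?W. X r s * Y s c) = (if c < l then A r (bead l p c) else 0)" if "r < l" "c < ?W" for r c
  proof (cases "c < l")
    case True
    have "(\<Sum>s<?W. X r s * Y s c) = (\<Sum>s<?W. A r (maya l q s) * (if maya l q s = maya l p c then 1 else 0))"
      using that True by (simp add: X_def Y_def)
    also have "\<dots> = (\<Sum>u<?W. A r u * (if u = maya l p c then 1 else 0))"
      by (rule sum_maya[OF q])
    also have "\<dots> = A r (bead l p c)" using pW[OF True] mp(1)[OF True] by (simp add: if_distrib cong: if_cong)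
    finally show ?thesis using True by simp
  next
    case False
    have "(\<Sum>s<?W. X r s * Y s c) = (\<Sum>s<?W. A r (maya l q s) * B (maya l q s) (c - l))"
      using that False by (simp add: X_def Y_def)
    also have "\<dots> = (\<Sum>u<?W. A r u * B u (c - l))" by (rule sum_maya[OF q])
    also have "\<dots> = 0" using that False by (intro AB) auto
    finally show ?thesis using False by simp
  qed
  have 2: "(\<Sum>s<?W. X r s * Y s c) = Y r c" if "r < ?W" "l \<le> r" for r c
  proof -
    have "(\<Sum>s<?W. X r s * Y s c) = (\<Sum>s<?W. if s = r then Y r c else 0)"
      using that by (intro sum.cong) (auto simp: X_def)
    thus ?thesis using that by simp
  qed
  have "fdet ?W (\<lambda>r c. \<Sum>s<?W. X r s * Y s c)
      = fdet l (\<lambda>r c. \<Sum>s<?W. X r s * Y s c) * fdet n (\<lambda>i j. \<Sum>s<?W. X (l + i) s * Y s (l + j))"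
    by (rule fdet_block) (simp add: 1)
  also have "fdet l (\<lambda>r c. \<Sum>s<?W. X r s * Y s c) = fdet l (\<lambda>r c. A r (bead l p c))"
    by (rule fdet_cong) (simp add: 1)
  also have "\<dots> = (\<Prod>i<l. A i (bead l p i))"
  proof (rule fdet_upper)
    fix i j assume "j < i" "i < l"
    hence "bead l p i < bead l p j" using pt_antimono[of j i p] by (auto simp: bead_def)
    thus "A i (bead l p j) = 0" by (simp add: A_def)
  qed
  also have "\<dots> = 1" by (simp add: A_def \<phi>0)
  also have "fdet n (\<lambda>i j. \<Sum>s<?W. X (l + i) s * Y s (l + j))
      = fdet n (\<lambda>i j. zcoeff (\<chi> j) (int (maya l q (l + i)) - int (maya l p (l + j))))"
    by (rule fdet_cong) (subst 2, auto simp: Y_def B_def)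
  finally have XYv: "fdet ?W X * fdet ?W Y
      = fdet n (\<lambda>i j. zcoeff (\<chi> j) (int (maya l q (l + i)) - int (maya l p (l + j))))"
    unfolding XY by simp
  have Xv: "fdet ?W X = fdet l (\<lambda>i j. zcoeff (\<phi> i) (int (bead l p i) - int (bead l q j)))"
  proof -
    have "fdet ?W X = fdet ?W (\<lambda>i j. X j i)" by (rule fdet_transpose[symmetric])
    also have "\<dots> = fdet l (\<lambda>i j. X j i) * fdet n (\<lambda>i j. X (l + j) (l + i))"
      by (rule fdet_block) (simp add: X_def)
    also have "fdet n (\<lambda>i j. X (l + j) (l + i)) = fdet n (\<lambda>i j. if i = j then 1 else 0)"
      by (rule fdet_cong) (simp add: X_def)
    also have "\<dots> = 1" by (rule fdet_one)
    also have "fdet l (\<lambda>i j. X j i) = fdet l X" by (rule fdet_transpose)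
    also have "\<dots> = fdet l (\<lambda>i j. zcoeff (\<phi> i) (int (bead l p i) - int (bead l q j)))"
      by (rule fdet_cong) (simp add: X_def A_def mp)
    finally show ?thesis by simp
  qed
  have Yv: "fdet ?W Y = (-1) ^ (psize p + psize q)"
  proof -
    \<comment> \<open>Listing the rows along the Maya diagram of \<open>p\<close> instead costs the
      sign and leaves a block triangular matrix with unit diagonal.\<close>
    define Y' where "Y' t c = (if c < l then if t = c then 1 else 0 else B (maya l p t) (c - l))" for t c
    have inj: "maya l p t = maya l p c \<longleftrightarrow> t = c" if "t < ?W" "c < ?W" for t c
      using bij_betw_imp_inj_on[OF maya_bij[OF p]] that by (auto simp: inj_on_def)
    have "fdet ?W Y = fdet ?W (\<lambda>s c. \<Sum>t<?W. (if maya l q s = maya l p t then 1 else 0) * Y' t c)"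
    proof (rule fdet_cong)
      fix s c assume sc: "s < ?W" "c < ?W"
      have "maya l q s \<in> {..<?W}" using bij_betwE[OF maya_bij[OF q]] sc by blast
      then obtain t0 where t0: "t0 < ?W" "maya l q s = maya l p t0"
        using bij_betw_imp_surj_on[OF maya_bij[OF p]] by (metis imageE lessThan_iff)
      have "(\<Sum>t<?W. (if maya l q s = maya l p t then 1 else 0) * Y' t c) = (\<Sum>t<?W. if t = t0 then Y' t0 c else 0)"
        using t0 inj by (intro sum.cong) auto
      also have "\<dots> = Y' t0 c" using t0 by simp
      also have "\<dots> = Y s c" using t0 inj sc by (auto simp: Y'_def Y_def)
      finally show "Y s c = (\<Sum>t<?W. (if maya l q s = maya l p t then 1 else 0) * Y' t c)" by simp
    qed
    also have "\<dots> = maya_sign l n p q * fdet ?W Y'"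
      unfolding maya_sign_def by (rule fdet_mult)
    also have "fdet ?W Y' = 1"
    proof -
      have "fdet ?W Y' = fdet ?W (\<lambda>i j. Y' j i)" by (rule fdet_transpose[symmetric])
      also have "\<dots> = fdet l (\<lambda>i j. Y' j i) * fdet n (\<lambda>i j. Y' (l + j) (l + i))"
        by (rule fdet_block) (auto simp: Y'_def)
      also have "fdet l (\<lambda>i j. Y' j i) = fdet l (\<lambda>i j. if i = j then 1 else 0)"
        by (rule fdet_cong) (auto simp: Y'_def)
      also have "\<dots> = 1" by (rule fdet_one)
      also have "fdet n (\<lambda>i j. Y' (l + j) (l + i)) = (\<Prod>i<n. Y' (l + i) (l + i))"
      proof (rule fdet_upper)
        fix i j assume "j < i" "i < n"
        have "pt (conj_ptn p) i \<le> pt (conj_ptn p) j" using \<open>j < i\<close> by (intro pt_antimono) simp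
        moreover have "pt (conj_ptn p) j \<le> l" using pt_conj_ptn_le[of p j] p(1) by simp
        ultimately have "maya l p (l + j) < maya l p (l + i)" using \<open>j < i\<close> by (simp add: maya_def)
        thus "Y' (l + j) (l + i) = 0" by (simp add: Y'_def B_def)
      qed
      also have "\<dots> = 1" by (simp add: Y'_def B_def \<chi>0)
      finally show ?thesis by simp
    qed
    finally show ?thesis by (simp add: maya_sign[OF p q])
  qed
  show ?thesis using XYv unfolding Xv Yv by (simp add: mult.commute)
qed

section \<open>Conjugation of Jacobi--Trudi matrices\<close>

definition neg_arg :: "'r::comm_ring_1 fps \<Rightarrow> 'r fps" where
  "neg_arg f = Abs_fps (\<lambda>n. (-1) ^ n * fps_nth f n)"

lemma neg_arg_nth [simp]: "fps_nth (neg_arg f) n = (-1) ^ n * fps_nth f n"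
  by (simp add: neg_arg_def)
lemma neg_arg_one [simp]: "neg_arg 1 = 1"
  by (rule fps_ext) (simp add: fps_one_nth)
lemma neg_arg_mult: "neg_arg (f * g) = neg_arg f * neg_arg g"
proof (rule fps_ext)
  fix n
  have "(-1) ^ n * (fps_nth f i * fps_nth g (n - i)) = (-1) ^ i * fps_nth f i * ((-1) ^ (n - i) * fps_nth g (n - i))"
    if "i \<le> n" for i
  proof -
    have "(-1 :: 'a) ^ n = (-1) ^ i * (-1) ^ (n - i)" using that by (simp flip: power_add)
    thus ?thesis by (simp only: mult_ac)
  qed
  thus "fps_nth (neg_arg (f * g)) n = fps_nth (neg_arg f * neg_arg g) n"
    by (simp add: fps_mult_nth sum_distrib_left)
qed
lemma neg_arg_geo [simp]: "neg_arg (geo a) = geo (- a)"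
  by (rule fps_ext) (simp add: power_minus[of a])
lemma neg_arg_lin [simp]: "neg_arg (lin a) = lin (- a)"
  by (rule fps_ext) (simp add: lin_nth)
lemma neg_arg_prod: "neg_arg (prod f A) = (\<Prod>i\<in>A. neg_arg (f i))"
  by (induction A rule: infinite_finite_induct) (simp_all add: neg_arg_mult)
lemma neg_arg_geos: "neg_arg (geos c n) = geos (\<lambda>k. - c k) n" and neg_arg_lins: "neg_arg (lins c n) = lins (\<lambda>k. - c k) n"
  by (simp_all add: geos_def lins_def neg_arg_prod)

lemma fdet_scale: "fdet n (\<lambda>i j. r i * s j * F i j) = (\<Prod>i<n. r i) * (\<Prod>j<n. s j) * fdet n F"
proof -
  have "(\<Prod>i<n. r i * s (\<pi> i) * F i (\<pi> i)) = (\<Prod>i<n. r i) * (\<Prod>j<n. s j) * (\<Prod>i<n. F i (\<pi> i))"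
    if "\<pi> permutes {..<n}" for \<pi>
    using prod.permute[OF that, of s] by (simp add: prod.distrib o_def)
  thus ?thesis unfolding fdet_leibniz by (simp add: sum_distrib_left mult_ac)
qed

definition conj_mat :: "'a::comm_ring_1 pmat \<Rightarrow> 'a pmat" where
  "conj_mat A = Pmat (\<lambda>p q. ent A (conj_ptn p) (conj_ptn q))"

lemma ent_conj_mat [simp]: "ent (conj_mat A) p q = ent A (conj_ptn p) (conj_ptn q)"
proof -
  have "ordge (pdist p q) (ent A (conj_ptn p) (conj_ptn q))" for p q
    using ent_ordge[of "conj_ptn p" "conj_ptn q" A] by (simp add: pdist_def)
  thus ?thesis unfolding conj_mat_def by (subst ent_Pmat) auto
qed

lemma conj_mat_mult: "conj_mat (A * B) = conj_mat A * conj_mat B"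
proof (rule pmat_eqI, rule eqv_all)
  fix p q N
  let ?T = "{r. psize r \<le> psize p + N}"
  have "eqv N (ent (conj_mat (A * B)) p q) (\<Sum>r\<in>?T. ent A (conj_ptn p) r * ent B r (conj_ptn q))"
    unfolding ent_conj_mat by (rule ent_mult_size) simp
  also have "\<dots> = (\<Sum>r\<in>?T. ent (conj_mat A) p r * ent (conj_mat B) r q)"
    by (rule sum.reindex_bij_witness[of _ conj_ptn conj_ptn]) auto
  also have "eqv N \<dots> (ent (conj_mat A * conj_mat B) p q)"
    by (rule eqv_sym, rule ent_mult_size) simp
  finally show "eqv N (ent (conj_mat (A * B)) p q) (ent (conj_mat A * conj_mat B) p q)" .
qed

lemma conj_ptn_eq_iff [simp]: "conj_ptn p = conj_ptn q \<longleftrightarrow> p = q"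
  by (metis conj_ptn_conj_ptn)

lemma conj_mat_one [simp]: "conj_mat 1 = 1"
  by (rule pmat_eqI) (simp add: ent_one)

lemma conj_mat_tr: "conj_mat (tr A) = tr (conj_mat A)"
  by (rule pmat_eqI) simp

text \<open>Pair the row series of \<open>p\<close> with those of its conjugate at
  \<open>-z\<close>. For a cell of \<open>p\<close>, the factors \<open>H\<close> and
  \<open>H'\<close> cancel and so do the geometric factors, which leaves a polynomial of too small a
  degree; for any other place the exponent is negative. So complementary minors apply, and the signs
  of the Maya diagrams cancel those from \<open>-z\<close>.\<close>

lemma jt_mat_duality:
  assumes ab: "small a" "small b" and H: "filtered H" "fps_nth H 0 = 1" and H': "filtered H'" "fps_nth H' 0 = 1"
    and inv: "H * neg_arg H' = 1"
  shows "conj_mat (jt_mat (\<lambda>p i. H' * row_ser b a p i) unit_fam) = jt_mat (\<lambda>p i. H * row_ser a b p i) unit_fam"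
proof (rule pmat_eqI)
  fix p q
  define l where "l = max (plen p) (plen q)"
  define n where "n = max (pt p 0) (pt q 0)"
  have p: "plen p \<le> l" "pt p 0 \<le> n" and q: "plen q \<le> l" "pt q 0 \<le> n" by (auto simp: l_def n_def)
  have gH: "good (\<lambda>p i. H * row_ser a b p i)" "good (\<lambda>p i. H' * row_ser b a p i)"
    using good_mult[of "\<lambda>_ _. H" "row_ser a b"] good_mult[of "\<lambda>_ _. H'" "row_ser b a"] ab H H'
    by (simp_all add: good_const good_row_ser)
  define \<phi> where "\<phi> i = H * row_ser a b p i" for i
  define \<chi> where "\<chi> j = neg_arg (H' * row_ser b a (conj_ptn p) j)" for j
  have \<chi>: "\<chi> j = neg_arg H' * (lins b (pt (conj_ptn p) j - 1) * geos (\<lambda>k. - a k) j)" for j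
    by (simp add: \<chi>_def row_ser_def neg_arg_mult neg_arg_geos neg_arg_lins)
  have maya_diff: "int (maya l q (l + i)) - int (maya l p (l + j))
      = int (pt (conj_ptn p) j) - int (pt (conj_ptn q) i) - int j + int i" for i j
    using pt_conj_ptn_le[of p j] pt_conj_ptn_le[of q i] p(1) q(1) by (simp add: maya_def)
  have orth: "zcoeff (\<phi> i * \<chi> j) (int (maya l p i) - int (maya l p (l + j))) = 0" if ij: "i < l" "j < n" for i j
  proof -
    have z: "int (maya l p i) - int (maya l p (l + j)) = int (pt p i) + int (pt (conj_ptn p) j) - int i - int j - 1"
      using ij pt_conj_ptn_le[of p j] p(1) by (simp add: maya_def bead_def)
    show ?thesis
    proof (cases "j < pt p i")
      case False
      hence "pt (conj_ptn p) j \<le> i" by (simp add: less_pt_conj_ptn flip: not_less)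
      thus ?thesis using False unfolding z by (intro zcoeff_neg) linarith
    next
      case True
      hence c: "i < pt (conj_ptn p) j" by (simp add: less_pt_conj_ptn)
      have "\<phi> i * \<chi> j = (H * neg_arg H') * ((geos (\<lambda>k. - a k) j * lins (\<lambda>k. - a k) (pt p i - 1))
          * (geos b i * lins b (pt (conj_ptn p) j - 1)))"
        by (simp only: \<phi>_def \<chi> row_ser_def mult_ac)
      also have "\<dots> = (\<Prod>k\<in>{j<..pt p i - 1}. lin (- a k)) * (\<Prod>k\<in>{i<..pt (conj_ptn p) j - 1}. lin (b k))"
        unfolding inv using True c by (subst (1 2) geos_lins_le) auto
      also have "deg_le (card {j<..pt p i - 1} + card {i<..pt (conj_ptn p) j - 1}) \<dots>"
        by (intro deg_le_mult deg_le_prod_lin) auto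
      \<comment> \<open>The degree is one less than the hook length, which is the exponent in question.\<close>
      finally have dg: "deg_le (card {j<..pt p i - 1} + card {i<..pt (conj_ptn p) j - 1}) (\<phi> i * \<chi> j)" .
      show ?thesis unfolding z by (rule deg_le_zcoeff[OF dg]) (use True c in simp)
    qed
  qed
  have main: "fdet n (\<lambda>i j. zcoeff (\<chi> j) (int (maya l q (l + i)) - int (maya l p (l + j))))
      = (-1) ^ (psize p + psize q) * fdet l (\<lambda>i j. zcoeff (\<phi> i) (int (bead l p i) - int (bead l q j)))"
    using p q _ _ orth
  proof (rule complementary_minors)
    show "fps_nth (\<phi> i) 0 = 1" for i using gH by (simp add: \<phi>_def good_def)
    show "fps_nth (\<chi> j) 0 = 1" for j using gH by (simp add: \<chi>_def good_def)
  qed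
  have cjl: "plen (conj_ptn p) \<le> n" "plen (conj_ptn q) \<le> n" using p q by (simp_all add: plen_conj_ptn)
  let ?\<psi> = "\<lambda>j. H' * row_ser b a (conj_ptn p) j"
  have "ent (conj_mat (jt_mat (\<lambda>p i. H' * row_ser b a p i) unit_fam)) p q
      = fdet n (\<lambda>i j. zcoeff (?\<psi> i) (int (pt (conj_ptn p) i) - int (pt (conj_ptn q) j) - int i + int j))"
    using gH cjl by (simp add: ent_jt_mat[of _ _ _ n] jt_det_def)
  also have "\<dots> = fdet n (\<lambda>i j. zcoeff (?\<psi> j) (int (pt (conj_ptn p) j) - int (pt (conj_ptn q) i) - int j + int i))"
    by (rule fdet_transpose[symmetric])
  \<comment> \<open>Scaling rows and columns by signs undoes the substitution of \<open>-z\<close>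
    that is built into \<open>\<chi>\<close>.\<close>
  also have "\<dots> = fdet n (\<lambda>i j. (-1) ^ (pt (conj_ptn q) i + i) * (-1) ^ (pt (conj_ptn p) j + j)
      * zcoeff (\<chi> j) (int (maya l q (l + i)) - int (maya l p (l + j))))"
  proof (rule fdet_cong)
    fix i j
    let ?z = "int (pt (conj_ptn p) j) - int (pt (conj_ptn q) i) - int j + int i"
    show "zcoeff (?\<psi> j) ?z = (-1) ^ (pt (conj_ptn q) i + i) * (-1) ^ (pt (conj_ptn p) j + j)
        * zcoeff (\<chi> j) (int (maya l q (l + i)) - int (maya l p (l + j)))"
    proof (cases "?z < 0")
      case True
      thus ?thesis unfolding maya_diff by simp
    next
      case False
      have ev: "even (nat ?z + (pt (conj_ptn q) i + i + (pt (conj_ptn p) j + j)))"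
      proof -
        have "int (nat ?z + (pt (conj_ptn q) i + i + (pt (conj_ptn p) j + j))) = 2 * (int (pt (conj_ptn p) j) + int i)"
          using False by simp
        hence "even (int (nat ?z + (pt (conj_ptn q) i + i + (pt (conj_ptn p) j + j))))" by (metis dvd_triv_left)
        thus ?thesis by (simp only: even_of_nat)
      qed
      have "(-1 :: (variable, 'a) mps) ^ (pt (conj_ptn q) i + i) * (-1) ^ (pt (conj_ptn p) j + j) * ((-1) ^ nat ?z * fps_nth (?\<psi> j) (nat ?z))
          = (-1) ^ (nat ?z + (pt (conj_ptn q) i + i + (pt (conj_ptn p) j + j))) * fps_nth (?\<psi> j) (nat ?z)"
        by (simp only: power_add mult_ac)
      also have "\<dots> = fps_nth (?\<psi> j) (nat ?z)" using ev by simp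
      finally show ?thesis using False unfolding maya_diff by (simp add: zcoeff_def \<chi>_def)
    qed
  qed
  also have "\<dots> = (\<Prod>i<n. (-1) ^ (pt (conj_ptn q) i + i)) * (\<Prod>j<n. (-1) ^ (pt (conj_ptn p) j + j))
      * fdet n (\<lambda>i j. zcoeff (\<chi> j) (int (maya l q (l + i)) - int (maya l p (l + j))))"
    by (rule fdet_scale)
  also have "(\<Prod>i<n. (-1) ^ (pt (conj_ptn q) i + i)) * (\<Prod>j<n. (-1) ^ (pt (conj_ptn p) j + j))
      = (-1 :: (variable, 'a) mps) ^ (psize p + psize q)"
  proof -
    have s: "(\<Sum>i<n. pt (conj_ptn r) i + i) = psize r + (\<Sum>i<n. i)" if "plen (conj_ptn r) \<le> n" for r
      using psize_sum[OF that] by (simp add: sum.distrib)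
    have "(\<Prod>i<n. (-1) ^ (pt (conj_ptn q) i + i)) * (\<Prod>j<n. (-1) ^ (pt (conj_ptn p) j + j))
        = (-1 :: (variable, 'a) mps) ^ (psize q + (\<Sum>i<n. i) + (psize p + (\<Sum>i<n. i)))"
      unfolding power_sum[symmetric] s[OF cjl(1)] s[OF cjl(2)] by (rule power_add[symmetric])
    \<comment> \<open>The staircase occurs once for the rows and once for the columns, so it drops
      out of the sign.\<close>
    also have "psize q + (\<Sum>i<n. i) + (psize p + (\<Sum>i<n. i)) = (psize p + psize q) + 2 * (\<Sum>i<n. i)" by simp
    also have "(-1 :: (variable, 'a) mps) ^ \<dots> = (-1) ^ (psize p + psize q)"
      by (simp only: power_add power_mult) simp
    finally show ?thesis .
  qed
  also have "(-1) ^ (psize p + psize q) * fdet n (\<lambda>i j. zcoeff (\<chi> j) (int (maya l q (l + i)) - int (maya l p (l + j))))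
      = fdet l (\<lambda>i j. zcoeff (\<phi> i) (int (bead l p i) - int (bead l q j)))"
    unfolding main by (simp add: mult.assoc[symmetric] flip: power_add)
  also have "\<dots> = ent (jt_mat (\<lambda>p i. H * row_ser a b p i) unit_fam) p q"
    using gH p q by (simp add: ent_jt_mat[of _ _ _ l] jt_det_bead \<phi>_def)
  finally show "ent (conj_mat (jt_mat (\<lambda>p i. H' * row_ser b a p i) unit_fam)) p q
      = ent (jt_mat (\<lambda>p i. H * row_ser a b p i) unit_fam) p q" .
qed

lemma conj_mat_g_to_schur: "small a \<Longrightarrow> small b \<Longrightarrow> conj_mat (g_to_schur b a) = g_to_schur a b"
  using jt_mat_duality[of a b 1 1] by (simp add: g_to_schur_def)

lemma lin_zero: "lin 0 = 1" and geo_zero: "geo 0 = 1"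
  by (rule fps_ext; simp add: lin_nth fps_one_nth power_0_left)+

lemma row_ser_zero: "row_ser (\<lambda>_. 0) (\<lambda>_. 0) = unit_fam"
  by (simp add: row_ser_def fun_eq_iff lins_def geos_def lin_zero geo_zero)

text \<open>This is the duality at vanishing parameters, where all row series are 1.\<close>

lemma conj_mat_schur:
  assumes "filtered H" "fps_nth H 0 = 1" "filtered H'" "fps_nth H' 0 = 1" "H * neg_arg H' = 1"
  shows "conj_mat (schur H') = schur H"
  using jt_mat_duality[of "\<lambda>_. 0" "\<lambda>_. 0" H H'] assms by (simp add: schur_def row_ser_zero small_def)

text \<open>Conjugation respects products, so it fixes the inverse of a matrix that it fixes up to
  the exchange of parameters.\<close>

lemma conj_mat_schur_to_g:
  assumes "small a" "small b"
  shows "conj_mat (schur_to_g b a) = schur_to_g a b"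
proof -
  have "g_to_schur a b * conj_mat (schur_to_g b a) = 1"
    using g_to_schur_schur_to_g[OF assms(2,1)] conj_mat_g_to_schur[OF assms] by (metis conj_mat_mult conj_mat_one)
  hence "schur_to_g a b * (g_to_schur a b * conj_mat (schur_to_g b a)) = schur_to_g a b" by simp
  thus ?thesis using schur_to_g_g_to_schur[OF assms] by (simp flip: mult.assoc)
qed


section \<open>Generating functions of alphabets\<close>

definition alph_gf :: "'r::comm_ring_1 alphabet \<Rightarrow> 'r fps" where
  "alph_gf U = prod_list (map geo (fst U)) * prod_list (map lin (snd U))"

lemma compl_sym_0 [simp]: "compl_sym 0 xs = 1"
proof -
  have "{I. set_mset I \<subseteq> {..<length xs} \<and> size I = 0} = {{#}}" by auto
  thus ?thesis by (simp add: compl_sym_def)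
qed

lemma elem_sym_0 [simp]: "elem_sym 0 xs = 1"
proof -
  have "{I. I \<subseteq> {..<length xs} \<and> card I = 0} = {{}}" by (auto dest: finite_subset)
  thus ?thesis by (simp add: elem_sym_def)
qed

lemma finite_multisets: "finite {I. set_mset I \<subseteq> {..<n::nat} \<and> size I = k}"
proof (rule finite_subset)
  show "{I. set_mset I \<subseteq> {..<n} \<and> size I = k} \<subseteq> mset ` {xs. set xs \<subseteq> {..<n} \<and> length xs = k}"
  proof
    fix I assume I: "I \<in> {I. set_mset I \<subseteq> {..<n} \<and> size I = k}"
    obtain xs where "mset xs = I" by (metis ex_mset)
    thus "I \<in> mset ` {xs. set xs \<subseteq> {..<n} \<and> length xs = k}" using I by auto
  qed
qed (simp add: finite_lists_length_eq)

lemma compl_sym_Nil: "compl_sym (Suc k) [] = 0"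
  unfolding compl_sym_def by (rule sum.neutral) auto

text \<open>Either the last index does not occur in the multiset, or one copy of it is removed. It
  may then occur again, which is why \<open>xs @ [a]\<close> remains in the second term.\<close>

lemma compl_sym_snoc:
  "compl_sym (Suc k) (xs @ [a]) = compl_sym (Suc k) xs + a * compl_sym k (xs @ [a])"
proof -
  let ?n = "length xs"
  let ?M = "\<lambda>N k. {I. set_mset I \<subseteq> {..<N::nat} \<and> size I = k}"
  let ?w = "\<lambda>I. \<Prod>i\<in>#I. (xs @ [a]) ! i"
  have split: "?M (Suc ?n) (Suc k) = ?M ?n (Suc k) \<union> add_mset ?n ` ?M (Suc ?n) k"
  proof (rule Set.set_eqI, rule iffI)
    fix I assume I: "I \<in> ?M (Suc ?n) (Suc k)"
    show "I \<in> ?M ?n (Suc k) \<union> add_mset ?n ` ?M (Suc ?n) k"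
    proof (cases "?n \<in># I")
      case True
      hence eq: "I = add_mset ?n (I - {#?n#})" by simp
      have "I - {#?n#} \<in> ?M (Suc ?n) k" using I True
        by (auto simp: size_Diff_singleton dest: in_diffD)
      thus ?thesis using eq by blast
    next
      case False
      hence "set_mset I \<subseteq> {..<?n}" using I by (auto simp: less_Suc_eq)
      thus ?thesis using I by auto
    qed
  next
    fix I assume "I \<in> ?M ?n (Suc k) \<union> add_mset ?n ` ?M (Suc ?n) k"
    thus "I \<in> ?M (Suc ?n) (Suc k)" by auto
  qed
  have "compl_sym (Suc k) (xs @ [a]) = sum ?w (?M (Suc ?n) (Suc k))" by (simp add: compl_sym_def)
  also have "\<dots> = sum ?w (?M ?n (Suc k)) + sum ?w (add_mset ?n ` ?M (Suc ?n) k)"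
    unfolding split by (rule sum.union_disjoint) (auto simp: finite_multisets)
  also have "sum ?w (?M ?n (Suc k)) = compl_sym (Suc k) xs"
    unfolding compl_sym_def
  proof (rule sum.cong[OF refl], rule arg_cong[of _ _ prod_mset], rule image_mset_cong)
    fix I i assume "I \<in> ?M ?n (Suc k)" "i \<in># I"
    thus "(xs @ [a]) ! i = xs ! i" by (auto simp: nth_append)
  qed
  also have "sum ?w (add_mset ?n ` ?M (Suc ?n) k) = (\<Sum>I\<in>?M (Suc ?n) k. ?w (add_mset ?n I))"
    by (rule sum.reindex_cong[OF _ refl refl]) (simp add: inj_on_def)
  also have "\<dots> = a * compl_sym k (xs @ [a])"
    by (simp add: compl_sym_def sum_distrib_left)
  finally show ?thesis .
qed

lemma elem_sym_Nil: "elem_sym (Suc k) [] = 0"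
  unfolding elem_sym_def by (rule sum.neutral) auto

lemma elem_sym_snoc:
  "elem_sym (Suc k) (xs @ [a]) = elem_sym (Suc k) xs + a * elem_sym k xs"
proof -
  let ?n = "length xs"
  let ?M = "\<lambda>k. {I. I \<subseteq> {..<?n} \<and> card I = k}"
  let ?w = "\<lambda>I. \<Prod>i\<in>I. (xs @ [a]) ! i"
  have fin: "finite (?M k)" for k by (rule finite_subset[of _ "Pow {..<?n}"]) auto
  have split: "{I. I \<subseteq> {..<Suc ?n} \<and> card I = Suc k} = ?M (Suc k) \<union> insert ?n ` ?M k"
  proof (rule Set.set_eqI, rule iffI)
    fix I assume I: "I \<in> {I. I \<subseteq> {..<Suc ?n} \<and> card I = Suc k}"
    hence finI: "finite I" by (auto dest: finite_subset)
    show "I \<in> ?M (Suc k) \<union> insert ?n ` ?M k"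
    proof (cases "?n \<in> I")
      case True
      hence "I = insert ?n (I - {?n})" by auto
      moreover have "I - {?n} \<in> ?M k" using I True finI by (auto simp: less_Suc_eq)
      ultimately show ?thesis by blast
    next
      case False
      hence "I \<subseteq> {..<?n}" using I by (auto simp: less_Suc_eq)
      thus ?thesis using I by auto
    qed
  next
    fix I assume "I \<in> ?M (Suc k) \<union> insert ?n ` ?M k"
    moreover have "card (insert ?n J) = Suc (card J)" if "J \<subseteq> {..<?n}" for J
      using that by (subst card_insert_disjoint) (auto dest: finite_subset)
    ultimately show "I \<in> {I. I \<subseteq> {..<Suc ?n} \<and> card I = Suc k}" by auto
  qed
  have "elem_sym (Suc k) (xs @ [a]) = sum ?w {I. I \<subseteq> {..<Suc ?n} \<and> card I = Suc k}" by (simp add: elem_sym_def)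
  also have "\<dots> = sum ?w (?M (Suc k)) + sum ?w (insert ?n ` ?M k)"
    unfolding split by (rule sum.union_disjoint) (auto simp: fin)
  also have "sum ?w (?M (Suc k)) = elem_sym (Suc k) xs"
    unfolding elem_sym_def by (intro sum.cong refl prod.cong) (auto simp: nth_append)
  also have "sum ?w (insert ?n ` ?M k) = (\<Sum>I\<in>?M k. ?w (insert ?n I))"
  proof (rule sum.reindex_cong[OF _ refl refl], rule inj_onI)
    fix I J assume "I \<in> ?M k" "J \<in> ?M k" and eq: "insert ?n I = insert ?n J"
    hence "?n \<notin> I" "?n \<notin> J" by auto
    thus "I = J" using eq by (metis insert_ident)
  qed
  also have "\<dots> = (\<Sum>I\<in>?M k. a * (\<Prod>i\<in>I. xs ! i))"
  proof (rule sum.cong[OF refl])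
    fix I assume I: "I \<in> ?M k"
    hence "finite I" "?n \<notin> I" by (auto dest: finite_subset)
    hence "?w (insert ?n I) = a * ?w I" by simp
    also have "?w I = (\<Prod>i\<in>I. xs ! i)" using I by (intro prod.cong) (auto simp: nth_append)
    finally show "?w (insert ?n I) = a * (\<Prod>i\<in>I. xs ! i)" .
  qed
  also have "\<dots> = a * elem_sym k xs" by (simp add: elem_sym_def sum_distrib_left)
  finally show ?thesis .
qed

lemma compl_sym_gf: "Abs_fps (\<lambda>k. compl_sym k xs) = prod_list (map geo xs)"
proof (induction xs rule: rev_induct)
  case Nil
  show ?case
  proof (rule fps_ext)
    fix n show "fps_nth (Abs_fps (\<lambda>k. compl_sym k [])) n = fps_nth (prod_list (map geo [])) n"
      by (cases n) (simp_all add: compl_sym_Nil)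
  qed
next
  case (snoc a xs)
  have "lin a * Abs_fps (\<lambda>k. compl_sym k (xs @ [a])) = Abs_fps (\<lambda>k. compl_sym k xs)"
  proof (rule fps_ext)
    fix n show "fps_nth (lin a * Abs_fps (\<lambda>k. compl_sym k (xs @ [a]))) n = fps_nth (Abs_fps (\<lambda>k. compl_sym k xs)) n"
      by (cases n) (simp_all add: lin_mult_nth_Suc compl_sym_snoc)
  qed
  hence "geo a * (lin a * Abs_fps (\<lambda>k. compl_sym k (xs @ [a]))) = geo a * prod_list (map geo xs)"
    using snoc by simp
  thus ?case by (simp add: mult.assoc[symmetric] mult.commute)
qed

lemma elem_sym_gf: "Abs_fps (\<lambda>k. (-1) ^ k * elem_sym k xs) = prod_list (map lin xs)"
proof (induction xs rule: rev_induct)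
  case Nil
  show ?case
  proof (rule fps_ext)
    fix n show "fps_nth (Abs_fps (\<lambda>k. (-1) ^ k * elem_sym k [])) n = fps_nth (prod_list (map lin [])) n"
      by (cases n) (simp_all add: elem_sym_Nil)
  qed
next
  case (snoc a xs)
  have "Abs_fps (\<lambda>k. (-1) ^ k * elem_sym k (xs @ [a])) = lin a * Abs_fps (\<lambda>k. (-1) ^ k * elem_sym k xs)"
  proof (rule fps_ext)
    fix n show "fps_nth (Abs_fps (\<lambda>k. (-1) ^ k * elem_sym k (xs @ [a]))) n
        = fps_nth (lin a * Abs_fps (\<lambda>k. (-1) ^ k * elem_sym k xs)) n"
      by (cases n) (simp_all add: lin_mult_nth_Suc elem_sym_snoc algebra_simps)
  qed
  thus ?case using snoc by (simp add: mult.commute)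
qed

lemma super_h_zcoeff: "super_h m U = zcoeff (alph_gf U) m"
proof (cases "m < 0")
  case False
  have "zcoeff (alph_gf U) m = (\<Sum>k\<le>nat m. compl_sym k (fst U) * ((-1) ^ (nat m - k) * elem_sym (nat m - k) (snd U)))"
    using False unfolding alph_gf_def compl_sym_gf[symmetric] elem_sym_gf[symmetric]
    by (simp add: zcoeff_def fps_mult_nth atLeast0AtMost)
  thus ?thesis using False by (simp add: super_h_def mult_ac)
qed (simp add: super_h_def)

lemma alph_gf_union: "alph_gf (U \<squnion>\<^sub>a T) = alph_gf U * alph_gf T"
  by (simp add: alph_gf_def alph_union_def mult_ac)

lemma prod_list_upto: "prod_list (map f [i..j]) = (\<Prod>k\<in>{i..j}. f k)"
  by (simp add: prod.distinct_set_conv_list[symmetric])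

lemma prod_upto_nat:
  "prod_list (map (\<lambda>k. f (nat k)) [max 1 i..j - 1]) = (\<Prod>k\<in>{nat (i - 1)<..nat (j - 1)}. f k)"
proof -
  have "prod_list (map (\<lambda>k. f (nat k)) [max 1 i..j - 1]) = (\<Prod>k\<in>{max 1 i..j - 1}. f (nat k))"
    by (rule prod_list_upto)
  also have "\<dots> = (\<Prod>k\<in>{nat (i - 1)<..nat (j - 1)}. f k)"
    by (rule prod.reindex_bij_witness[of _ int nat]) auto
  finally show ?thesis .
qed

text \<open>A negative letter contributes the inverse of a positive one, so the quotient of the
  products up to the two ends is right for reversed intervals as well. It separates the end given by
  the row from the end given by the column.\<close>

lemma alph_gf_seg: "alph_gf (alph_seg c i j) = geos c (nat (j - 1)) * lins c (nat (i - 1))"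
proof (cases "i \<le> j")
  case True
  have "alph_gf (alph_seg c i j) = (\<Prod>k\<in>{nat (i - 1)<..nat (j - 1)}. geo (c k))"
    using True prod_upto_nat[of "\<lambda>k. geo (c k)" i j] by (simp add: alph_gf_def alph_seg_def o_def)
  thus ?thesis using True geos_lins_ge[of "nat (i - 1)" "nat (j - 1)" c] by simp
next
  case False
  have "alph_gf (alph_seg c i j) = (\<Prod>k\<in>{nat (j - 1)<..nat (i - 1)}. lin (c k))"
    using False prod_upto_nat[of "\<lambda>k. lin (c k)" j i] by (simp add: alph_gf_def alph_seg_def o_def)
  thus ?thesis using False geos_lins_le[of "nat (j - 1)" "nat (i - 1)" c] by simp
qed

lemma alph_gf_vars: "alph_gf (alph_vars x n) = geos x n"
proof -
  have "prod_list (map (\<lambda>k. geo (x k)) [1..<Suc n]) = (\<Prod>k\<in>{1..<Suc n}. geo (x k))"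
    by (metis atLeastLessThan_upt distinct_upt prod.distinct_set_conv_list)
  thus ?thesis unfolding alph_gf_def alph_vars_def geos_def atLeastLessThanSuc_atLeastAtMost
    by (simp add: o_def del: upt_Suc)
qed

section \<open>Entries of the determinants of \<open>g\<close> and \<open>G\<close>\<close>

lemma g_entry:
  assumes "i < l" "j < l"
  shows "super_h (int (part (plist p) (Suc i)) - int (part (plist q) (Suc j)) - int (Suc i) + int (Suc j))
      (alph_vars x n \<squnion>\<^sub>a A_closed a (int (part (plist p) (Suc i))) (int (part (plist q) (Suc j)))
        \<squnion>\<^sub>a B_halfopen b (int (Suc j)) (int (Suc i)))
    = zcoeff (row_ser a b p i * (geos x n * col_ser a b q j)) (int (pt p i) - int (pt q j) - int i + int j)"
proof -
  have "nat (int k - 1) = k - 1" for k by (simp add: nat_diff_distrib')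
  hence gf: "alph_gf (alph_vars x n \<squnion>\<^sub>a A_closed a (int (pt p i)) (int (pt q j)) \<squnion>\<^sub>a B_halfopen b (int (Suc j)) (int (Suc i)))
      = row_ser a b p i * (geos x n * col_ser a b q j)"
    by (simp add: alph_gf_union alph_gf_vars A_closed_def B_halfopen_def alph_gf_seg row_ser_def col_ser_def mult_ac)
  have z: "int (pt p i) - int (pt q j) - int (Suc i) + int (Suc j) = int (pt p i) - int (pt q j) - int i + int j"
    by simp
  show ?thesis unfolding super_h_zcoeff pt_def[symmetric] gf z ..
qed

lemma g_fin_jt_mat:
  assumes "small x" "small a" "small b"
  shows "g_fin (plist p) (plist q) n x a b = ent (g_to_schur a b * schur (geos x n) * schur_to_g a b) p q"
proof -
  have H: "filtered (geos x n)" "fps_nth (geos x n) 0 = 1" using assms by (simp_all add: filtered_geos_small)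
  have gd: "good (row_ser a b)" "good (\<lambda>p i. geos x n * col_ser a b p i)"
    using good_mult[of "\<lambda>_ _. geos x n" "col_ser a b"] assms H by (simp_all add: good_row_ser good_col_ser good_const)
  have "g_fin (plist p) (plist q) n x a b
      = jt_det (max (plen p) (plen q)) (row_ser a b) (\<lambda>p i. geos x n * col_ser a b p i) p q"
    unfolding g_fin_def det1_fdet jt_det_def plen_def by (rule fdet_cong, rule g_entry)
  also have "\<dots> = ent (jt_mat (row_ser a b) (\<lambda>p i. geos x n * col_ser a b p i)) p q"
    by (rule ent_jt_mat_max[OF gd, symmetric])
  finally show ?thesis using jt_mat_factor(1)[OF assms(2,3) H] by simp
qed

text \<open>The pairs are parametrised by \<open>b\<close>, with \<open>zcoeff\<close> vanishing
  where \<open>a\<close> would be negative. The coefficient of index \<open>b\<close> for the second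
  alphabet has weight at least \<open>b\<close>, so the terms from \<open>N\<close> on
  disappear.\<close>

lemma h_dslash_eqv:
  assumes U: "filtered (alph_gf U)" and T: "filtered (alph_gf T)"
  shows "eqv N (h_dslash m U T) (\<Sum>b<N. zcoeff (alph_gf U) (m + int b) * fps_nth (alph_gf T) b)"
proof -
  let ?f = "\<lambda>b. zcoeff (alph_gf U) (m + int b) * fps_nth (alph_gf T) b"
  have tail: "ordge k (?f b)" if "k \<le> b" for b k
    using T that by (intro ordge_mult2) (auto simp: filtered_def intro: ordge_mono)
  obtain s where s: "\<And>n. eqv n s (\<Sum>b<n. ?f b)"
  proof (rule eqv_complete[of "\<lambda>n. \<Sum>b<n. ?f b"])
    show "eqv n (\<Sum>b<n. ?f b) (\<Sum>b<Suc n. ?f b)" for n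
      by (rule eqv_sym, rule eqv_sum_subset) (auto intro: tail)
  qed blast
  let ?A = "{(a :: nat, b :: nat). int a - int b = m}"
  let ?g = "\<lambda>(a :: nat, b :: nat). super_h (int a) U * super_h (int b) T"
  have "(?g has_sum s) ?A"
  proof (rule has_sum_mpsI)
    fix n
    let ?F = "?A \<inter> ({..nat (m + int n)} \<times> {..<n})"
    have "sum ?g ?F = (\<Sum>b\<in>{b. b < n \<and> m + int b \<ge> 0}. ?f b)"
      by (rule sum.reindex_bij_witness[of _ "\<lambda>b. (nat (m + int b), b)" snd])
        (auto simp: super_h_zcoeff)
    also have "\<dots> = (\<Sum>b<n. ?f b)"
    proof (rule sum.mono_neutral_left, simp, blast, rule ballI)
      fix b assume "b \<in> {..<n} - {b. b < n \<and> m + int b \<ge> 0}"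
      hence "m + int b < 0" by auto
      thus "?f b = 0" by simp
    qed
    finally have "eqv n (sum ?g ?F) s" using eqv_sym[OF s] by simp
    moreover have "ordge n (?g x)" if "x \<in> ?A - ?F" for x
    proof -
      obtain a b where x: "x = (a, b)" by (cases x)
      have "n \<le> b"
      proof (rule ccontr)
        assume "\<not> n \<le> b"
        hence "x \<in> ?F" using that x by auto
        thus False using that by simp
      qed
      hence "ordge n (fps_nth (alph_gf T) b)" using T by (auto simp: filtered_def intro: ordge_mono)
      thus ?thesis by (simp add: x super_h_zcoeff ordge_mult2)
    qed
    ultimately show "\<exists>F\<subseteq>?A. finite F \<and> eqv n (sum ?g F) s \<and> (\<forall>i\<in>?A - F. ordge n (?g i))"
      by (intro exI[of _ ?F]) auto
  qed
  hence "h_dslash m U T = s" unfolding h_dslash_def by (rule infsumI)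
  thus ?thesis using s by simp
qed


section \<open>Grothendieck functions as matrix entries\<close>

lemma sum_window_up:
  "(\<Sum>r<W. zcoeff u (int r - int P) * h r) = (\<Sum>s<W - P. fps_nth u s * h (P + s))"
proof -
  have "(\<Sum>r<W. zcoeff u (int r - int P) * h r) = (\<Sum>r\<in>{P..<W}. zcoeff u (int r - int P) * h r)"
    by (rule sum.mono_neutral_right) auto
  also have "\<dots> = (\<Sum>s<W - P. fps_nth u s * h (P + s))"
    by (rule sum.reindex_bij_witness[of _ "\<lambda>s. P + s" "\<lambda>r. r - P"]) (auto simp: zcoeff_def nat_diff_distrib')
  finally show ?thesis .
qed

lemma sum_window_down:
  assumes "Q < W"
  shows "(\<Sum>v<W. h v * zcoeff u (int Q - int v)) = (\<Sum>t<Suc Q. h (Q - t) * fps_nth u t)"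
proof -
  have "(\<Sum>v<W. h v * zcoeff u (int Q - int v)) = (\<Sum>v<Suc Q. h v * zcoeff u (int Q - int v))"
    using assms by (intro sum.mono_neutral_right) auto
  also have "\<dots> = (\<Sum>t<Suc Q. h (Q - t) * fps_nth u t)"
    by (rule sum.reindex_bij_witness[of _ "\<lambda>t. Q - t" "\<lambda>t. Q - t"]) (auto simp: zcoeff_def nat_diff_distrib')
  finally show ?thesis .
qed

text \<open>The coefficient of a series in \<open>z\<close> times \<open>U\<close> and
  \<open>V\<close> at \<open>1 / z\<close> is written as a product of three matrices, with
  \<open>U\<close> moving positions up and \<open>V\<close> moving them down. The upper end of the
  window only costs terms of weight \<open>N\<close> through \<open>U\<close>; the lower end is
  exact, because the degree of \<open>V\<close> is at most \<open>Q\<close>.\<close>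

lemma G_entry_window:
  fixes H U V :: "(variable, 'a::comm_ring_1) mps fps"
  assumes U: "filtered U" and V: "filtered V" "deg_le Q V" and W: "P + N \<le> W" "Q < W"
  shows "eqv N (\<Sum>t<N. zcoeff H (int P - int Q + int t) * fps_nth (U * V) t)
    (\<Sum>r<W. zcoeff U (int r - int P) * (\<Sum>v<W. zcoeff H (int r - int v) * zcoeff V (int Q - int v)))"
proof -
  define F where "F s t = zcoeff H (int P - int Q + int (s + t)) * (fps_nth U s * fps_nth V t)" for s t
  have Ford: "ordge N (F s t)" if "N \<le> s + t" for s t
    unfolding F_def using U V(1) that
    by (intro ordge_mult2 ordge_mono[OF ordge_mult]) (auto simp: filtered_def)
  \<comment> \<open>A square that contains both the triangle \<open>s + t < N\<close> and the
    rectangle cut out by the window.\<close>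
  define M where "M = W + Suc Q + N"
  let ?S = "\<lambda>A. sum (\<lambda>(s, t). F s t) A"
  have "(\<Sum>t<N. zcoeff H (int P - int Q + int t) * fps_nth (U * V) t) = (\<Sum>k<N. \<Sum>i\<le>k. F i (k - i))"
    by (simp add: fps_mult_nth atLeast0AtMost sum_distrib_left F_def)
  also have "\<dots> = ?S {(s, t). s + t < N}"
    by (rule sum.triangle_reindex[symmetric])
  also have "eqv N \<dots> (?S ({..<M} \<times> {..<M}))"
    by (rule eqv_sym, rule eqv_sum_subset) (auto simp: M_def intro: Ford)
  also have "eqv N \<dots> (?S ({..<W - P} \<times> {..<Suc Q}))"
  proof (rule eqv_sum_subset)
    fix z assume z: "z \<in> {..<M} \<times> {..<M} - {..<W - P} \<times> {..<Suc Q}"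
    obtain s t where st: "z = (s, t)" by (cases z)
    show "ordge N (case z of (s, t) \<Rightarrow> F s t)"
    proof (cases "t \<le> Q")
      case True
      hence "W - P \<le> s" using z st by auto
      thus ?thesis using W st by (auto intro: Ford)
    next
      case False
      hence "F s t = 0" using V(2) by (simp add: F_def deg_le_def)
      thus ?thesis using st by simp
    qed
  qed (use W in \<open>auto simp: M_def\<close>)
  also have "?S ({..<W - P} \<times> {..<Suc Q}) = (\<Sum>s<W - P. \<Sum>t<Suc Q. F s t)"
    by (rule sum.cartesian_product[symmetric])
  also have "\<dots> = (\<Sum>s<W - P. fps_nth U s * (\<Sum>t<Suc Q. zcoeff H (int (P + s) - int (Q - t)) * fps_nth V t))"
  proof (rule sum.cong[OF refl])
    fix s
    have "F s t = fps_nth U s * (zcoeff H (int (P + s) - int (Q - t)) * fps_nth V t)" if "t \<in> {..<Suc Q}" for t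
    proof -
      have "int P - int Q + int (s + t) = int (P + s) - int (Q - t)" using that by auto
      thus ?thesis unfolding F_def by (simp only: mult_ac)
    qed
    thus "(\<Sum>t<Suc Q. F s t) = fps_nth U s * (\<Sum>t<Suc Q. zcoeff H (int (P + s) - int (Q - t)) * fps_nth V t)"
      unfolding sum_distrib_left by (rule sum.cong[OF refl])
  qed
  also have "\<dots> = (\<Sum>r<W. zcoeff U (int r - int P) * (\<Sum>v<W. zcoeff H (int r - int v) * zcoeff V (int Q - int v)))"
    unfolding sum_window_up sum_window_down[OF W(2)] ..
  finally show ?thesis .
qed

lemma G_entry:
  "alph_gf (A_closed a (int (pt q j)) (int (pt p i)) \<squnion>\<^sub>a B_halfopen b (int (Suc i)) (int (Suc j)))
    = col_ser a b p i * row_ser a b q j"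
proof -
  have "nat (int k - 1) = k - 1" for k by (simp add: nat_diff_distrib')
  thus ?thesis by (simp add: alph_gf_union A_closed_def B_halfopen_def alph_gf_seg row_ser_def col_ser_def mult_ac)
qed

text \<open>Cauchy--Binet is applied twice. The inner sum is exact, since its partitions are
  contained in \<open>q\<close>; the outer sum loses only partitions at distance at least
  \<open>N\<close> from \<open>p\<close>.\<close>

lemma G_det_eqv:
  assumes x: "small x" and ab: "small a" "small b"
    and l: "psize p + N \<le> l" "plen q \<le> l" "0 < l"
  shows "eqv N (fdet l (\<lambda>i j. h_dslash (int (pt p i) - int (pt q j) - int (Suc i) + int (Suc j)) (alph_vars x n)
       (A_closed a (int (pt q j)) (int (pt p i)) \<squnion>\<^sub>a B_halfopen b (int (Suc i)) (int (Suc j)))))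
     (ent (tr (schur (geos b (l - 1)) * schur_to_g a b) * schur (geos x n) * tr (g_to_schur a b * schur (lins b (l - 1)))) p q)"
proof -
  let ?T = "\<lambda>i j. A_closed a (int (pt q j)) (int (pt p i)) \<squnion>\<^sub>a B_halfopen b (int (Suc i)) (int (Suc j))"
  let ?h = "\<lambda>i j. h_dslash (int (pt p i) - int (pt q j) - int (Suc i) + int (Suc j)) (alph_vars x n) (?T i j)"
  define H where "H = geos x n"
  \<comment> \<open>Moving \<open>geos b (l - 1)\<close> from the column series to the row series leaves polynomials \<open>V j\<close> whose
    degrees keep the Cauchy--Binet summation inside partitions with at most \<open>l\<close> rows.\<close>
  define U where "U i = geos b (l - 1) * col_ser a b p i" for i
  define V where "V j = lins b (l - 1) * row_ser a b q j" for j
  \<comment> \<open>The box must be wide enough for every partition inside \<open>q\<close>, and a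
    partition outside it must exceed the size of \<open>p\<close> by \<open>N\<close>.\<close>
  define K where "K = psize p + N + pt q 0"
  define W where "W = l + K"
  have pl: "plen p \<le> l" using plen_le_psize[of p] l(1) by simp
  note gd = good_row_ser[OF ab] good_col_ser[OF ab]
  have hH: "filtered H" "fps_nth H 0 = 1" using x by (simp_all add: H_def filtered_geos_small)
  have hb: "filtered (geos b (l - 1))" "fps_nth (geos b (l - 1)) 0 = 1" "filtered (lins b (l - 1))" "fps_nth (lins b (l - 1)) 0 = 1"
    using ab by (simp_all add: filtered_geos_small filtered_lins_small)
  have gU: "good (\<lambda>p i. geos b (l - 1) * col_ser a b p i)" and gV: "good (\<lambda>p i. lins b (l - 1) * row_ser a b p i)"
    using good_mult[of "\<lambda>_ _. geos b (l - 1)" "col_ser a b"] good_mult[of "\<lambda>_ _. lins b (l - 1)" "row_ser a b"] gd hb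
    by (simp_all add: good_const)
  have hU: "filtered (U i)" and hV: "filtered (V i)" for i using gU gV by (auto simp: good_def U_def V_def)
  have UV: "col_ser a b p i * row_ser a b q j = U i * V j" for i j
  proof -
    have "U i * V j = (geos b (l - 1) * lins b (l - 1)) * (col_ser a b p i * row_ser a b q j)"
      by (simp only: U_def V_def mult_ac)
    thus ?thesis by simp
  qed
  have dV: "deg_le (bead l q j) (V j)" if "j < l" for j
  proof -
    have "V j = lins (\<lambda>k. - a k) (pt q j - 1) * (geos b j * lins b (l - 1))"
      by (simp only: V_def row_ser_def mult_ac)
    also have "\<dots> = lins (\<lambda>k. - a k) (pt q j - 1) * (\<Prod>k\<in>{j<..l - 1}. lin (b k))"
      using that by (subst geos_lins_le) auto
    also have "deg_le (card {1..pt q j - 1} + card {j<..l - 1}) \<dots>"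
      unfolding lins_def by (intro deg_le_mult deg_le_prod_lin) auto
    finally show ?thesis by (rule deg_le_mono) (simp add: bead_def)
  qed
  define A where "A i r = zcoeff (U i) (int r - int (bead l p i))" for i r
  define B where "B r j = (\<Sum>v<W. zcoeff H (int r - int v) * zcoeff (V j) (int (bead l q j) - int v))" for r j
  have entry: "eqv N (?h i j) (\<Sum>r<W. A i r * B r j)" if ij: "i < l" "j < l" for i j
  proof -
    have hT: "filtered (col_ser a b p i * row_ser a b q j)" using gd by (intro filtered_mult) (auto simp: good_def)
    have m: "int (pt p i) - int (pt q j) - int (Suc i) + int (Suc j) = int (bead l p i) - int (bead l q j)"
      using bead_diff[OF ij, of p q] by simp
    have "eqv N (h_dslash (int (bead l p i) - int (bead l q j)) (alph_vars x n) (?T i j))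
      (\<Sum>t<N. zcoeff H (int (bead l p i) - int (bead l q j) + int t) * fps_nth (U i * V j) t)"
      using h_dslash_eqv[of "alph_vars x n" "?T i j"]
        hH(1) hT unfolding alph_gf_vars G_entry H_def UV by simp
    also have "eqv N \<dots> (\<Sum>r<W. A i r * B r j)"
      unfolding A_def B_def
    proof (rule G_entry_window[OF hU hV dV[OF ij(2)]])
      show "bead l p i + N \<le> W" using pt_le_psize[of p i] ij by (simp add: bead_def W_def K_def)
      show "bead l q j < W" using pt_antimono[of 0 j q] ij by (simp add: bead_def W_def K_def)
    qed
    finally show ?thesis unfolding m .
  qed
  let ?A = "tr (schur (geos b (l - 1)) * schur_to_g a b)" and ?B = "schur H" and ?C = "tr (g_to_schur a b * schur (lins b (l - 1)))"
  have A1: "fdet l (\<lambda>i j. A i (bead l t j)) = ent ?A p t" if "t \<in> pbox l K" for t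
  proof -
    have "ent ?A p t = ent (jt_mat unit_fam (\<lambda>p i. geos b (l - 1) * col_ser a b p i)) t p"
      unfolding ent_tr jt_mat_factor(3)[OF ab hb(1,2)] ..
    also have "\<dots> = fdet l (\<lambda>i j. A j (bead l t i))"
      using that pl gU by (simp add: ent_jt_mat[of _ _ _ l] pbox_def jt_det_bead A_def U_def)
    also have "\<dots> = fdet l (\<lambda>i j. A i (bead l t j))" by (rule fdet_transpose)
    finally show ?thesis by simp
  qed
  have C1: "fdet l (\<lambda>i j. zcoeff (V j) (int (bead l q j) - int (bead l s i))) = ent ?C s q" if "s \<in> pbox l K" for s
  proof -
    have "ent ?C s q = ent (jt_mat (\<lambda>p i. lins b (l - 1) * row_ser a b p i) unit_fam) q s"
      unfolding ent_tr jt_mat_factor(2)[OF ab hb(3,4)] ..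
    also have "\<dots> = fdet l (\<lambda>i j. zcoeff (V i) (int (bead l q i) - int (bead l s j)))"
      using that l gV by (simp add: ent_jt_mat[of _ _ _ l] pbox_def jt_det_bead V_def)
    also have "\<dots> = fdet l (\<lambda>i j. zcoeff (V j) (int (bead l q j) - int (bead l s i)))" by (rule fdet_transpose[symmetric])
    finally show ?thesis by simp
  qed
  have B1: "fdet l (\<lambda>i j. zcoeff H (int (bead l t i) - int (bead l s j))) = ent ?B t s" if "t \<in> pbox l K" "s \<in> pbox l K" for t s
    using that hH by (simp add: schur_def ent_jt_mat[of _ _ _ l] pbox_def jt_det_bead good_const)
  have C0: "ent ?C s q = 0" if "s \<notin> pbox l K" for s
  proof -
    have "\<not> contained s q"
    proof
      assume c: "contained s q"
      hence "pt s 0 \<le> pt q 0" by (simp add: contained_def)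
      thus False using that contained_plen[OF c] l by (simp add: pbox_def K_def)
    qed
    thus ?thesis using gV jt_mat_factor(2)[OF ab hb(3,4)] by (metis ent_jt_mat_not_contained ent_tr good_unit)
  qed
  have BC: "fdet l (\<lambda>i j. B (bead l t i) j) = ent (?B * ?C) t q" if "t \<in> pbox l K" for t
  proof -
    have "fdet l (\<lambda>i j. B (bead l t i) j)
        = (\<Sum>s\<in>pbox l K. fdet l (\<lambda>i j. zcoeff H (int (bead l t i) - int (bead l s j)))
            * fdet l (\<lambda>i j. zcoeff (V j) (int (bead l q j) - int (bead l s i))))"
      unfolding B_def W_def
      by (rule Cauchy_Binet_pbox[where A = "\<lambda>i v. zcoeff H (int (bead l t i) - int v)"
            and B = "\<lambda>v j. zcoeff (V j) (int (bead l q j) - int v)"])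
    also have "\<dots> = (\<Sum>s\<in>pbox l K. ent ?B t s * ent ?C s q)"
      using that by (intro sum.cong refl) (simp only: B1 C1)
    also have "\<dots> = ent (?B * ?C) t q"
    proof (rule ent_mult_finite[symmetric])
      fix s assume "s \<notin> pbox l K"
      from C0[OF this] show "ent ?B t s * ent ?C s q = 0" by (simp only: mult_zero_right)
    qed simp
    finally show ?thesis .
  qed
  have "eqv N (fdet l ?h) (fdet l (\<lambda>i j. \<Sum>r<W. A i r * B r j))"
    by (rule fdet_eqv) (rule entry)
  also have "fdet l (\<lambda>i j. \<Sum>r<W. A i r * B r j)
      = (\<Sum>t\<in>pbox l K. fdet l (\<lambda>i j. A i (bead l t j)) * fdet l (\<lambda>i j. B (bead l t i) j))"
    unfolding W_def by (rule Cauchy_Binet_pbox)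
  also have "\<dots> = (\<Sum>t\<in>pbox l K. ent ?A p t * ent (?B * ?C) t q)"
    by (intro sum.cong refl) (simp only: A1 BC)
  also have "eqv N \<dots> (ent (?A * (?B * ?C)) p q)"
  proof (rule eqv_sym, rule ent_mult_approx)
    fix t assume "t \<notin> pbox l K"
    hence "N \<le> pdist p t"
      using plen_le_psize[of t] pt_le_psize[of t 0] l(1) by (auto simp: pbox_def pdist_def K_def)
    thus "ordge N (ent ?A p t * ent (?B * ?C) t q)"
      by (intro ordge_mult1 ordge_mono[OF ent_ordge])
  qed simp
  finally show ?thesis by (simp only: H_def mult.assoc)
qed

text \<open>The rows of the determinant involve only the first \<open>l - 1\<close> letters of
  \<open>b\<close> in their series. The prefactor of these letters is exactly what moves the
  transposed Schur matrix of \<open>b\<close> past that of \<open>x\<close>, where it meets its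
  inverse.\<close>

lemma G_jt_eqv:
  assumes x: "small x" and ab: "small a" "small b"
    and l: "psize p + N \<le> l" "plen q \<le> l" "0 < l"
  shows "eqv N (G_jt l (plist p) (plist q) n x a b) (ent (tr (schur_to_g a b) * schur (geos x n) * tr (g_to_schur a b)) p q)"
proof -
  define \<kappa> where "\<kappa> = (\<Prod>i\<in>{1..l - 1}. \<Prod>j\<in>{1..n}. 1 - b i * x j)"
  let ?M = "tr (schur (geos b (l - 1)) * schur_to_g a b) * schur (geos x n) * tr (g_to_schur a b * schur (lins b (l - 1)))"
  \<comment> \<open>The factors with index \<open>l\<close> are left over; they are 1 modulo
    \<open>N\<close>, as \<open>b l\<close> has weight above \<open>l\<close>.\<close>
  have "eqv N (\<Prod>i=1..l. \<Prod>j=1..n. 1 - b i * x j) (\<kappa> * 1)"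
  proof -
    have "(\<Prod>i=1..l. \<Prod>j=1..n. 1 - b i * x j) = \<kappa> * (\<Prod>j=1..n. 1 - b l * x j)"
      using l(3) by (cases l) (simp_all add: \<kappa>_def atLeastAtMostSuc_conv mult.commute)
    moreover have "eqv N (\<Prod>j=1..n. 1 - b l * x j) (\<Prod>j=1..n. 1)"
    proof (rule eqv_prod)
      fix j
      have "ordge (Suc l) (b l)" using ab(2) by (simp add: small_def)
      hence "ordge N (b l)" by (rule ordge_mono) (use l in simp)
      thus "eqv N (1 - b l * x j) 1" by (simp add: eqv_def ordge_mult1)
    qed
    ultimately show ?thesis by (metis eqv_mult eqv_refl prod.neutral_const)
  qed
  hence "eqv N (G_jt l (plist p) (plist q) n x a b) (\<kappa> * 1 * ent ?M p q)"
    unfolding G_jt_def det1_fdet pt_def[symmetric]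
    by (rule eqv_mult) (rule G_det_eqv[OF x ab l])
  also have "\<kappa> * 1 * ent ?M p q = ent (smul \<kappa> ?M) p q" by simp
  also have "smul \<kappa> ?M = tr (schur_to_g a b) * smul \<kappa> (tr (schur (geos b (l - 1))) * schur (geos x n)) * (tr (schur (lins b (l - 1))) * tr (g_to_schur a b))"
    by (simp add: tr_mult smul_mult_left smul_mult_right mult.assoc)
  also have "smul \<kappa> (tr (schur (geos b (l - 1))) * schur (geos x n)) = schur (geos x n) * tr (schur (geos b (l - 1)))"
    using skew_Cauchy[OF ab(2) x] by (simp add: commute_upto_def \<kappa>_def)
  also have "tr (schur_to_g a b) * (schur (geos x n) * tr (schur (geos b (l - 1)))) * (tr (schur (lins b (l - 1))) * tr (g_to_schur a b))
      = tr (schur_to_g a b) * schur (geos x n) * tr (schur (lins b (l - 1)) * schur (geos b (l - 1))) * tr (g_to_schur a b)"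
    by (simp add: tr_mult mult.assoc)
  also have "schur (lins b (l - 1)) * schur (geos b (l - 1)) = 1"
    using ab by (subst schur_mult) (auto simp: filtered_geos_small filtered_lins_small)
  finally show ?thesis by simp
qed

lemma G_fin_eq:
  assumes "small x" "small a" "small b"
  shows "G_fin (plist p) (plist q) n x a b = ent (tr (schur_to_g a b) * schur (geos x n) * tr (g_to_schur a b)) p q"
  unfolding G_fin_def
proof (rule lim_mpsI)
  fix N
  show "\<forall>\<^sub>F l in sequentially. eqv N (G_jt l (plist p) (plist q) n x a b) (ent (tr (schur_to_g a b) * schur (geos x n) * tr (g_to_schur a b)) p q)"
    by (rule eventually_sequentiallyI[of "Suc (psize p + N + plen q)"]) (rule G_jt_eqv[OF assms], auto)
qed

section \<open>Infinitely many variables\<close>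

lemma schur_geo_eqvm_one:
  assumes "ordge n x" "1 \<le> n"
  shows "eqvm n (schur (geo x)) 1"
  unfolding eqvm_def
proof (intro allI)
  fix p q
  have x: "ordge 1 x" using assms by (rule ordge_mono)
  show "eqv n (ent (schur (geo x)) p q) (ent 1 p q)"
  proof (cases "p = q")
    case True
    have "hstrip p p" by (simp add: hstrip_def pt_antimono)
    thus ?thesis using True by (simp add: ent_schur_geo[OF x] ent_one)
  next
    case False
    have "ordge n (x ^ (psize p - psize q))" if "hstrip p q"
    proof -
      have "psize q < psize p"
        using False contained_size_eq[OF hstrip_contained[OF that]] contained_psize[OF hstrip_contained[OF that]]
        by (auto simp: le_less)
      then obtain d where "psize p - psize q = Suc d" using less_imp_Suc_add[of "psize q" "psize p"] by auto
      thus ?thesis using assms(1) by (simp add: ordge_mult1)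
    qed
    thus ?thesis using False by (simp add: ent_schur_geo[OF x] ent_one eqv_zero_iff)
  qed
qed

lemma eqvm_mono: "eqvm N A B \<Longrightarrow> M \<le> N \<Longrightarrow> eqvm M A B"
  unfolding eqvm_def by (meson eqv_mono)

text \<open>The choice is unique, since the congruences determine a matrix.\<close>

definition schur_inf :: "(nat \<Rightarrow> (variable, 'a::comm_ring_1) mps) \<Rightarrow> 'a pmat" where
  "schur_inf x = (SOME B. \<forall>n. eqvm n B (schur (geos x n)))"

lemma schur_inf_eqvm:
  assumes "small x"
  shows "eqvm n (schur_inf x) (schur (geos x n))"
proof -
  have "eqvm n (schur (geos x n)) (schur (geos x (Suc n)))" for n
  proof -
    have "ordge (Suc (Suc n)) (x (Suc n))" using assms by (simp add: small_def)
    hence "eqvm (Suc n) (schur (geo (x (Suc n)))) 1" by (intro schur_geo_eqvm_one) (auto intro: ordge_mono)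
    hence "eqvm n (schur (geo (x (Suc n)))) 1" by (rule eqvm_mono) simp
    hence "eqvm n (schur (geos x n) * schur (geo (x (Suc n)))) (schur (geos x n) * 1)" by (intro eqvm_mult) simp_all
    thus ?thesis using schur_geos_Suc[OF assms] by (simp add: eqvm_sym)
  qed
  then obtain B where "\<And>n. eqvm n B (schur (geos x n))" by (rule eqvm_complete) blast
  hence "\<exists>B. \<forall>n. eqvm n B (schur (geos x n))" by blast
  hence "\<forall>n. eqvm n (schur_inf x) (schur (geos x n))" unfolding schur_inf_def by (rule someI_ex)
  thus ?thesis ..
qed

lemma lim_ent:
  assumes "\<And>n. eqvm n A (F n)"
  shows "lim (\<lambda>n. ent (F n) p q) = ent A p q"
proof (rule lim_mpsI)
  fix N
  have "eqv N (ent (F n) p q) (ent A p q)" if "N \<le> n" for n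
    using eqvm_sym[OF eqvm_mono[OF assms that]] by (simp add: eqvm_def)
  thus "\<forall>\<^sub>F n in sequentially. eqv N (ent (F n) p q) (ent A p q)"
    by (rule eventually_sequentiallyI)
qed

lemma G_fun_eq:
  assumes "small x" "small a" "small b"
  shows "G_fun (plist p) (plist q) x a b = ent (tr (schur_to_g a b) * schur_inf x * tr (g_to_schur a b)) p q"
  unfolding G_fun_def G_fin_eq[OF assms]
  by (rule lim_ent) (intro eqvm_mult eqvm_refl schur_inf_eqvm assms)

lemma g_fun_eq:
  assumes "small x" "small a" "small b"
  shows "g_fun (plist p) (plist q) x a b = ent (g_to_schur a b * schur_inf x * schur_to_g a b) p q"
  unfolding g_fun_def g_fin_jt_mat[OF assms]
  by (rule lim_ent) (intro eqvm_mult eqvm_refl schur_inf_eqvm assms)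

text \<open>A pair outside the square of side \<open>n\<close> has index sum at least
  \<open>n\<close>, so its factor is invisible modulo \<open>n\<close>.\<close>

lemma infprod_eqv:
  assumes f: "\<And>i j. eqv (i + j) (f (i, j)) 1"
  shows "eqv n (infprod f ({1..} \<times> {1..})) (\<Prod>i\<in>{1..n}. \<Prod>j\<in>{1..n}. f (i, j))"
proof -
  let ?B = "\<lambda>n. {1..n} \<times> {1..n::nat}"
  have out: "eqv n (f z) 1" if "z \<in> {1..} \<times> {1..} - ?B n" for z n
  proof -
    obtain i j where z: "z = (i, j)" by (cases z)
    have "n \<le> i + j" using that z by auto
    thus ?thesis using f[of i j] z by (auto intro: eqv_mono)
  qed
  obtain s where s: "\<And>n. eqv n s (prod f (?B n))"
  proof (rule eqv_complete[of "\<lambda>n. prod f (?B n)"])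
    show "eqv n (prod f (?B n)) (prod f (?B (Suc n)))" for n
      by (rule eqv_sym, rule eqv_prod_subset) (auto intro!: out)
  qed blast
  have "infprod f ({1..} \<times> {1..}) = s"
  proof (rule infprod_mpsI)
    fix N
    show "\<exists>F\<subseteq>{1..} \<times> {1..}. finite F \<and> eqv N (prod f F) s \<and> (\<forall>i\<in>{1..} \<times> {1..} - F. eqv N (f i) 1)"
      using out[of _ N] eqv_sym[OF s[of N]] by (intro exI[of _ "?B N"]) auto
  qed
  thus ?thesis using s[of n] by (simp add: prod.cartesian_product)
qed

lemma eqvm_conj_mat: "eqvm N A B \<Longrightarrow> eqvm N (conj_mat A) (conj_mat B)"
  by (simp add: eqvm_def)

text \<open>At each finite level the two matrices belong to the mutually inverse series
  \<open>lins x n\<close> and \<open>geos x n\<close>, by duality; the two products are then 1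
  modulo every \<open>n\<close>.\<close>

lemma schur_inf_conj_inverse:
  assumes x: "small x"
  shows "conj_mat (schur_inf (\<lambda>i. - x i)) * schur_inf x = 1" "schur_inf x * conj_mat (schur_inf (\<lambda>i. - x i)) = 1"
proof -
  have x': "small (\<lambda>i. - x i)" using x by (rule small_uminus)
  have h: "filtered (lins x n)" "filtered (geos x n)" "filtered (geos (\<lambda>i. - x i) n)" for n
    using x x' by (simp_all add: filtered_lins_small filtered_geos_small)
  have conj_ptn: "conj_mat (schur (geos (\<lambda>i. - x i) n)) = schur (lins x n)" for n
    by (rule conj_mat_schur) (simp_all add: h neg_arg_geos)
  have 1: "eqvm n (conj_mat (schur_inf (\<lambda>i. - x i))) (schur (lins x n))" for n
    using eqvm_conj_mat[OF schur_inf_eqvm[OF x', of n]] by (simp add: conj_ptn)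
  show "conj_mat (schur_inf (\<lambda>i. - x i)) * schur_inf x = 1"
  proof (rule eqvm_all)
    fix n
    have "eqvm n (conj_mat (schur_inf (\<lambda>i. - x i)) * schur_inf x) (schur (lins x n) * schur (geos x n))"
      by (intro eqvm_mult 1 schur_inf_eqvm x)
    also have "schur (lins x n) * schur (geos x n) = 1" by (subst schur_mult) (simp_all add: h)
    finally show "eqvm n (conj_mat (schur_inf (\<lambda>i. - x i)) * schur_inf x) 1" .
  qed
  show "schur_inf x * conj_mat (schur_inf (\<lambda>i. - x i)) = 1"
  proof (rule eqvm_all)
    fix n
    have "eqvm n (schur_inf x * conj_mat (schur_inf (\<lambda>i. - x i))) (schur (geos x n) * schur (lins x n))"
      by (intro eqvm_mult 1 schur_inf_eqvm x)
    also have "schur (geos x n) * schur (lins x n) = 1" by (subst schur_mult) (simp_all add: h)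
    finally show "eqvm n (schur_inf x * conj_mat (schur_inf (\<lambda>i. - x i))) 1" .
  qed
qed

lemma small_mult: "small x \<Longrightarrow> small y \<Longrightarrow> ordge (i + j + 2) (x i * y j)"
  using ordge_mult[of "Suc i" "x i" "Suc j" "y j"] by (simp add: small_def)

lemma skew_Cauchy_schur_inf:
  assumes x: "small x" and y: "small y"
  shows "tr (schur_inf x) * schur_inf y = smul (infprod (\<lambda>(i, j). 1 / (1 - x i * y j)) ({1..} \<times> {1..})) (schur_inf y * tr (schur_inf x))"
proof (rule eqvm_all)
  fix n
  let ?K = "infprod (\<lambda>(i, j). 1 / (1 - x i * y j)) ({1..} \<times> {1..})"
  define k where "k = (\<Prod>i\<in>{1..n}. \<Prod>j\<in>{1..n}. 1 - x i * y j)"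
  define k' where "k' = (\<Prod>i\<in>{1..n}. \<Prod>j\<in>{1..n}. 1 / (1 - x i * y j))"
  have inv: "(1 - x i * y j) * (1 / (1 - x i * y j)) = 1" "eqv (i + j + 2) (1 / (1 - x i * y j)) 1" for i j
    by (rule one_minus_inverse[OF small_mult[OF x y]]; simp)+
  have "k' * k = 1"
    unfolding k_def k'_def prod.distrib[symmetric] by (simp add: mult.commute[of "1 / _"] inv)
  have K: "eqv n ?K k'"
    unfolding k'_def using infprod_eqv[of "\<lambda>(i, j). 1 / (1 - x i * y j)" n] eqv_mono[OF inv(2)] by simp
  have "eqvm n (tr (schur_inf x) * schur_inf y) (tr (schur (geos x n)) * schur (geos y n))"
    by (intro eqvm_mult eqvm_tr schur_inf_eqvm x y)
  also have "tr (schur (geos x n)) * schur (geos y n) = smul (k' * k) (tr (schur (geos x n)) * schur (geos y n))"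
    by (simp add: \<open>k' * k = 1\<close>)
  also have "\<dots> = smul k' (schur (geos y n) * tr (schur (geos x n)))"
    using skew_Cauchy[OF x y, where n = n and m = n] by (simp add: commute_upto_def k_def flip: smul_smul)
  also have "eqvm n \<dots> (smul ?K (schur_inf y * tr (schur_inf x)))"
    by (intro eqvm_smul eqvm_mult eqvm_tr eqv_sym[OF K] eqvm_sym[OF schur_inf_eqvm] x y)
  finally show "eqvm n (tr (schur_inf x) * schur_inf y) (smul ?K (schur_inf y * tr (schur_inf x)))" .
qed

text \<open>Replacing \<open>x\<close> by \<open>-x\<close> turns \<open>1 - x i * y j\<close> into
  \<open>1 + x i * y j\<close>, and the finite identity is used in its polynomial form, so no
  inverse appears.\<close>

lemma skew_Cauchy_schur_inf_dual:
  assumes x: "small x" and y: "small y"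
  shows "schur_inf y * tr (schur_inf (\<lambda>i. - x i)) = smul (infprod (\<lambda>(i, j). 1 + x i * y j) ({1..} \<times> {1..})) (tr (schur_inf (\<lambda>i. - x i)) * schur_inf y)"
proof (rule eqvm_all)
  fix n
  let ?K = "infprod (\<lambda>(i, j). 1 + x i * y j) ({1..} \<times> {1..})"
  define k where "k = (\<Prod>i\<in>{1..n}. \<Prod>j\<in>{1..n}. 1 + x i * y j)"
  have x': "small (\<lambda>i. - x i)" using x by (rule small_uminus)
  have "eqv (i + j) (1 + x i * y j) 1" for i j
    using ordge_mono[OF small_mult[OF x y, of i j], of "i + j"] by (simp add: eqv_def)
  hence K: "eqv n ?K k"
    unfolding k_def using infprod_eqv[of "\<lambda>(i, j). 1 + x i * y j" n] by simp
  have "eqvm n (schur_inf y * tr (schur_inf (\<lambda>i. - x i))) (schur (geos y n) * tr (schur (geos (\<lambda>i. - x i) n)))"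
    by (intro eqvm_mult eqvm_tr schur_inf_eqvm x' y)
  also have "schur (geos y n) * tr (schur (geos (\<lambda>i. - x i) n)) = smul k (tr (schur (geos (\<lambda>i. - x i) n)) * schur (geos y n))"
    using skew_Cauchy[OF x' y, where n = n and m = n] by (simp add: commute_upto_def k_def)
  also have "eqvm n \<dots> (smul ?K (tr (schur_inf (\<lambda>i. - x i)) * schur_inf y))"
    by (intro eqvm_smul eqvm_mult eqvm_tr eqv_sym[OF K] eqvm_sym[OF schur_inf_eqvm] x' y)
  finally show "eqvm n (schur_inf y * tr (schur_inf (\<lambda>i. - x i))) (smul ?K (tr (schur_inf (\<lambda>i. - x i)) * schur_inf y))" .
qed

section \<open>The four summation identities\<close>

lemma has_sum_partitions:
  assumes "\<And>p q. f (plist p, plist q) = ent A a p * ent B p q * ent C q b"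
  shows "(f has_sum ent (A * B * C) a b) ({l. is_partition l} \<times> {l. is_partition l})"
proof -
  have "bij_betw (map_prod plist plist) (UNIV \<times> UNIV) ({l. is_partition l} \<times> {l. is_partition l})"
    by (intro bij_betw_map_prod bij_betw_imageI) (auto simp: inj_on_def plist_inject plist_partition
        image_iff intro: Ptn_inverse[symmetric])
  moreover have "((\<lambda>z. f (map_prod plist plist z)) has_sum ent (A * B * C) a b) (UNIV \<times> UNIV)"
    using has_sum_triple[of A a B C b] by (simp add: assms case_prod_unfold map_prod_def)
  ultimately show ?thesis using has_sum_reindex_bij_betw by blast
qed

theorem theorem4p8:
  fixes x y \<alpha> \<beta> :: "nat \<Rightarrow> (variable, 'a::comm_ring_1) mps"
    and \<mu> \<nu> :: "nat list"
  assumes "x = (\<lambda>i. Var_mps (X i))" and "y = (\<lambda>i. Var_mps (Y i))"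
    and "\<alpha> = (\<lambda>i. Var_mps (Alpha i))" and "\<beta> = (\<lambda>i. Var_mps (Beta i))"
    and "is_partition \<mu>" and "is_partition \<nu>"
  shows
    "((\<lambda>(lam, \<eta>). G_fun lam \<mu> x \<alpha> \<beta>
          * G_fun (conj_partition \<nu>) (conj_partition \<eta>) (\<lambda>i. - x i) \<beta> \<alpha>
          * g_fun lam \<eta> y \<alpha> \<beta>)
        has_sum
        (infprod (\<lambda>(i, j). 1 / (1 - x i * y j)) ({1..} \<times> {1..}) * g_fun \<mu> \<nu> y \<alpha> \<beta>))
      ({lam. is_partition lam} \<times> {\<eta>. is_partition \<eta>})
   \<and> ((\<lambda>(lam, \<eta>). g_fun lam \<mu> x \<alpha> \<beta>
          * g_fun (conj_partition \<nu>) (conj_partition \<eta>) (\<lambda>i. - x i) \<beta> \<alpha>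
          * G_fun lam \<eta> y \<alpha> \<beta>)
        has_sum
        (infprod (\<lambda>(i, j). 1 / (1 - x i * y j)) ({1..} \<times> {1..}) * G_fun \<mu> \<nu> y \<alpha> \<beta>))
      ({lam. is_partition lam} \<times> {\<eta>. is_partition \<eta>})
   \<and> ((\<lambda>(lam, \<eta>). G_fun (conj_partition lam) (conj_partition \<mu>) x \<beta> \<alpha>
          * G_fun \<nu> \<eta> (\<lambda>i. - x i) \<alpha> \<beta>
          * g_fun lam \<eta> y \<alpha> \<beta>)
        has_sum
        (infprod (\<lambda>(i, j). 1 + x i * y j) ({1..} \<times> {1..}) * g_fun \<mu> \<nu> y \<alpha> \<beta>))
      ({lam. is_partition lam} \<times> {\<eta>. is_partition \<eta>})
   \<and> ((\<lambda>(lam, \<eta>). g_fun (conj_partition lam) (conj_partition \<mu>) x \<beta> \<alpha>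
          * g_fun \<nu> \<eta> (\<lambda>i. - x i) \<alpha> \<beta>
          * G_fun lam \<eta> y \<alpha> \<beta>)
        has_sum
        (infprod (\<lambda>(i, j). 1 + x i * y j) ({1..} \<times> {1..}) * G_fun \<mu> \<nu> y \<alpha> \<beta>))
      ({lam. is_partition lam} \<times> {\<eta>. is_partition \<eta>})"
proof -
  have sm: "small x" "small y" "small \<alpha>" "small \<beta>"
    unfolding small_def assms(1-4) by (metis ordge_Var var_weight.simps)+
  have sx: "small (\<lambda>i. - x i)" using sm(1) by (rule small_uminus)
  obtain m v where m: "\<mu> = plist m" and v: "\<nu> = plist v"
    using assms(5,6) Ptn_inverse[of \<mu>] Ptn_inverse[of \<nu>] by (metis mem_Collect_eq)
  define c where "c = g_to_schur \<alpha> \<beta>"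
  define e where "e = schur_to_g \<alpha> \<beta>"
  define T where "T = schur_inf y"
  have ec: "e * c = 1" "tr c * tr e = 1"
    using schur_to_g_g_to_schur[OF sm(3,4)] by (simp_all add: c_def e_def flip: tr_mult)
  have cancel: "e * (c * M) = M" "tr c * (tr e * M) = M" for M
    using ec by (simp_all flip: mult.assoc)
  have Gv: "G_fun (plist p) (plist q) z \<alpha> \<beta> = ent (tr e * schur_inf z * tr c) p q"
    and gv: "g_fun (plist p) (plist q) z \<alpha> \<beta> = ent (c * schur_inf z * e) p q" if "small z" for z p q
    using G_fun_eq[OF that sm(3,4)] g_fun_eq[OF that sm(3,4)] by (simp_all add: c_def e_def)
  \<comment> \<open>Conjugation restores the order of the parameters in the change of basis, so only
    the Schur matrix remains conjugated.\<close>
  have Gc: "G_fun (conj_partition (plist p)) (conj_partition (plist q)) z \<beta> \<alpha> = ent (tr e * conj_mat (schur_inf z) * tr c) p q"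
    and gc: "g_fun (conj_partition (plist p)) (conj_partition (plist q)) z \<beta> \<alpha> = ent (c * conj_mat (schur_inf z) * e) p q"
    if "small z" for z p q
  proof -
    have "conj_mat (tr (schur_to_g \<beta> \<alpha>) * schur_inf z * tr (g_to_schur \<beta> \<alpha>)) = tr e * conj_mat (schur_inf z) * tr c"
      "conj_mat (g_to_schur \<beta> \<alpha> * schur_inf z * schur_to_g \<beta> \<alpha>) = c * conj_mat (schur_inf z) * e"
      by (simp_all add: conj_mat_mult conj_mat_tr conj_mat_g_to_schur[OF sm(3,4)] conj_mat_schur_to_g[OF sm(3,4)] c_def e_def)
    thus "G_fun (conj_partition (plist p)) (conj_partition (plist q)) z \<beta> \<alpha> = ent (tr e * conj_mat (schur_inf z) * tr c) p q"
      "g_fun (conj_partition (plist p)) (conj_partition (plist q)) z \<beta> \<alpha> = ent (c * conj_mat (schur_inf z) * e) p q"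
      using G_fun_eq[OF that sm(4,3), of "conj_ptn p" "conj_ptn q"] g_fun_eq[OF that sm(4,3), of "conj_ptn p" "conj_ptn q"]
      by (metis ent_conj_mat plist_conj_ptn)+
  qed
  define K where "K = infprod (\<lambda>(i, j). 1 / (1 - x i * y j)) ({1..} \<times> {1..})"
  define K' where "K' = infprod (\<lambda>(i, j). 1 + x i * y j) ({1..} \<times> {1..})"
  define R where "R = tr (schur_inf x)"
  define Q where "Q = tr (conj_mat (schur_inf (\<lambda>i. - x i)))"
  define R' where "R' = tr (schur_inf (\<lambda>i. - x i))"
  define Q' where "Q' = tr (conj_mat (schur_inf x))"
  have RQ: "R * Q = 1"
    using schur_inf_conj_inverse(1)[OF sm(1)] by (simp add: R_def Q_def flip: tr_mult)
  have QR': "Q' * R' = 1"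
    using schur_inf_conj_inverse(2)[OF sx] by (simp add: R'_def Q'_def flip: tr_mult)
  have RT: "R * T = smul K (T * R)"
    using skew_Cauchy_schur_inf[OF sm(1,2)] by (simp add: R_def T_def K_def)
  have TR': "T * R' = smul K' (R' * T)"
    using skew_Cauchy_schur_inf_dual[OF sm(1,2)] by (simp add: R'_def T_def K'_def)
  \<comment> \<open>The trailing \<open>M\<close> lets this rewrite inside products that are
    associated to the right.\<close>
  have RTQ: "R * (T * (Q * M)) = smul K (T * M)" for M
  proof -
    have "R * (T * (Q * M)) = R * T * (Q * M)" by (simp add: mult.assoc)
    also have "\<dots> = smul K (T * (R * Q) * M)" unfolding RT by (simp add: smul_mult_left mult.assoc)
    finally show ?thesis by (simp add: RQ)
  qed
  have QTR: "Q' * (T * (R' * M)) = smul K' (T * M)" for M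
  proof -
    have "Q' * (T * (R' * M)) = Q' * (T * R') * M" by (simp add: mult.assoc)
    also have "\<dots> = smul K' (Q' * R' * T * M)" unfolding TR' by (simp add: smul_mult_left smul_mult_right mult.assoc)
    finally show ?thesis by (simp add: QR')
  qed
  let ?P = "{lam. is_partition lam} \<times> {\<eta>. is_partition \<eta>}"
  \<comment> \<open>The outer indices of the matrix product are \<open>\<mu>\<close> and
    \<open>\<nu>\<close>, so the first two functions enter transposed and the third does not.
    Transposition turns the factors \<open>tr e\<close>, \<open>tr c\<close> of \<open>G\<close>
    into those of \<open>g\<close>, and conversely, so that neighbouring factors cancel.\<close>
  have 1: "((\<lambda>(lam, \<eta>). G_fun lam \<mu> x \<alpha> \<beta>
          * G_fun (conj_partition \<nu>) (conj_partition \<eta>) (\<lambda>i. - x i) \<beta> \<alpha> * g_fun lam \<eta> y \<alpha> \<beta>)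
        has_sum ent ((c * R * e) * (c * T * e) * (c * Q * e)) m v) ?P"
  proof (rule has_sum_partitions, unfold split_conv m v, goal_cases)
    case (1 p q)
    have "ent (c * R * e) m p = ent (tr e * schur_inf x * tr c) p m"
      "ent (c * Q * e) q v = ent (tr e * conj_mat (schur_inf (\<lambda>i. - x i)) * tr c) v q"
      by (subst ent_tr[symmetric], simp add: tr_mult mult.assoc R_def Q_def)+
    thus ?case unfolding Gv[OF sm(1)] Gc[OF sx] gv[OF sm(2)] T_def by (simp only: mult_ac)
  qed
  have 2: "((\<lambda>(lam, \<eta>). g_fun lam \<mu> x \<alpha> \<beta>
          * g_fun (conj_partition \<nu>) (conj_partition \<eta>) (\<lambda>i. - x i) \<beta> \<alpha> * G_fun lam \<eta> y \<alpha> \<beta>)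
        has_sum ent ((tr e * R * tr c) * (tr e * T * tr c) * (tr e * Q * tr c)) m v) ?P"
  proof (rule has_sum_partitions, unfold split_conv m v, goal_cases)
    case (1 p q)
    have "ent (tr e * R * tr c) m p = ent (c * schur_inf x * e) p m"
      "ent (tr e * Q * tr c) q v = ent (c * conj_mat (schur_inf (\<lambda>i. - x i)) * e) v q"
      by (subst ent_tr[symmetric], simp add: tr_mult mult.assoc R_def Q_def)+
    thus ?case unfolding gv[OF sm(1)] gc[OF sx] Gv[OF sm(2)] T_def by (simp only: mult_ac)
  qed
  have 3: "((\<lambda>(lam, \<eta>). G_fun (conj_partition lam) (conj_partition \<mu>) x \<beta> \<alpha>
          * G_fun \<nu> \<eta> (\<lambda>i. - x i) \<alpha> \<beta> * g_fun lam \<eta> y \<alpha> \<beta>)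
        has_sum ent ((c * Q' * e) * (c * T * e) * (c * R' * e)) m v) ?P"
  proof (rule has_sum_partitions, unfold split_conv m v, goal_cases)
    case (1 p q)
    have "ent (c * Q' * e) m p = ent (tr e * conj_mat (schur_inf x) * tr c) p m"
      "ent (c * R' * e) q v = ent (tr e * schur_inf (\<lambda>i. - x i) * tr c) v q"
      by (subst ent_tr[symmetric], simp add: tr_mult mult.assoc R'_def Q'_def)+
    thus ?case unfolding Gc[OF sm(1)] Gv[OF sx] gv[OF sm(2)] T_def by (simp only: mult_ac)
  qed
  have 4: "((\<lambda>(lam, \<eta>). g_fun (conj_partition lam) (conj_partition \<mu>) x \<beta> \<alpha>
          * g_fun \<nu> \<eta> (\<lambda>i. - x i) \<alpha> \<beta> * G_fun lam \<eta> y \<alpha> \<beta>)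
        has_sum ent ((tr e * Q' * tr c) * (tr e * T * tr c) * (tr e * R' * tr c)) m v) ?P"
  proof (rule has_sum_partitions, unfold split_conv m v, goal_cases)
    case (1 p q)
    have "ent (tr e * Q' * tr c) m p = ent (c * conj_mat (schur_inf x) * e) p m"
      "ent (tr e * R' * tr c) q v = ent (c * schur_inf (\<lambda>i. - x i) * e) v q"
      by (subst ent_tr[symmetric], simp add: tr_mult mult.assoc R'_def Q'_def)+
    thus ?case unfolding gc[OF sm(1)] gv[OF sx] Gv[OF sm(2)] T_def by (simp only: mult_ac)
  qed
  have "(c * R * e) * (c * T * e) * (c * Q * e) = smul K (c * T * e)"
    "(tr e * R * tr c) * (tr e * T * tr c) * (tr e * Q * tr c) = smul K (tr e * T * tr c)"
    "(c * Q' * e) * (c * T * e) * (c * R' * e) = smul K' (c * T * e)"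
    "(tr e * Q' * tr c) * (tr e * T * tr c) * (tr e * R' * tr c) = smul K' (tr e * T * tr c)"
    by (simp_all add: mult.assoc cancel RTQ QTR smul_mult_right)
  hence "ent ((c * R * e) * (c * T * e) * (c * Q * e)) m v = K * g_fun \<mu> \<nu> y \<alpha> \<beta>"
    "ent ((tr e * R * tr c) * (tr e * T * tr c) * (tr e * Q * tr c)) m v = K * G_fun \<mu> \<nu> y \<alpha> \<beta>"
    "ent ((c * Q' * e) * (c * T * e) * (c * R' * e)) m v = K' * g_fun \<mu> \<nu> y \<alpha> \<beta>"
    "ent ((tr e * Q' * tr c) * (tr e * T * tr c) * (tr e * R' * tr c)) m v = K' * G_fun \<mu> \<nu> y \<alpha> \<beta>"
    by (simp_all add: m v Gv[OF sm(2)] gv[OF sm(2)] T_def)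
  thus ?thesis using 1 2 3 4 by (simp only: K_def K'_def conj_assoc)
qed

end
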